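(* Let $\lambda$ be a contact form on a closed manifold $M$ and let $\mathfrak{R}$ be its Reeb foliation. Then the class $[d\lambda]$ is non-zero in the basic cohomology group $H^2_b(M;\mathfrak{R})$.
   Context: A contact form on a $(2n+1)$-manifold is a 1-form $\lambda$ with $\lambda\wedge(d\lambda)^n$ nowhere zero. Its Reeb foliation $\mathfrak{R}$ is the 1-dimensional foliation tangent to the line bundle $\{V\in TM:\iota_V d\lambda=0\}$. For a foliation $\mathfrak{F}$ of $M$, the space of basic $k$-forms is $\Omega^k_b=\{\alpha\in\Omega^k(M) : \iota_X\alpha=\iota_X d\alpha=0 \text{ for all } X\in T\mathfrak{F}\}$. The cohomology of the complex $(\Omega_b^*,d)$ is the basic cohomology $H^*_b(M;\mathfrak{F})$. The form $d\lambda$ is basic with respect to $\mathfrak{R}$. *)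

theory Defs
  imports
    "HOL-Analysis.Analysis"
    "HOL-Algebra.Coset"
    "HOL-Library.Function_Algebras"
begin

section \<open>Smooth maps between open subsets of Euclidean spaces\<close>

primrec Ck_on :: "nat \<Rightarrow> 'e::euclidean_space set \<Rightarrow> ('e \<Rightarrow> 'f::real_normed_vector) \<Rightarrow> bool" where
  "Ck_on 0 S f \<longleftrightarrow> continuous_on S f"
| "Ck_on (Suc k) S f \<longleftrightarrow>
     (\<forall>x\<in>S. f differentiable (at x)) \<and>
     (\<forall>v. Ck_on k S (\<lambda>x. frechet_derivative f (at x) v))"

definition smooth_on :: "'e::euclidean_space set \<Rightarrow> ('e \<Rightarrow> 'f::real_normed_vector) \<Rightarrow> bool" where
  "smooth_on S f \<longleftrightarrow> (\<forall>k. Ck_on k S f)"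

section \<open>Alternating forms on a Euclidean space\<close>

text \<open>A \<open>k\<close>-linear form is a function of sequences of vectors that only looks at the entries
  \<open>0, \<dots>, k - 1\<close>.  In particular, a \<open>0\<close>-form is a constant function.\<close>

type_synonym 'e mform = "(nat \<Rightarrow> 'e) \<Rightarrow> real"

definition alternating_form :: "nat \<Rightarrow> 'e::euclidean_space mform \<Rightarrow> bool" where
  "alternating_form k a \<longleftrightarrow>
     (\<forall>v w. (\<forall>i<k. v i = w i) \<longrightarrow> a v = a w) \<and>
     (\<forall>v. \<forall>i<k. linear (\<lambda>x. a (v(i := x)))) \<and>
     (\<forall>v. \<forall>i<k. \<forall>j<k. i \<noteq> j \<and> v i = v j \<longrightarrow> a v = 0)"

text \<open>The wedge product of a \<open>k\<close>-form and an \<open>l\<close>-form, in the convention where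
  \<open>dx\<^sub>1 \<and> \<dots> \<and> dx\<^sub>k\<close> is the determinant.\<close>

definition wedge :: "nat \<Rightarrow> nat \<Rightarrow> 'e mform \<Rightarrow> 'e mform \<Rightarrow> 'e mform" where
  "wedge k l a b = (\<lambda>v.
     (\<Sum>\<sigma> | \<sigma> permutes {..<k + l}.
        of_int (sign \<sigma>) * a (\<lambda>i. v (\<sigma> i)) * b (\<lambda>i. v (\<sigma> (k + i)))) / (fact k * fact l))"

primrec wedge_power :: "nat \<Rightarrow> 'e mform \<Rightarrow> nat \<Rightarrow> 'e mform" where
  "wedge_power k a 0 = (\<lambda>v. 1)"
| "wedge_power k a (Suc m) = wedge k (k * m) a (wedge_power k a m)"

text \<open>The contraction of a \<open>k\<close>-form with \<open>X\<close>; on \<open>0\<close>-forms it vanishes.\<close>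

definition contraction :: "nat \<Rightarrow> 'e \<Rightarrow> 'e mform \<Rightarrow> 'e mform" where
  "contraction k X a = (if k = 0 then 0 else (\<lambda>v. a (case_nat X v)))"

section \<open>Forms on open subsets of a Euclidean space\<close>

definition pullback ::
  "('e::euclidean_space \<Rightarrow> 'e) \<Rightarrow> ('e \<Rightarrow> 'e mform) \<Rightarrow> 'e \<Rightarrow> 'e mform" where
  "pullback f \<omega> x = (\<lambda>v. \<omega> (f x) (\<lambda>i. frechet_derivative f (at x) (v i)))"

text \<open>The exterior derivative of a \<open>k\<close>-form evaluated on constant vector fields:
  \<open>(d\<omega>)\<^sub>x(v\<^sub>0,\<dots>,v\<^sub>k)\<close> is the alternating sum over \<open>i\<close> of the derivative at \<open>x\<close> in
  direction \<open>v\<^sub>i\<close> of \<open>\<omega>(v\<^sub>0,\<dots>,v\<^sub>k)\<close> with \<open>v\<^sub>i\<close> omitted.\<close>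

definition ext_deriv_at :: "nat \<Rightarrow> ('e::euclidean_space \<Rightarrow> 'e mform) \<Rightarrow> 'e \<Rightarrow> 'e mform" where
  "ext_deriv_at k \<omega> x = (\<lambda>v.
     \<Sum>i\<le>k. (- 1) ^ i *
       frechet_derivative (\<lambda>y. \<omega> y (\<lambda>j. if j < i then v j else v (Suc j))) (at x) (v i))"

section \<open>Smooth manifolds\<close>

text \<open>A chart is a domain together with a coordinate map; values of the coordinate map outside
  the domain are irrelevant.\<close>

type_synonym ('a, 'e) chart = "'a set \<times> ('a \<Rightarrow> 'e)"

definition coord_dom :: "('a, 'e) chart \<Rightarrow> 'e set" where
  "coord_dom c = snd c ` fst c"

definition transition :: "('a, 'e) chart \<Rightarrow> ('a, 'e) chart \<Rightarrow> 'e \<Rightarrow> 'e" where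
  "transition c c' = (\<lambda>x. snd c' (inv_into (fst c) (snd c) x))"

definition smooth_atlas :: "'a topology \<Rightarrow> ('a, 'e::euclidean_space) chart set \<Rightarrow> bool" where
  "smooth_atlas T A \<longleftrightarrow>
     (\<Union>c\<in>A. fst c) = topspace T \<and>
     (\<forall>c\<in>A. openin T (fst c) \<and> open (coord_dom c) \<and>
        homeomorphic_map (subtopology T (fst c)) (top_of_set (coord_dom c)) (snd c)) \<and>
     (\<forall>c\<in>A. \<forall>c'\<in>A. smooth_on (snd c ` (fst c \<inter> fst c')) (transition c c'))"

definition smooth_manifold :: "'a topology \<Rightarrow> ('a, 'e::euclidean_space) chart set \<Rightarrow> bool" where
  "smooth_manifold T A \<longleftrightarrow> Hausdorff_space T \<and> second_countable T \<and> smooth_atlas T A"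

text \<open>Charts take values in open subsets of a Euclidean space, so there is no boundary.\<close>

definition closed_manifold :: "'a topology \<Rightarrow> ('a, 'e::euclidean_space) chart set \<Rightarrow> bool" where
  "closed_manifold T A \<longleftrightarrow> smooth_manifold T A \<and> compact_space T \<and> topspace T \<noteq> {}"

section \<open>Differential forms on a manifold\<close>

text \<open>A differential form is a family of smooth forms on the coordinate domains of the charts of
  the atlas that is compatible with the transition maps.  The value \<open>0\<close> outside the coordinate
  domains makes equality of forms equality of functions.\<close>

type_synonym ('a, 'e) dform = "('a, 'e) chart \<Rightarrow> 'e \<Rightarrow> 'e mform"

definition forms :: "('a, 'e::euclidean_space) chart set \<Rightarrow> nat \<Rightarrow> ('a, 'e) dform set" where
  "forms A k = {\<omega>.
     (\<forall>c x. \<not> (c \<in> A \<and> x \<in> coord_dom c) \<longrightarrow> \<omega> c x = 0) \<and>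
     (\<forall>c\<in>A. \<forall>x\<in>coord_dom c. alternating_form k (\<omega> c x)) \<and>
     (\<forall>c\<in>A. \<forall>v. smooth_on (coord_dom c) (\<lambda>x. \<omega> c x v)) \<and>
     (\<forall>c\<in>A. \<forall>c'\<in>A. \<forall>x\<in>snd c ` (fst c \<inter> fst c').
        \<omega> c x = pullback (transition c c') (\<omega> c') x)}"

definition ext_deriv ::
  "('a, 'e::euclidean_space) chart set \<Rightarrow> nat \<Rightarrow> ('a, 'e) dform \<Rightarrow> ('a, 'e) dform" where
  "ext_deriv A k \<omega> =
     (\<lambda>c x. if c \<in> A \<and> x \<in> coord_dom c then ext_deriv_at k (\<omega> c) x else 0)"

section \<open>Basic cohomology\<close>

text \<open>Basic forms depend on a foliation only through its tangent distribution, which is given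
  here by its fibres \<open>D c x\<close> in the coordinates of the charts \<open>c\<close>.\<close>

type_synonym ('a, 'e) distribution = "('a, 'e) chart \<Rightarrow> 'e \<Rightarrow> 'e set"

definition basic_forms ::
  "('a, 'e::euclidean_space) chart set \<Rightarrow> ('a, 'e) distribution \<Rightarrow> nat \<Rightarrow> ('a, 'e) dform set" where
  "basic_forms A D k = {\<alpha> \<in> forms A k.
     \<forall>c\<in>A. \<forall>x\<in>coord_dom c. \<forall>X\<in>D c x.
       contraction k X (\<alpha> c x) = 0 \<and> contraction (Suc k) X (ext_deriv A k \<alpha> c x) = 0}"

definition basic_cocycles ::
  "('a, 'e::euclidean_space) chart set \<Rightarrow> ('a, 'e) distribution \<Rightarrow> nat \<Rightarrow> ('a, 'e) dform monoid" where
  "basic_cocycles A D k =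
     \<lparr>carrier = {\<alpha> \<in> basic_forms A D k. ext_deriv A k \<alpha> = 0}, mult = (+), one = 0\<rparr>"

definition basic_coboundaries ::
  "('a, 'e::euclidean_space) chart set \<Rightarrow> ('a, 'e) distribution \<Rightarrow> nat \<Rightarrow> ('a, 'e) dform set" where
  "basic_coboundaries A D k =
     (case k of 0 \<Rightarrow> {0} | Suc j \<Rightarrow> ext_deriv A j ` basic_forms A D j)"

definition basic_cohomology ::
  "('a, 'e::euclidean_space) chart set \<Rightarrow> ('a, 'e) distribution \<Rightarrow> nat \<Rightarrow> ('a, 'e) dform set monoid" where
  "basic_cohomology A D k = basic_cocycles A D k Mod basic_coboundaries A D k"

definition basic_class ::
  "('a, 'e::euclidean_space) chart set \<Rightarrow> ('a, 'e) distribution \<Rightarrow> nat \<Rightarrow> ('a, 'e) dform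
     \<Rightarrow> ('a, 'e) dform set" where
  "basic_class A D k \<alpha> = basic_coboundaries A D k #>\<^bsub>basic_cocycles A D k\<^esub> \<alpha>"

section \<open>Contact forms\<close>

definition contact_form ::
  "('a, 'e::euclidean_space) chart set \<Rightarrow> nat \<Rightarrow> ('a, 'e) dform \<Rightarrow> bool" where
  "contact_form A n lam \<longleftrightarrow> DIM('e) = 2 * n + 1 \<and> lam \<in> forms A 1 \<and>
     (\<forall>c\<in>A. \<forall>x\<in>coord_dom c.
        wedge 1 (2 * n) (lam c x) (wedge_power 2 (ext_deriv A 1 lam c x) n) \<noteq> 0)"

text \<open>The tangent distribution of the Reeb foliation.\<close>

definition reeb :: "('a, 'e::euclidean_space) chart set \<Rightarrow> ('a, 'e) dform \<Rightarrow> ('a, 'e) distribution" where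
  "reeb A lam c x = {X. contraction 2 X (ext_deriv A 1 lam c x) = 0}"

end

theory Submission
  imports Defs "HOL-Combinatorics.Permutations"
begin

text \<open>Suppose \<open>d\<lambda> = d\<alpha>\<close> with \<open>\<alpha>\<close> basic, so that \<open>\<beta> = \<lambda> - \<alpha>\<close> is closed.  In odd dimension \<open>d\<lambda>\<close> has a
  kernel vector at each point, on which \<open>\<alpha>\<close> vanishes; hence \<open>\<alpha> \<and> (d\<lambda>)\<^sup>n = 0\<close> and
  \<open>\<beta> \<and> (d\<lambda>)\<^sup>n = \<lambda> \<and> (d\<lambda>)\<^sup>n\<close> is a volume form.  As \<open>\<beta>\<close> is closed, this volume form is
  \<open>- d(\<beta> \<and> \<lambda> \<and> (d\<lambda>)\<^sup>n\<^sup>-\<^sup>1)\<close>, which contradicts Stokes' theorem on a closed manifold.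

  The instance of Stokes' theorem is obtained from a partition of unity \<open>\<rho>\<^sub>i\<close>: for
  \<open>\<eta> = \<beta> \<and> \<lambda> \<and> (d\<lambda>)\<^sup>n\<^sup>-\<^sup>1\<close> each \<open>d(\<rho>\<^sub>i \<eta>)\<close> integrates to zero in its chart, and the change of variables
  formula allows one to integrate their sum \<open>d\<eta>\<close> over disjoint pieces of the manifold, each lying in a
  single chart.\<close>

text \<open>The exponent \<open>n - 1\<close> of \<eta> is where \<open>n \<ge> 1\<close> enters;
  for \<open>n = 0\<close> the form d\<lambda> is zero by dimension. The minus sign comes from
  moving d past the 1-form \<beta>. The product of \<alpha> with the power of d\<lambda> vanishes
  because a kernel vector is killed by every factor, and a top form whose contraction with one
  non-zero vector is zero is itself zero. The manifold comes with an atlas only, without orientation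
  or measure, so no integral over it is at hand. Two devices replace it. A top form is recorded in
  each chart by its value on one numbered basis, a real function that changes by the Jacobian; the
  volume form has no zeros, so its sign turns Jacobians into absolute values. Each point is assigned
  to the first chart of a finite cover that contains it, which makes the pieces Borel. The partition
  of unity is only C1, since a single derivative of it occurs. Normalising constants of wedge
  products are dropped, which leaves a factor \<open>- 1 / 2\<close> in front of the volume.\<close>

section \<open>Coordinates indexed by a finite well-ordered type\<close>

text \<open>The change of variables theorem of the library is stated for \<open>real ^ 'n\<close> with a well-ordered
  index type; indexing by the basis transports it to an arbitrary Euclidean space.\<close>

typedef (overloaded) 'e::euclidean_space basis_index = "Basis :: 'e set"
  morphisms basis_vec Abs_basis_index
  using nonempty_Basis by blast

instance basis_index :: (euclidean_space) finite
proof
  have "(UNIV :: 'a basis_index set) = Abs_basis_index ` Basis"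
    by (rule type_definition.univ[OF type_definition_basis_index])
  then show "finite (UNIV :: 'a basis_index set)" by (metis finite_Basis finite_imageI)
qed

text \<open>The order on the index type carries no meaning. It is pulled back along an arbitrary
  injection into the naturals so that the index type is well-ordered.\<close>

definition basis_rank :: "'e::euclidean_space basis_index \<Rightarrow> nat" where
  "basis_rank = (SOME f. inj f)"

lemma inj_basis_rank: "inj (basis_rank :: 'e::euclidean_space basis_index \<Rightarrow> nat)"
proof -
  obtain n and f :: "'e basis_index \<Rightarrow> nat" where "f ` UNIV = {i. i < n} \<and> inj_on f UNIV"
    using finite_imp_inj_to_nat_seg[OF finite_class.finite_UNIV] by blast
  then have "\<exists>f::'e basis_index \<Rightarrow> nat. inj f" by blast
  then show ?thesis unfolding basis_rank_def by (rule someI_ex)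
qed

instantiation basis_index :: (euclidean_space) wellorder
begin

definition "i \<le> j \<longleftrightarrow> basis_rank i \<le> basis_rank j"
definition "i < j \<longleftrightarrow> basis_rank i < basis_rank j"

instance
proof (intro_classes, goal_cases)
  case (1 i j)
  then show ?case unfolding less_eq_basis_index_def less_basis_index_def by (rule less_le_not_le)
next
  case (2 i)
  then show ?case unfolding less_eq_basis_index_def by (rule order_refl)
next
  case (3 i j k)
  then show ?case unfolding less_eq_basis_index_def by (rule order_trans)
next
  case (4 i j)
  then have "basis_rank i = basis_rank j" unfolding less_eq_basis_index_def by (rule order_antisym)
  then show ?case by (rule injD[OF inj_basis_rank])
next
  case (5 i j)
  then show ?case unfolding less_eq_basis_index_def by (rule linear)
next
  case (6 P i)
  show ?case
  proof (rule measure_induct_rule[of basis_rank P])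
    fix j :: "'a basis_index" assume "\<And>k. basis_rank k < basis_rank j \<Longrightarrow> P k"
    then show "P j" unfolding less_basis_index_def[symmetric] by (rule 6)
  qed
qed

end

lemma basis_vec_Basis [simp]: "basis_vec i \<in> Basis"
  by (rule basis_vec)

lemma bij_betw_basis_vec: "bij_betw basis_vec UNIV Basis"
  unfolding bij_betw_def
  using type_definition.Rep_range[OF type_definition_basis_index] by (simp add: inj_def basis_vec_inject)

lemma ball_Basis_iff: "(\<forall>b\<in>Basis. P b) \<longleftrightarrow> (\<forall>i. P (basis_vec i))"
proof (intro iffI ballI allI)
  fix b :: 'a assume *: "\<forall>i. P (basis_vec i)" and "b \<in> Basis"
  then obtain i where "b = basis_vec i" using basis_vec_cases by blast
  then show "P b" using * by simp
qed simp

lemma inner_basis_vec: "basis_vec i \<bullet> basis_vec j = (if i = j then 1 else 0)"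
  by (simp add: inner_Basis basis_vec_inject)

lemma CARD_basis_index: "CARD('e::euclidean_space basis_index) = DIM('e)"
  using bij_betw_same_card[OF bij_betw_basis_vec] .

section \<open>Identification of a Euclidean space with a Cartesian power of the reals\<close>

definition coords :: "'e::euclidean_space \<Rightarrow> real ^ 'e basis_index" where
  "coords x = (\<chi> i. x \<bullet> basis_vec i)"

definition of_coords :: "real ^ 'e basis_index \<Rightarrow> 'e::euclidean_space" where
  "of_coords w = (\<Sum>i\<in>UNIV. w $ i *\<^sub>R basis_vec i)"

lemma linear_coords: "linear coords"
  by (rule linearI) (simp_all add: coords_def vec_eq_iff inner_left_distrib)

lemma linear_of_coords: "linear of_coords"
  by (rule linearI) (simp_all add: of_coords_def scaleR_left_distrib sum.distrib scaleR_sum_right)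

lemma of_coords_coords [simp]: "of_coords (coords x) = x"
proof -
  have "of_coords (coords x) = (\<Sum>b\<in>Basis. (x \<bullet> b) *\<^sub>R b)"
    unfolding of_coords_def coords_def
    using sum.reindex_bij_betw[OF bij_betw_basis_vec, of "\<lambda>b. (x \<bullet> b) *\<^sub>R b"] by simp
  then show ?thesis by (simp add: euclidean_representation)
qed

lemma of_coords_inner_basis_vec [simp]: "of_coords w \<bullet> basis_vec i = w $ i"
  by (simp add: of_coords_def inner_sum_left inner_basis_vec if_distrib cong: if_cong)

lemma coords_of_coords [simp]: "coords (of_coords w) = w"
  by (simp add: coords_def vec_eq_iff)

lemma coords_nth: "coords x $ i = x \<bullet> basis_vec i"
  by (simp add: coords_def)

lemma coords_basis_vec: "coords (basis_vec i) = axis i 1"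
  by (simp add: coords_def vec_eq_iff inner_basis_vec axis_def)

lemma of_coords_axis: "of_coords (axis i 1) = basis_vec i"
  by (metis coords_basis_vec of_coords_coords)

lemma mem_coords_image [simp]: "w \<in> coords ` X \<longleftrightarrow> of_coords w \<in> X"
  by (metis coords_of_coords image_iff of_coords_coords)

lemma borel_measurable_coords [measurable]:
  "(coords :: 'e::euclidean_space \<Rightarrow> _) \<in> borel_measurable borel"
  by (intro borel_measurable_continuous_onI linear_continuous_on
      linear_conv_bounded_linear[THEN iffD1] linear_coords)

lemma borel_measurable_of_coords [measurable]:
  "(of_coords :: _ \<Rightarrow> 'e::euclidean_space) \<in> borel_measurable borel"
  by (intro borel_measurable_continuous_onI linear_continuous_on
      linear_conv_bounded_linear[THEN iffD1] linear_of_coords)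

text \<open>A measure with the right values on boxes is Lebesgue measure, and \<open>coords\<close>
  matches boxes with boxes of the same side lengths.\<close>

lemma distr_coords: "distr lborel borel coords = (lborel :: (real ^ 'e::euclidean_space basis_index) measure)"
proof (rule lborel_eqI[symmetric])
  fix l u :: "real ^ 'e basis_index"
  assume le: "\<And>b. b \<in> Basis \<Longrightarrow> l \<bullet> b \<le> u \<bullet> b"
  have le': "l $ i \<le> u $ i" for i
    using le[of "axis i 1"] by (simp add: inner_axis)
  have "(coords -` box l u :: 'e set) = box (of_coords l) (of_coords u)"
    by (auto simp: box_def ball_Basis_iff[where 'a = 'e] Basis_vec_def inner_axis coords_nth)
  then have "emeasure (distr lborel borel coords) (box l u)
      = emeasure lborel (box (of_coords l) (of_coords u) :: 'e set)"
    by (subst emeasure_distr) auto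
  also have "\<dots> = (\<Prod>b\<in>Basis. (of_coords u - of_coords l :: 'e) \<bullet> b)"
  proof (rule emeasure_lborel_box)
    have "\<forall>b\<in>Basis. (of_coords l :: 'e) \<bullet> b \<le> of_coords u \<bullet> b"
      unfolding ball_Basis_iff by (simp add: le')
    then show "(of_coords l :: 'e) \<bullet> b \<le> of_coords u \<bullet> b" if "b \<in> Basis" for b using that by blast
  qed
  also have "(\<Prod>b\<in>Basis. (of_coords u - of_coords l :: 'e) \<bullet> b) = (\<Prod>i\<in>UNIV. u $ i - l $ i)"
    using prod.reindex_bij_betw[OF bij_betw_basis_vec, of "\<lambda>b. (of_coords u - of_coords l :: 'e) \<bullet> b"]
    by (simp add: inner_diff_left)
  also have "\<dots> = (\<Prod>b\<in>Basis. (u - l) \<bullet> b)"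
  proof -
    have "bij_betw (\<lambda>i. axis i (1::real)) UNIV (Basis :: (real ^ 'e basis_index) set)"
      by (auto simp: bij_betw_def Basis_vec_def inj_on_def axis_eq_axis)
    from prod.reindex_bij_betw[OF this, of "\<lambda>b. (u - l) \<bullet> b"] show ?thesis
      by (simp add: inner_axis)
  qed
  finally show "emeasure (distr lborel borel coords) (box l u) = ennreal (\<Prod>b\<in>Basis. (u - l) \<bullet> b)" .
qed simp

section \<open>Change of variables in a Euclidean space\<close>

definition jacobian :: "('e::euclidean_space \<Rightarrow> 'e) \<Rightarrow> real" where
  "jacobian L = det (matrix (coords \<circ> L \<circ> of_coords))"

text \<open>The classical theorem speaks of integrability for the completed measure. Borel
  measurability of \<open>h\<close> is what brings its conclusion back to \<open>lborel\<close>; in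
  the application \<open>h\<close> is continuous, with a formula of its own, hence the separate
  name.\<close>

lemma change_of_variables_lborel:
  fixes f h :: "'e::euclidean_space \<Rightarrow> real" and g :: "'e \<Rightarrow> 'e"
  assumes S: "S \<in> sets borel" and gS: "g ` S \<in> sets borel"
    and der: "\<And>x. x \<in> S \<Longrightarrow> (g has_derivative g' x) (at x)"
    and inj: "inj_on g S"
    and h: "\<And>x. x \<in> S \<Longrightarrow> h x = \<bar>jacobian (g' x)\<bar> * f (g x)"
    and h_meas: "set_borel_measurable borel S h"
    and f_int: "set_integrable lborel (g ` S) f"
  shows "set_integrable lborel S h \<and>
    (LINT x:S|lborel. h x) = (LINT y:g ` S|lborel. f y)"
proof -
  have transfer: "(integrable (lborel :: (real ^ 'e basis_index) measure) (\<lambda>w. k (of_coords w)) \<longleftrightarrow> integrable lborel k) \<and>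
    integral\<^sup>L (lborel :: (real ^ 'e basis_index) measure) (\<lambda>w. k (of_coords w)) = integral\<^sup>L lborel k"
    if [measurable]: "k \<in> borel_measurable borel" for k :: "'e \<Rightarrow> real"
    using integrable_distr_eq[of coords lborel borel "\<lambda>w. k (of_coords w)"]
      integral_distr[of coords lborel borel "\<lambda>w. k (of_coords w)"]
    by (simp add: distr_coords)
  \<comment> \<open>For Borel integrands, passing to the completion changes neither integrability
    nor the integral.\<close>
  have abs: "(k absolutely_integrable_on X \<longleftrightarrow> set_integrable lborel X k) \<and>
     (set_integrable lborel X k \<longrightarrow> integral X k = (LINT x:X|lborel. k x))"
    if "set_borel_measurable borel X k" for k :: "real ^ 'e basis_index \<Rightarrow> real" and X
  proof -
    have 1: "(\<lambda>x. indicator X x *\<^sub>R k x) \<in> borel_measurable lborel"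
      using that by (simp add: set_borel_measurable_def)
    show ?thesis
      using integrable_completion[OF 1] set_borel_integral_eq_integral(2)[of X k]
      by (auto simp: set_integrable_def)
  qed
  let ?G = "coords \<circ> g \<circ> of_coords" and ?G' = "\<lambda>w. coords \<circ> g' (of_coords w) \<circ> of_coords"
  let ?S = "coords ` S" and ?F = "f \<circ> of_coords" and ?H = "h \<circ> of_coords"
  have GS: "?G ` ?S = coords ` g ` S" by (auto simp: image_comp)
  have ind: "indicator (coords ` X) w *\<^sub>R (k \<circ> of_coords) w = indicator X (of_coords w) *\<^sub>R k (of_coords w)"
    for X and k :: "'e \<Rightarrow> real" and w
    by (simp add: indicator_def)
  have S': "?S \<in> sets lebesgue"
  proof -
    have "?S = of_coords -` S" by auto
    moreover have "of_coords -` S \<in> sets borel"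
      using measurable_sets[OF borel_measurable_of_coords S] by simp
    ultimately show ?thesis by simp
  qed
  have bl: "bounded_linear (coords :: 'e \<Rightarrow> _)" "bounded_linear (of_coords :: _ \<Rightarrow> 'e)"
    using linear_coords linear_of_coords linear_conv_bounded_linear by blast+
  have der': "(?G has_derivative ?G' w) (at w within ?S)" if "w \<in> ?S" for w
  proof -
    have "of_coords w \<in> S" using that by auto
    then have "(g has_derivative g' (of_coords w)) (at (of_coords w))" by (rule der)
    then have "(?G has_derivative ?G' w) (at w)"
      unfolding comp_def
      using bounded_linear.has_derivative[OF bl(1)
          has_derivative_compose[OF bounded_linear_imp_has_derivative[OF bl(2)]]] by blast
    then show ?thesis by (rule has_derivative_at_withinI)
  qed
  have inj': "inj_on ?G ?S"
  proof (rule inj_onI)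
    fix v w assume vw: "v \<in> ?S" "w \<in> ?S" and "?G v = ?G w"
    then have "of_coords (?G v) = of_coords (?G w)" by simp
    then have "g (of_coords v) = g (of_coords w)" by simp
    then have "of_coords v = of_coords w" using vw inj by (simp add: inj_on_eq_iff)
    then have "coords (of_coords v) = coords (of_coords w)" by simp
    then show "v = w" by simp
  qed
  have fm: "(\<lambda>x. indicator (g ` S) x *\<^sub>R f x) \<in> borel_measurable borel"
    using f_int by (auto simp: set_integrable_def dest: borel_measurable_integrable)
  have hm: "(\<lambda>x. indicator S x *\<^sub>R h x) \<in> borel_measurable borel"
    using h_meas by (simp add: set_borel_measurable_def)
  have Fm: "set_borel_measurable borel (?G ` ?S) ?F"
    unfolding GS set_borel_measurable_def ind using fm by measurable
  have Hm: "set_borel_measurable borel ?S ?H"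
    unfolding set_borel_measurable_def ind using hm by measurable
  have Fi: "set_integrable lborel (?G ` ?S) ?F"
    using f_int transfer[OF fm] unfolding GS set_integrable_def ind by simp
  then have Fa: "?F absolutely_integrable_on (?G ` ?S)"
    using abs[OF Fm] by blast
  \<comment> \<open>The theorem integrates functions with values in a Cartesian power of the reals;
    real integrands pass through \<open>real ^ 1\<close>.\<close>
  have mult: "(vec (?H w) :: real^1) = \<bar>det (matrix (?G' w))\<bar> *\<^sub>R vec (?F (?G w))" if "w \<in> ?S" for w
    using that h by (auto simp: jacobian_def vec_eq_iff)
  have vec_int: "(\<lambda>x. vec (k x) :: real^1) absolutely_integrable_on X \<longleftrightarrow> k absolutely_integrable_on X"
    for k :: "real ^ 'e basis_index \<Rightarrow> real" and X
    by (simp add: absolutely_integrable_on_1_iff)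
  have vec_integral: "integral X (\<lambda>x. vec (k x) :: real^1) = vec (integral X k)"
    for k :: "real ^ 'e basis_index \<Rightarrow> real" and X
    by (simp add: integral_on_1_eq)
  have cov: "(\<lambda>w. \<bar>det (matrix (?G' w))\<bar> *\<^sub>R vec (?F (?G w)) :: real^1) absolutely_integrable_on ?S \<and>
      integral ?S (\<lambda>w. \<bar>det (matrix (?G' w))\<bar> *\<^sub>R vec (?F (?G w)) :: real^1) = vec (integral (?G ` ?S) ?F)"
    using has_absolute_integral_change_of_variables[OF S' der' inj',
        where f = "\<lambda>y. vec (?F y) :: real^1" and b = "vec (integral (?G ` ?S) ?F)"] Fa
    by (simp add: vec_int vec_integral comp_def)
  have "(\<lambda>w. vec (?H w) :: real^1) absolutely_integrable_on ?S"
    by (rule set_integrable_cong[OF refl refl mult, THEN iffD2]) (use cov in auto)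
  then have Ha: "?H absolutely_integrable_on ?S" by (simp only: vec_int)
  have "integral ?S (\<lambda>w. vec (?H w) :: real^1) = integral ?S (\<lambda>w. \<bar>det (matrix (?G' w))\<bar> *\<^sub>R vec (?F (?G w)))"
    by (rule integral_cong) (rule mult)
  then have eq: "integral ?S ?H = integral (?G ` ?S) ?F"
    using cov by (simp add: vec_integral comp_def)
  have Hi: "set_integrable lborel ?S ?H" using abs[OF Hm] Ha by blast
  have "set_integrable lborel S h"
    using Hi transfer[OF hm] unfolding set_integrable_def ind by simp
  moreover have "(LINT w:?S|lborel. ?H w) = (LINT x:S|lborel. h x)"
    using transfer[OF hm] unfolding set_lebesgue_integral_def ind by simp
  moreover have "(LINT w:?G ` ?S|lborel. ?F w) = (LINT y:g ` S|lborel. f y)"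
    using transfer[OF fm] unfolding GS set_lebesgue_integral_def ind by simp
  ultimately show ?thesis
    using eq abs[OF Hm] Hi abs[OF Fm] Fi by simp
qed

section \<open>Alternating forms of top degree\<close>

lemma alternating_form_cong:
  assumes "alternating_form k a" "\<And>i. i < k \<Longrightarrow> v i = w i"
  shows "a v = a w"
  using assms unfolding alternating_form_def by blast

lemma alternating_form_linear:
  assumes "alternating_form k a" "i < k"
  shows "linear (\<lambda>x. a (v(i := x)))"
  using assms unfolding alternating_form_def by blast

lemma alternating_form_eq_0:
  assumes "alternating_form k a" "i < k" "j < k" "i \<noteq> j" "v i = v j"
  shows "a v = 0"
  using assms unfolding alternating_form_def by blast

lemma alternating_form_add:
  assumes "alternating_form k a" "i < k"
  shows "a (v(i := x + y)) = a (v(i := x)) + a (v(i := y))"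
  using linear_add[OF alternating_form_linear[OF assms]] .

lemma alternating_form_scaleR:
  assumes "alternating_form k a" "i < k"
  shows "a (v(i := c *\<^sub>R x)) = c * a (v(i := x))"
  using linear_scale[OF alternating_form_linear[OF assms]] by simp

lemma alternating_form_add_other:
  assumes "alternating_form k a" "i < k" "j < k" "i \<noteq> j"
  shows "a (v(i := v i + v j)) = a v"
proof -
  have "a (v(i := v i + v j)) = a (v(i := v i)) + a (v(i := v j))"
    by (rule alternating_form_add[OF assms(1,2)])
  moreover have "a (v(i := v j)) = 0"
    by (rule alternating_form_eq_0[OF assms]) (use assms(4) in auto)
  ultimately show ?thesis by simp
qed

text \<open>Put \<open>v i + v j\<close> into both slots, where the form vanishes, and expand: the
  two terms with equal entries drop out.\<close>

lemma alternating_form_swap: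
  assumes "alternating_form k a" "i < k" "j < k" "i \<noteq> j"
  shows "a (v(i := v j, j := v i)) = - a v"
proof -
  let ?s = "v i + v j"
  have zero: "a (v(i := x, j := x)) = 0" for x
    by (rule alternating_form_eq_0[OF assms]) (use assms(4) in auto)
  have split: "a (v(i := ?s, j := x)) = a (v(i := v i, j := x)) + a (v(i := v j, j := x))" for x
    using alternating_form_add[OF assms(1,2), of "v(j := x)" "v i" "v j"] assms(4)
    by (simp add: fun_upd_twist fun_upd_idem[of "v(j := x)" i "v i"])
  have "0 = a (v(i := ?s, j := v i)) + a (v(i := ?s, j := v j))"
    using alternating_form_add[OF assms(1,3), of "v(i := ?s)" "v i" "v j"] zero by simp
  also have "\<dots> = a (v(i := v j, j := v i)) + a (v(i := v i, j := v j))"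
    unfolding split using zero[of "v i"] zero[of "v j"] by simp
  finally show ?thesis by simp
qed

lemma alternating_form_scaleR_all:
  assumes "alternating_form k a"
  shows "a (\<lambda>i. c i *\<^sub>R v i) = (\<Prod>i<k. c i) * a v"
proof -
  have "a (\<lambda>i. if i < m then c i *\<^sub>R v i else v i) = (\<Prod>i<m. c i) * a v" if "m \<le> k" for m
    using that
  proof (induction m)
    case (Suc m)
    let ?w = "\<lambda>i. if i < m then c i *\<^sub>R v i else v i"
    have "(\<lambda>i. if i < Suc m then c i *\<^sub>R v i else v i) = ?w(m := c m *\<^sub>R v m)"
      by (auto simp: less_Suc_eq)
    moreover have "?w(m := v m) = ?w" by auto
    ultimately show ?case
      using alternating_form_scaleR[OF assms, of m ?w "c m" "v m"] Suc by simp
  qed simp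
  from this[of k] show ?thesis
    using alternating_form_cong[OF assms, of "\<lambda>i. if i < k then c i *\<^sub>R v i else v i" "\<lambda>i. c i *\<^sub>R v i"]
    by simp
qed

lemma alternating_form_span:
  assumes "alternating_form k a" "i < k" "v i \<in> span (v ` ({..<k} - {i}))"
  shows "a v = 0"
proof -
  have "a (v(i := x)) = 0" if "x \<in> v ` ({..<k} - {i})" for x
  proof -
    from that obtain j where "j < k" "j \<noteq> i" "x = v j" by auto
    then show ?thesis
      by (intro alternating_form_eq_0[OF assms(1,2)]) auto
  qed
  then have "a (v(i := v i)) = 0"
    using linear_eq_0_on_span[OF alternating_form_linear[OF assms(1,2)] _ assms(3)] by blast
  then show ?thesis by simp
qed

text \<open>As many vectors as the dimension cannot be independent inside a hyperplane, so either an
  entry repeats or one lies in the span of the others.\<close>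

lemma alternating_form_top_hyperplane:
  fixes a :: "'e::euclidean_space mform"
  assumes a: "alternating_form DIM('e) a" and "b \<noteq> 0" and perp: "\<And>i. v i \<bullet> b = 0"
  shows "a v = 0"
proof (cases "inj_on v {..<DIM('e)}")
  case False
  then show ?thesis
    using alternating_form_eq_0[OF a] by (auto simp: inj_on_def)
next
  case True
  have "dim (v ` {..<DIM('e)}) \<le> dim {x. b \<bullet> x = 0}"
    by (rule dim_subset) (use perp in \<open>auto simp: inner_commute\<close>)
  also have "\<dots> < DIM('e)"
    using dim_hyperplane[OF \<open>b \<noteq> 0\<close>] DIM_positive[where 'a='e] by linarith
  also have "\<dots> = card (v ` {..<DIM('e)})"
    using True by (simp add: card_image)
  finally have "dependent (v ` {..<DIM('e)})"
    using dim_eq_card_independent by fastforce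
  then obtain y where "y \<in> v ` {..<DIM('e)}" "y \<in> span (v ` {..<DIM('e)} - {y})"
    unfolding dependent_def by blast
  then obtain i where i: "i < DIM('e)" "v i \<in> span (v ` {..<DIM('e)} - {v i})" by blast
  have "v ` {..<DIM('e)} - {v i} \<subseteq> v ` ({..<DIM('e)} - {i})" by blast
  then show ?thesis
    using alternating_form_span[OF a i(1)] i(2) span_mono by blast
qed

lemma alternating_form_compose_linear:
  fixes L :: "'d::euclidean_space \<Rightarrow> 'e::euclidean_space"
  assumes "alternating_form k a" "linear L"
  shows "alternating_form k (\<lambda>v. a (\<lambda>i. L (v i)))"
  unfolding alternating_form_def
proof (intro conjI allI impI)
  fix v w :: "nat \<Rightarrow> 'd"
  assume "\<forall>i<k. v i = w i"
  then show "a (\<lambda>i. L (v i)) = a (\<lambda>i. L (w i))"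
    by (intro alternating_form_cong[OF assms(1)]) simp
next
  fix v :: "nat \<Rightarrow> 'd" and i assume "i < k"
  have "linear (\<lambda>x. a ((\<lambda>j. L (v j))(i := L x)))"
    using linear_compose[OF assms(2) alternating_form_linear[OF assms(1) \<open>i < k\<close>]] by (simp add: comp_def)
  moreover have "(\<lambda>j. L ((v(i := x)) j)) = (\<lambda>j. L (v j))(i := L x)" for x by auto
  ultimately show "linear (\<lambda>x. a (\<lambda>j. L ((v(i := x)) j)))" by simp
next
  fix v :: "nat \<Rightarrow> 'd" and i j assume "i < k" "j < k" "i \<noteq> j \<and> v i = v j"
  then show "a (\<lambda>i. L (v i)) = 0"
    by (intro alternating_form_eq_0[OF assms(1), of i j]) auto
qed

text \<open>Forms take vectors numbered by naturals, so the basis has to be numbered. The numbering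
  is arbitrary: another one changes the value of a top form on the basis only by a sign.\<close>

definition basis_idx :: "nat \<Rightarrow> 'e::euclidean_space basis_index" where
  "basis_idx = (SOME f. bij_betw f {..<DIM('e)} UNIV)"

lemma bij_betw_basis_idx: "bij_betw (basis_idx :: nat \<Rightarrow> 'e::euclidean_space basis_index) {..<DIM('e)} UNIV"
proof -
  have "\<exists>f. bij_betw f {..<DIM('e)} (UNIV :: 'e basis_index set)"
    by (intro finite_same_card_bij) (simp_all add: CARD_basis_index)
  then show ?thesis unfolding basis_idx_def by (rule someI_ex)
qed

definition basis_enum :: "nat \<Rightarrow> 'e::euclidean_space" where
  "basis_enum i = basis_vec (basis_idx i)"

lemma coords_basis_enum: "coords (basis_enum i) = axis (basis_idx i) 1"
  by (simp add: basis_enum_def coords_basis_vec)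

lemma obtain_basis_idx:
  obtains p where "p < DIM('e::euclidean_space)" "basis_idx p = (i :: 'e basis_index)"
proof -
  have "i \<in> basis_idx ` {..<DIM('e)}"
    using bij_betw_basis_idx[where 'e='e] by (simp add: bij_betw_def)
  then show ?thesis using that by auto
qed

lemma basis_idx_eq_iff:
  assumes "p < DIM('e::euclidean_space)" "q < DIM('e)"
  shows "(basis_idx p :: 'e basis_index) = basis_idx q \<longleftrightarrow> p = q"
  using bij_betw_basis_idx[where 'e='e] assms by (auto simp: bij_betw_def dest: inj_onD)

lemma linear_basis_conj:
  "linear f \<Longrightarrow> linear (\<lambda>x. of_coords (f (coords x)))"
  using linear_compose[OF linear_compose[OF linear_coords] linear_of_coords] by (simp add: comp_def)

text \<open>Both sides are multiplicative under composition, so it is enough to treat elementary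
  maps: a vanishing coordinate, a diagonal map, a swap and a shear. The induction predicate
  quantifies over all \<open>a\<close>, since for a composition the form is replaced by its pullback
  along the outer map.\<close>

lemma alternating_form_jacobian:
  fixes a :: "'e::euclidean_space mform"
  assumes a: "alternating_form DIM('e) a" and L: "linear L"
  shows "a (\<lambda>i. L (basis_enum i)) = jacobian L * a basis_enum"
proof -
  let ?P = "\<lambda>f :: real ^ 'e basis_index \<Rightarrow> real ^ 'e basis_index. \<forall>a. alternating_form DIM('e) a \<longrightarrow>
    a (\<lambda>i. of_coords (f (coords (basis_enum i)))) = det (matrix f) * a basis_enum"
  have "?P (coords \<circ> L \<circ> of_coords)"
  proof (rule induct_linear_elementary[where P = ?P])
    show "linear (coords \<circ> L \<circ> of_coords)"
      using linear_compose[OF linear_compose[OF linear_of_coords L] linear_coords] by (simp add: comp_assoc)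
  next
    fix f g :: "real ^ 'e basis_index \<Rightarrow> real ^ 'e basis_index"
    assume fg: "linear f" "linear g" and P: "?P f" "?P g"
    show "?P (f \<circ> g)"
    proof (intro allI impI)
      fix a :: "'e mform" assume a: "alternating_form DIM('e) a"
      let ?b = "\<lambda>v. a (\<lambda>i. of_coords (f (coords (v i))))"
      have b: "alternating_form DIM('e) ?b"
        by (rule alternating_form_compose_linear[OF a linear_basis_conj[OF fg(1)]])
      have "a (\<lambda>i. of_coords ((f \<circ> g) (coords (basis_enum i))))
          = ?b (\<lambda>i. of_coords (g (coords (basis_enum i))))" by simp
      also have "\<dots> = det (matrix g) * ?b basis_enum" using P(2) b by blast
      also have "\<dots> = det (matrix g) * (det (matrix f) * a basis_enum)" using P(1) a by simp
      finally show "a (\<lambda>i. of_coords ((f \<circ> g) (coords (basis_enum i))))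
          = det (matrix (f \<circ> g)) * a basis_enum"
        using fg by (simp add: matrix_compose det_mul)
    qed
  next
    fix f :: "real ^ 'e basis_index \<Rightarrow> real ^ 'e basis_index" and i0
    assume f: "linear f" and 0: "\<And>x. f x $ i0 = 0"
    have "det (matrix f) = 0"
      by (rule det_zero_row(2)[of i0]) (simp add: row_def matrix_def 0 vec_eq_iff)
    moreover have "a (\<lambda>i. of_coords (f (coords (basis_enum i)))) = 0"
      if "alternating_form DIM('e) a" for a
      by (rule alternating_form_top_hyperplane[OF that, of "basis_vec i0"])
        (use 0 nonzero_Basis[OF basis_vec_Basis[of i0]] in simp_all)
    ultimately show "?P f" by simp
  next
    fix c :: "'e basis_index \<Rightarrow> real"
    let ?f = "\<lambda>x. \<chi> i. c i * x $ i"
    have "matrix ?f = (\<chi> i j. if i = j then c i else 0)"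
      by (auto simp: matrix_def axis_def vec_eq_iff)
    then have "det (matrix ?f) = (\<Prod>i\<in>UNIV. c i)"
      by (simp add: det_diagonal)
    also have "\<dots> = (\<Prod>p<DIM('e). c (basis_idx p))"
      by (rule prod.reindex_bij_betw[OF bij_betw_basis_idx, symmetric])
    finally have det: "det (matrix ?f) = (\<Prod>p<DIM('e). c (basis_idx p))" .
    have "of_coords (?f (coords (basis_enum p))) = c (basis_idx p) *\<^sub>R basis_enum p" for p
    proof -
      have "?f (axis i 1) = c i *\<^sub>R axis i 1" for i
        by (auto simp: axis_def vec_eq_iff)
      then show ?thesis
        unfolding coords_basis_enum
        by (simp add: linear_scale[OF linear_of_coords] of_coords_axis basis_enum_def)
    qed
    then show "?P ?f"
      using alternating_form_scaleR_all[of "DIM('e)" _ "\<lambda>p. c (basis_idx p)" "basis_enum :: nat \<Rightarrow> 'e"] by (simp add: det)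
  next
    fix m n :: "'e basis_index" assume "m \<noteq> n"
    obtain p where "p < DIM('e)" "basis_idx p = m" by (rule obtain_basis_idx)
    moreover obtain q where "q < DIM('e)" "basis_idx q = n" by (rule obtain_basis_idx)
    ultimately have pq: "p < DIM('e)" "q < DIM('e)" "basis_idx p = m" "basis_idx q = n" by auto
    let ?\<tau> = "Transposition.transpose m n"
    let ?f = "\<lambda>x::real ^ 'e basis_index. \<chi> i. x $ ?\<tau> i"
    have "matrix ?f = (\<chi> i. mat 1 $ ?\<tau> i)"
      by (auto simp: matrix_def axis_def vec_eq_iff mat_def)
    then have det: "det (matrix ?f) = -1"
      using \<open>m \<noteq> n\<close> by (simp add: det_permute_rows permutes_swap_id sign_swap_id)
    have img: "of_coords (?f (coords (basis_enum r))) = basis_vec (?\<tau> (basis_idx r))" for r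
    proof -
      have "?f (axis i 1) = axis (?\<tau> i) 1" for i
        by (auto simp: axis_def vec_eq_iff transpose_eq_iff)
      then show ?thesis by (simp add: coords_basis_enum of_coords_axis)
    qed
    show "?P ?f"
    proof (intro allI impI)
      fix a :: "'e mform" assume a: "alternating_form DIM('e) a"
      have "a (\<lambda>i. of_coords (?f (coords (basis_enum i))))
          = a (basis_enum(p := basis_enum q, q := basis_enum p))"
      proof (rule alternating_form_cong[OF a])
        fix i assume "i < DIM('e)"
        then show "of_coords (?f (coords (basis_enum i))) = (basis_enum(p := basis_enum q, q := basis_enum p)) i"
          unfolding img using pq \<open>m \<noteq> n\<close> basis_idx_eq_iff[of i p, where 'e='e] basis_idx_eq_iff[of i q, where 'e='e]
          by (auto simp: basis_enum_def transpose_def)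
      qed
      also have "\<dots> = - a basis_enum"
        by (rule alternating_form_swap[OF a]) (use pq \<open>m \<noteq> n\<close> in auto)
      finally show "a (\<lambda>i. of_coords (?f (coords (basis_enum i)))) = det (matrix ?f) * a basis_enum"
        by (simp add: det)
    qed
  next
    fix m n :: "'e basis_index" assume "m \<noteq> n"
    obtain p where "p < DIM('e)" "basis_idx p = m" by (rule obtain_basis_idx)
    moreover obtain q where "q < DIM('e)" "basis_idx q = n" by (rule obtain_basis_idx)
    ultimately have pq: "p < DIM('e)" "q < DIM('e)" "basis_idx p = m" "basis_idx q = n" by auto
    let ?f = "\<lambda>x::real ^ 'e basis_index. \<chi> i. if i = m then x $ m + x $ n else x $ i"
    have "matrix ?f = (\<chi> k. if k = m then row m (mat 1) + 1 *s row n (mat 1) else row k (mat 1))"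
      by (auto simp: matrix_def axis_def vec_eq_iff mat_def row_def)
    then have det: "det (matrix ?f) = 1"
      by (simp only: det_row_operation[OF \<open>m \<noteq> n\<close>] det_I)
    \<comment> \<open>The map adds coordinate \<open>n\<close> to coordinate \<open>m\<close>; the
      basis vector that moves is therefore the one of \<open>n\<close>, not that of
      \<open>m\<close>.\<close>
    have img: "of_coords (?f (coords (basis_enum r)))
        = (if basis_idx r = n then basis_vec n + basis_vec m else basis_vec (basis_idx r))" for r
    proof -
      have "?f (axis i 1) = (if i = n then axis n 1 + axis m 1 else axis i 1)" for i
        using \<open>m \<noteq> n\<close> by (auto simp: axis_def vec_eq_iff)
      then show ?thesis unfolding coords_basis_enum by (simp add: of_coords_axis linear_add[OF linear_of_coords])
    qed
    show "?P ?f"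
    proof (intro allI impI)
      fix a :: "'e mform" assume a: "alternating_form DIM('e) a"
      have "a (\<lambda>i. of_coords (?f (coords (basis_enum i))))
          = a (basis_enum(q := basis_enum q + basis_enum p))"
      proof (rule alternating_form_cong[OF a])
        fix i assume "i < DIM('e)"
        then show "of_coords (?f (coords (basis_enum i))) = (basis_enum(q := basis_enum q + basis_enum p)) i"
          unfolding img using pq basis_idx_eq_iff[of i q, where 'e='e]
          by (auto simp: basis_enum_def)
      qed
      also have "\<dots> = a basis_enum"
        by (rule alternating_form_add_other[OF a]) (use pq \<open>m \<noteq> n\<close> in auto)
      finally show "a (\<lambda>i. of_coords (?f (coords (basis_enum i)))) = det (matrix ?f) * a basis_enum"
        by (simp add: det)
    qed
  qed
  then show ?thesis
    using a by (simp add: jacobian_def)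
qed

section \<open>Antisymmetrisation and wedge products\<close>

text \<open>In contrast to \<^const>\<open>wedge\<close>, there is no normalising factor here.\<close>

definition alternate :: "nat \<Rightarrow> 'e mform \<Rightarrow> 'e mform" where
  "alternate k F v = (\<Sum>\<sigma> | \<sigma> permutes {..<k}. of_int (sign \<sigma>) * F (\<lambda>i. v (\<sigma> i)))"

definition tensor :: "nat \<Rightarrow> 'e mform \<Rightarrow> 'e mform \<Rightarrow> 'e mform" where
  "tensor k a b v = a v * b (\<lambda>i. v (k + i))"

primrec tensor_power :: "nat \<Rightarrow> 'e mform \<Rightarrow> nat \<Rightarrow> 'e mform" where
  "tensor_power k a 0 = (\<lambda>v. 1)"
| "tensor_power k a (Suc m) = tensor k a (tensor_power k a m)"

definition multilinear :: "nat \<Rightarrow> 'e::real_vector mform \<Rightarrow> bool" where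
  "multilinear k F \<longleftrightarrow> (\<forall>v w. (\<forall>i<k. v i = w i) \<longrightarrow> F v = F w) \<and>
     (\<forall>v. \<forall>i<k. linear (\<lambda>x. F (v(i := x))))"

lemma multilinear_cong: "multilinear k F \<Longrightarrow> (\<And>i. i < k \<Longrightarrow> v i = w i) \<Longrightarrow> F v = F w"
  unfolding multilinear_def by blast

lemma multilinear_linear: "multilinear k F \<Longrightarrow> i < k \<Longrightarrow> linear (\<lambda>x. F (v(i := x)))"
  unfolding multilinear_def by blast

lemma linear_mult_const:
  fixes f :: "'e::real_vector \<Rightarrow> real"
  assumes "linear f"
  shows "linear (\<lambda>x. f x * c)" "linear (\<lambda>x. c * f x)"
  using assms by (simp_all add: linear_iff algebra_simps)

lemma multilinear_tensor:
  assumes a: "multilinear k a" and b: "multilinear l b"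
  shows "multilinear (k + l) (tensor k a b)"
  unfolding multilinear_def
proof (intro conjI allI impI)
  fix v w :: "nat \<Rightarrow> 'a" assume vw: "\<forall>i<k + l. v i = w i"
  have "a v = a w" by (rule multilinear_cong[OF a]) (use vw in simp)
  moreover have "b (\<lambda>i. v (k + i)) = b (\<lambda>i. w (k + i))" by (rule multilinear_cong[OF b]) (use vw in simp)
  ultimately show "tensor k a b v = tensor k a b w" by (simp add: tensor_def)
next
  fix v :: "nat \<Rightarrow> 'a" and i assume i: "i < k + l"
  show "linear (\<lambda>x. tensor k a b (v(i := x)))"
  proof (cases "i < k")
    case True
    then have "(\<lambda>j. (v(i := x)) (k + j)) = (\<lambda>j. v (k + j))" for x by auto
    then show ?thesis
      unfolding tensor_def
      using linear_mult_const(1)[OF multilinear_linear[OF a True, of v]] by (simp only:)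
  next
    case False
    have "a (v(i := x)) = a v" for x by (rule multilinear_cong[OF a]) (use False in auto)
    moreover have "(\<lambda>j. (v(i := x)) (k + j)) = (\<lambda>j. v (k + j))(i - k := x)" for x using False by (fastforce simp: fun_eq_iff)
    moreover have "linear (\<lambda>x. b ((\<lambda>j. v (k + j))(i - k := x)))"
      by (rule multilinear_linear[OF b]) (use False i in auto)
    ultimately show ?thesis
      unfolding tensor_def using linear_mult_const(2) by (simp only:)
  qed
qed

lemma multilinear_tensor_power:
  "multilinear k a \<Longrightarrow> multilinear (k * m) (tensor_power k a m)"
  by (induction m) (auto simp: multilinear_tensor multilinear_def[of 0] intro: linear_zero)

lemma multilinear_1: "linear f \<Longrightarrow> multilinear 1 (\<lambda>v. f (v 0))"
  by (simp add: multilinear_def)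

lemma multilinear_2:
  assumes "\<And>y. linear (\<lambda>x. w x y)" "\<And>x. linear (w x)"
  shows "multilinear 2 (\<lambda>v. w (v 0) (v 1))"
proof -
  have "linear (\<lambda>x. w ((v(i := x)) 0) ((v(i := x)) 1))" if "i < 2" for v and i :: nat
  proof -
    have "i = 0 \<or> i = 1" using that by auto
    then show ?thesis using assms by auto
  qed
  then show ?thesis by (simp add: multilinear_def)
qed

lemma tensor_power_2:
  "tensor_power 2 (\<lambda>v. w (v 0) (v 1)) m v = (\<Prod>j<m. w (v (2 * j)) (v (2 * j + 1)))"
proof (induction m arbitrary: v)
  case (Suc m)
  show ?case
    unfolding tensor_power.simps tensor_def Suc prod.lessThan_Suc_shift by simp
qed simp

section \<open>Signed sums over permutations\<close>

lemma permutation_lessThan: "\<sigma> permutes {..<k::nat} \<Longrightarrow> permutation \<sigma>"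
  by (rule permutes_imp_permutation) auto

text \<open>Right translation by \<tau> permutes the index set and multiplies every sign by that of
  \<tau>. It serves to move arguments between the slots of a product.\<close>

lemma sum_sign_reindex:
  fixes F :: "(nat \<Rightarrow> nat) \<Rightarrow> real"
  assumes "\<tau> permutes {..<k}"
  shows "(\<Sum>\<sigma> | \<sigma> permutes {..<k}. of_int (sign \<sigma>) * F \<sigma>)
    = of_int (sign \<tau>) * (\<Sum>\<sigma> | \<sigma> permutes {..<k}. of_int (sign \<sigma>) * F (\<sigma> \<circ> \<tau>))"
proof -
  have "(\<Sum>\<sigma> | \<sigma> permutes {..<k}. of_int (sign \<sigma>) * F \<sigma>)
     = (\<Sum>\<sigma> | \<sigma> permutes {..<k}. of_int (sign (\<sigma> \<circ> \<tau>)) * F (\<sigma> \<circ> \<tau>))"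
    by (rule sum_permutations_compose_right[OF assms])
  also have "\<dots> = (\<Sum>\<sigma> | \<sigma> permutes {..<k}. of_int (sign \<tau>) * (of_int (sign \<sigma>) * F (\<sigma> \<circ> \<tau>)))"
    by (rule sum.cong) (auto simp: sign_compose permutation_lessThan permutation_lessThan[OF assms])
  finally show ?thesis by (simp add: sum_distrib_left)
qed

text \<open>If two arguments agree, composing with their transposition on the left fixes the terms
  and flips all signs, so the sum is its own negative.\<close>

lemma alternating_form_alternate:
  fixes F :: "'e::euclidean_space mform"
  assumes F: "multilinear k F"
  shows "alternating_form k (alternate k F)"
  unfolding alternating_form_def
proof (intro conjI allI impI)
  fix v w :: "nat \<Rightarrow> 'e" assume vw: "\<forall>i<k. v i = w i"
  have "F (\<lambda>i. v (\<sigma> i)) = F (\<lambda>i. w (\<sigma> i))" if "\<sigma> permutes {..<k}" for \<sigma>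
    by (rule multilinear_cong[OF F]) (use vw permutes_in_image[OF that] in auto)
  then show "alternate k F v = alternate k F w" by (simp add: alternate_def)
next
  fix v :: "nat \<Rightarrow> 'e" and i assume i: "i < k"
  have "linear (\<lambda>x. of_int (sign \<sigma>) * F (\<lambda>j. (v(i := x)) (\<sigma> j)))" if \<sigma>: "\<sigma> permutes {..<k}" for \<sigma>
  proof -
    \<comment> \<open>Argument \<open>i\<close> appears in the permuted sequence at the slot that
      \<sigma> sends to \<open>i\<close>.\<close>
    have "(\<lambda>j. (v(i := x)) (\<sigma> j)) = (\<lambda>j. v (\<sigma> j))(inv_into UNIV \<sigma> i := x)" for x
      using permutes_inverses[OF \<sigma>] permutes_inv_eq[OF \<sigma>] by fastforce
    moreover have "inv_into UNIV \<sigma> i < k"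
      using permutes_in_image[OF permutes_inv[OF \<sigma>]] i by auto
    ultimately have "linear (\<lambda>x. F (\<lambda>j. (v(i := x)) (\<sigma> j)))"
      using multilinear_linear[OF F] by simp
    then show ?thesis by (rule linear_mult_const)
  qed
  then show "linear (\<lambda>x. alternate k F (v(i := x)))"
    unfolding alternate_def by (intro linear_compose_sum) auto
next
  fix v :: "nat \<Rightarrow> 'e" and i j assume ij: "i < k" "j < k" "i \<noteq> j \<and> v i = v j"
  let ?\<tau> = "Transposition.transpose i j"
  have \<tau>: "?\<tau> permutes {..<k}" using ij by (intro permutes_swap_id) auto
  have v: "v (?\<tau> l) = v l" for l using ij by (auto simp: Transposition.transpose_def)
  have "alternate k F v = (\<Sum>\<sigma> | \<sigma> permutes {..<k}. of_int (sign (?\<tau> \<circ> \<sigma>)) * F (\<lambda>i. v ((?\<tau> \<circ> \<sigma>) i)))"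
    unfolding alternate_def by (rule setum_permutations_compose_left[OF \<tau>])
  also have "\<dots> = (\<Sum>\<sigma> | \<sigma> permutes {..<k}. - (of_int (sign \<sigma>) * F (\<lambda>i. v (\<sigma> i))))"
    using ij by (intro sum.cong) (auto simp: sign_compose permutation_lessThan[OF \<tau>] permutation_lessThan v sign_swap_id)
  also have "\<dots> = - alternate k F v" by (simp add: alternate_def sum_negf)
  finally show "alternate k F v = 0" by simp
qed

text \<open>A permutation of the last \<open>l\<close> slots can be absorbed into the outer
  permutation at the cost of its sign, which cancels the inner sign. The inner sum thus yields
  \<open>fact l\<close> equal terms and only \<open>fact k\<close> of the normalisation
  remains.\<close>

lemma wedge_alternate:
  assumes a: "\<And>v w. (\<And>i. i < k \<Longrightarrow> v i = w i) \<Longrightarrow> a v = a w"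
  shows "wedge k l a (alternate l G) v = alternate (k + l) (tensor k a G) v / fact k"
proof -
  let ?S = "{\<sigma>. \<sigma> permutes {..<k + l}}"
  have "(\<Sum>\<sigma>\<in>?S. of_int (sign \<sigma>) * a (\<lambda>i. v (\<sigma> i)) * alternate l G (\<lambda>i. v (\<sigma> (k + i))))
     = (\<Sum>\<sigma>\<in>?S. \<Sum>\<tau> | \<tau> permutes {..<l}. of_int (sign \<sigma>) *
          (a (\<lambda>i. v (\<sigma> i)) * of_int (sign \<tau>) * G (\<lambda>i. v (\<sigma> (k + \<tau> i)))))"
    by (simp add: alternate_def sum_distrib_left mult.assoc)
  also have "\<dots> = (\<Sum>\<tau> | \<tau> permutes {..<l}. \<Sum>\<sigma>\<in>?S. of_int (sign \<sigma>) *
          (a (\<lambda>i. v (\<sigma> i)) * of_int (sign \<tau>) * G (\<lambda>i. v (\<sigma> (k + \<tau> i)))))"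
    by (rule sum.swap)
  also have "\<dots> = (\<Sum>\<tau> | \<tau> permutes {..<l}. alternate (k + l) (tensor k a G) v)"
  proof (rule sum.cong[OF refl])
    fix \<tau> assume "\<tau> \<in> {\<tau>. \<tau> permutes {..<l}}"
    then have \<tau>: "\<tau> permutes {..<l}" by simp
    \<comment> \<open>The permutation \<tau> shifted to the last \<open>l\<close> of the
      \<open>k + l\<close> slots; it fixes the slots read by \<open>a\<close>.\<close>
    define \<tau>' where "\<tau>' = map_permutation {..<l} ((+) k) \<tau>"
    have bij: "bij_betw ((+) k) {..<l} {k..<k + l}"
      by (auto simp: bij_betw_def image_add_atLeastLessThan lessThan_atLeast0)
    have p': "\<tau>' permutes {k..<k + l}"
      unfolding \<tau>'_def by (rule map_permutation_permutes[OF bij \<tau>])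
    then have perm: "\<tau>' permutes {..<k + l}"
      by (rule permutes_subset) auto
    have sgn: "sign \<tau>' = sign \<tau>"
      unfolding \<tau>'_def by (rule sign_map_permutation) (use \<tau> in auto)
    have low: "\<tau>' i = i" if "i < k" for i
      using permutes_not_in[OF p'] that by auto
    have "a (\<lambda>i. v (\<sigma> (\<tau>' i))) = a (\<lambda>i. v (\<sigma> i))" for \<sigma>
      by (rule a) (simp add: low)
    moreover have "\<tau>' (k + i) = k + \<tau> i" for i
    proof (cases "i < l")
      case True
      then show ?thesis unfolding \<tau>'_def by (intro map_permutation_apply) auto
    next
      case False
      then show ?thesis using permutes_not_in[OF p'] permutes_not_in[OF \<tau>] by auto
    qed
    ultimately have "alternate (k + l) (tensor k a G) v = of_int (sign \<tau>) *
      (\<Sum>\<sigma>\<in>?S. of_int (sign \<sigma>) * (a (\<lambda>i. v (\<sigma> i)) * G (\<lambda>i. v (\<sigma> (k + \<tau> i)))))"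
      unfolding alternate_def tensor_def
      by (subst sum_sign_reindex[OF perm]) (simp add: sgn)
    then show "(\<Sum>\<sigma>\<in>?S. of_int (sign \<sigma>) *
          (a (\<lambda>i. v (\<sigma> i)) * of_int (sign \<tau>) * G (\<lambda>i. v (\<sigma> (k + \<tau> i)))))
       = alternate (k + l) (tensor k a G) v"
      by (simp add: sum_distrib_left mult_ac)
  qed
  also have "\<dots> = fact l * alternate (k + l) (tensor k a G) v"
    using card_permutations[of "{..<l}" l] by simp
  finally show ?thesis by (simp add: wedge_def)
qed

lemma wedge_scale: "wedge k l a (\<lambda>v. c * b v) v = c * wedge k l a b v"
  by (simp add: wedge_def sum_distrib_left mult_ac)

text \<open>Iterating \<open>wedge_alternate\<close> keeps a single signed sum, and each 2-form
  contributes \<open>1 / fact 2\<close>.\<close>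

lemma wedge_power_2_alternate:
  assumes a: "\<And>v w. (\<And>i. i < 2 \<Longrightarrow> v i = w i) \<Longrightarrow> a v = a w"
  shows "wedge_power 2 a m = (\<lambda>v. (1 / 2 ^ m) * alternate (2 * m) (tensor_power 2 a m) v)"
proof (induction m)
  case 0
  show ?case by (simp add: alternate_def)
next
  case (Suc m)
  have "wedge_power 2 a (Suc m) v = (1 / 2 ^ m) * (alternate (2 + 2 * m) (tensor 2 a (tensor_power 2 a m)) v / fact 2)" for v
  proof -
    have "wedge 2 l a (alternate l G) v = alternate (2 + l) (tensor 2 a G) v / fact 2" for l G
      by (rule wedge_alternate) (rule a)
    then show ?thesis by (simp only: wedge_power.simps Suc wedge_scale)
  qed
  then show ?case by (simp add: fun_eq_iff)
qed

text \<open>Up to constant factors, \<open>contact_volume n l w\<close> is \<open>l \<and> w\<^sup>n\<close> and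
  \<open>flux_form m x b l w\<close> is \<open>x \<and> b \<and> l \<and> w\<^sup>m\<close>.\<close>

definition pairing_product :: "('e \<Rightarrow> 'e \<Rightarrow> real) \<Rightarrow> nat set \<Rightarrow> nat \<Rightarrow> 'e mform" where
  "pairing_product w J s v = (\<Prod>j\<in>J. w (v (2 * j + s)) (v (2 * j + s + 1)))"

definition contact_volume :: "nat \<Rightarrow> ('e::euclidean_space \<Rightarrow> real) \<Rightarrow> ('e \<Rightarrow> 'e \<Rightarrow> real) \<Rightarrow> 'e mform" where
  "contact_volume n l w = alternate (2 * n + 1) (\<lambda>v. l (v 0) * pairing_product w {..<n} 1 v)"

definition flux_form :: "nat \<Rightarrow> ('e::euclidean_space \<Rightarrow> real) \<Rightarrow> ('e \<Rightarrow> real) \<Rightarrow> ('e \<Rightarrow> real) \<Rightarrow> ('e \<Rightarrow> 'e \<Rightarrow> real) \<Rightarrow> 'e mform" where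
  "flux_form m x b l w = alternate (2 * m + 3)
     (\<lambda>v. x (v 0) * (b (v 1) * (l (v 2) * pairing_product w {..<m} 3 v)))"

text \<open>The explicit product in the definition suits differentiation and reindexing; the tensor
  product gives multilinearity and the link with \<open>wedge\<close>.\<close>

lemma contact_volume_tensor:
  "contact_volume n l w = alternate (1 + 2 * n) (tensor 1 (\<lambda>v. l (v 0)) (tensor_power 2 (\<lambda>v. w (v 0) (v 1)) n))"
  unfolding contact_volume_def pairing_product_def tensor_def tensor_power_2 by (simp add: add.commute)

lemma flux_form_tensor:
  "flux_form m x b l w = alternate (1 + (1 + (1 + 2 * m)))
     (tensor 1 (\<lambda>v. x (v 0)) (tensor 1 (\<lambda>v. b (v 0)) (tensor 1 (\<lambda>v. l (v 0)) (tensor_power 2 (\<lambda>v. w (v 0) (v 1)) m))))"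
  unfolding flux_form_def pairing_product_def tensor_def tensor_power_2
  by (simp add: add.commute numeral_eq_Suc)

lemma alternating_form_contact_volume:
  assumes "linear l" "\<And>y. linear (\<lambda>x. w x y)" "\<And>x. linear (w x)"
  shows "alternating_form (2 * n + 1) (contact_volume n l w)"
proof -
  have "alternating_form (1 + 2 * n) (contact_volume n l w)"
    unfolding contact_volume_tensor
    by (intro alternating_form_alternate multilinear_tensor multilinear_tensor_power multilinear_1 multilinear_2 assms)
  then show ?thesis by simp
qed

lemma alternating_form_flux_form:
  assumes "linear x" "linear b" "linear l" "\<And>y. linear (\<lambda>x. w x y)" "\<And>x. linear (w x)"
  shows "alternating_form (2 * m + 3) (flux_form m x b l w)"
proof -
  have "alternating_form (1 + (1 + (1 + 2 * m))) (flux_form m x b l w)"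
    unfolding flux_form_tensor
    by (intro alternating_form_alternate multilinear_tensor multilinear_tensor_power multilinear_1 multilinear_2 assms)
  then show ?thesis by (simp add: numeral_eq_Suc)
qed

lemma contact_volume_pullback:
  "contact_volume n (\<lambda>u. l (L u)) (\<lambda>u v. w (L u) (L v)) v = contact_volume n l w (\<lambda>i. L (v i))"
  by (simp add: contact_volume_def alternate_def pairing_product_def)

lemma flux_form_pullback:
  "flux_form n (\<lambda>u. x (L u)) (\<lambda>u. b (L u)) (\<lambda>u. l (L u)) (\<lambda>u v. w (L u) (L v)) v = flux_form n x b l w (\<lambda>i. L (v i))"
  by (simp add: flux_form_def alternate_def pairing_product_def)

text \<open>The power of 2 is the normalisation from \<open>wedge_power_2_alternate\<close>. The
  sequence \<open>case_nat x (\<lambda>_. y)\<close> is x, y, y, ..., of which a 2-form reads the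
  first two entries.\<close>

lemma wedge_contact_volume:
  assumes a: "alternating_form 1 a" and b: "alternating_form 2 b"
  shows "wedge 1 (2 * n) a (wedge_power 2 b n) v =
    contact_volume n (\<lambda>x. a (\<lambda>_. x)) (\<lambda>x y. b (case_nat x (\<lambda>_. y))) v / 2 ^ n"
proof -
  have a_eq: "(\<lambda>v. a (\<lambda>_. v 0)) = a"
    by (rule ext, rule alternating_form_cong[OF a]) auto
  have b_eq: "(\<lambda>v. b (case_nat (v 0) (\<lambda>_. v 1))) = b"
    by (rule ext, rule alternating_form_cong[OF b]) (auto simp: less_2_cases_iff)
  have "wedge_power 2 b n = (\<lambda>v. (1 / 2 ^ n) * alternate (2 * n) (tensor_power 2 b n) v)"
    by (rule wedge_power_2_alternate) (rule alternating_form_cong[OF b])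
  then have "wedge 1 (2 * n) a (wedge_power 2 b n) v
     = (1 / 2 ^ n) * (alternate (1 + 2 * n) (tensor 1 a (tensor_power 2 b n)) v / fact 1)"
    using wedge_alternate[of 1 a, OF alternating_form_cong[OF a]] by (simp only: wedge_scale)
  then show ?thesis
    unfolding contact_volume_tensor a_eq b_eq by simp
qed

section \<open>Linear algebra of contact forms\<close>

lemma bij_betw_basis_enum: "bij_betw (basis_enum :: nat \<Rightarrow> 'e::euclidean_space) {..<DIM('e)} Basis"
  using bij_betw_trans[OF bij_betw_basis_idx bij_betw_basis_vec] by (simp add: comp_def basis_enum_def[abs_def])

lemma obtain_basis_enum:
  assumes "(b :: 'e::euclidean_space) \<in> Basis"
  obtains p where "p < DIM('e)" "basis_enum p = b"
proof -
  have "b \<in> basis_enum ` {..<DIM('e)}"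
    using bij_betw_basis_enum[where 'e='e] assms by (simp add: bij_betw_def)
  then show ?thesis using that by auto
qed

text \<open>Cramer's rule: putting \<open>X\<close> in the slot of a basis vector \<open>b\<close>
  multiplies the value on the basis by \<open>X \<bullet> b\<close>, and some component of
  \<open>X\<close> is non-zero.\<close>

lemma alternating_form_contract_top:
  fixes a :: "'e::euclidean_space mform"
  assumes a: "alternating_form DIM('e) a" and X: "X \<noteq> 0"
    and contract: "\<And>v i. i < DIM('e) \<Longrightarrow> v i = X \<Longrightarrow> a v = 0"
  shows "a basis_enum = 0"
proof -
  obtain b :: 'e where b: "b \<in> Basis" "X \<bullet> b \<noteq> 0"
    using X euclidean_all_zero_iff by blast
  obtain p where p: "p < DIM('e)" "basis_enum p = b"
    using obtain_basis_enum[OF b(1)] .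
  let ?f = "\<lambda>x. a (basis_enum(p := x))"
  have lin: "linear ?f" by (rule alternating_form_linear[OF a p(1)])
  have zero: "?f c = 0" if "c \<in> Basis" "c \<noteq> b" for c
  proof -
    obtain q where q: "q < DIM('e)" "basis_enum q = c"
      using obtain_basis_enum[OF \<open>c \<in> Basis\<close>] .
    show ?thesis
      by (rule alternating_form_eq_0[OF a p(1) q(1)]) (use p q that in auto)
  qed
  have "0 = ?f X" using contract[OF p(1)] by simp
  also have "\<dots> = ?f (\<Sum>c\<in>Basis. (X \<bullet> c) *\<^sub>R c)" by (simp add: euclidean_representation)
  also have "\<dots> = (\<Sum>c\<in>Basis. (X \<bullet> c) * ?f c)"
    by (simp add: linear_sum[OF lin] linear_scale[OF lin])
  also have "\<dots> = (\<Sum>c\<in>Basis. if c = b then (X \<bullet> b) * ?f b else 0)"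
    by (rule sum.cong) (auto simp: zero)
  also have "\<dots> = (X \<bullet> b) * a basis_enum"
    using b p by (simp add: fun_upd_idem)
  finally show ?thesis using b by simp
qed

text \<open>In every term of the signed sum some factor receives \<open>X\<close>, and both
  \<open>l\<close> and \<open>w\<close> vanish on it. This is applied with the basic form \<alpha>
  in the place of \<open>l\<close>.\<close>

lemma contact_volume_kernel:
  fixes l :: "'e::euclidean_space \<Rightarrow> real"
  assumes lin: "linear l" "\<And>y. linear (\<lambda>x. w x y)" "\<And>x. linear (w x)"
    and dim: "DIM('e) = 2 * n + 1"
    and X: "X \<noteq> 0" "l X = 0" "\<And>u. w X u = 0" "\<And>u. w u X = 0"
  shows "contact_volume n l w basis_enum = 0"
proof (rule alternating_form_contract_top[OF _ X(1)])
  show "alternating_form DIM('e) (contact_volume n l w)"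
    unfolding dim by (rule alternating_form_contact_volume[OF lin])
next
  fix v :: "nat \<Rightarrow> 'e" and i assume "i < DIM('e)" and v: "v i = X"
  then have i: "i < 2 * n + 1" by (simp add: dim)
  have "l (v (\<sigma> 0)) * pairing_product w {..<n} 1 (\<lambda>j. v (\<sigma> j)) = 0" if \<sigma>: "\<sigma> permutes {..<2 * n + 1}" for \<sigma>
  proof -
    obtain r where r: "r < 2 * n + 1" "\<sigma> r = i"
      using permutes_image[OF \<sigma>] i by (metis image_iff lessThan_iff)
    \<comment> \<open>Slot \<open>r\<close> is the one that receives \<open>X\<close>: slot 0
      belongs to \<open>l\<close>, slots \<open>2 * j + 1\<close> and \<open>2 * j + 2\<close> to
      pairing number \<open>j\<close>.\<close>
    have "r = 0 \<or> (\<exists>j<n. r = 2 * j + 1) \<or> (\<exists>j<n. r = 2 * j + 1 + 1)"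
      using r(1) by presburger
    then consider "r = 0" | j where "j < n" "r = 2 * j + 1" | j where "j < n" "r = 2 * j + 1 + 1"
      by blast
    then show ?thesis
    proof cases
      case 1
      then show ?thesis using r v X by simp
    next
      case 2
      then have "w (v (\<sigma> (2 * j + 1))) (v (\<sigma> (2 * j + 1 + 1))) = 0" using r v X by simp
      then show ?thesis using 2 by (auto simp: pairing_product_def)
    next
      case 3
      then have "w (v (\<sigma> (2 * j + 1))) (v (\<sigma> (2 * j + 1 + 1))) = 0" using r v X by simp
      then show ?thesis using 3 by (auto simp: pairing_product_def)
    qed
  qed
  then show "contact_volume n l w v = 0"
    unfolding contact_volume_def alternate_def
    by (intro sum.neutral ballI) (simp only: mem_Collect_eq mult_zero_right)
qed

lemma contact_volume_diff:
  "contact_volume n (\<lambda>x. l x - l' x) w v = contact_volume n l w v - contact_volume n l' w v"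
  by (simp add: contact_volume_def alternate_def pairing_product_def sum_subtractf algebra_simps)

text \<open>The Gram matrix is minus its transpose, so in odd dimension its determinant equals its
  own negative.\<close>

lemma odd_dim_skew_kernel:
  fixes w :: "'e::euclidean_space \<Rightarrow> 'e \<Rightarrow> real"
  assumes lin: "\<And>x. linear (w x)" and skew: "\<And>x y. w x y = - w y x"
    and dim: "odd DIM('e)"
  obtains X where "X \<noteq> 0" "\<And>u. w X u = 0" "\<And>u. w u X = 0"
proof -
  let ?B = "(\<chi> i j. w (basis_vec i) (basis_vec j)) :: real ^ 'e basis_index ^ 'e basis_index"
  have lin': "linear (\<lambda>x. w x y)" for y
  proof -
    have "(\<lambda>x. w x y) = (\<lambda>x. - w y x)" using skew by blast
    then show ?thesis using linear_compose_neg[OF lin] by simp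
  qed
  have "transpose ?B = (\<chi> i. (-1) *s ?B $ i)"
    by (simp add: Finite_Cartesian_Product.transpose_def vec_eq_iff) (metis skew)
  then have "det ?B = det (\<chi> i. (-1) *s ?B $ i)"
    by (metis det_transpose)
  also have "\<dots> = - det ?B"
    using det_rows_mul[of "\<lambda>_. -1" "\<lambda>i. ?B $ i"] dim by (simp only: CARD_basis_index prod_constant) simp
  finally have "det ?B = 0" by simp
  then have "\<not> invertible ?B" by (simp add: invertible_det_nz)
  then obtain x where x: "x \<noteq> 0" "?B *v x = 0"
    using matrix_left_invertible_ker[of ?B] invertible_left_inverse[of ?B] by blast
  let ?X = "of_coords x"
  have "w (basis_vec i) ?X = (?B *v x) $ i" for i
    by (simp add: of_coords_def linear_sum[OF lin] linear_scale[OF lin] matrix_vector_mult_def mult.commute)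
  then have *: "\<forall>b\<in>Basis. w b ?X = 0" unfolding ball_Basis_iff using x by simp
  have 1: "w u ?X = 0" for u
    using linear_eq_0_on_span[OF lin'[of ?X], of Basis u] * by simp
  moreover have "?X \<noteq> 0"
    using x(1) coords_of_coords[of x] linear_0[OF linear_coords] by metis
  ultimately show ?thesis
    using that[of ?X] skew[of ?X] by simp
qed

section \<open>The divergence of the product of two 1-forms with pairings\<close>

lemma sum_sign_swap_zero:
  fixes F :: "(nat \<Rightarrow> nat) \<Rightarrow> real"
  assumes "i < k" "j < k" "i \<noteq> j"
    and "\<And>\<sigma>. F (\<sigma> \<circ> Transposition.transpose i j) = F \<sigma>"
  shows "(\<Sum>\<sigma> | \<sigma> permutes {..<k}. of_int (sign \<sigma>) * F \<sigma>) = 0"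
proof -
  have "Transposition.transpose i j permutes {..<k}"
    using assms by (intro permutes_swap_id) auto
  from sum_sign_reindex[OF this, of F] show ?thesis
    using assms by (simp add: sign_swap_id)
qed

lemma pairing_product_cong:
  assumes "\<And>i. i \<ge> s \<Longrightarrow> v i = v' i"
  shows "pairing_product w J s v = pairing_product w J s v'"
  unfolding pairing_product_def using assms by simp

text \<open>The left-hand side is \<open>d(b \<and> l \<and> w\<^sup>m)\<close> expanded by the product rule, with \<open>Db\<close>, \<open>Dl\<close>, \<open>Dw\<close>
  the derivatives in the direction of the first argument.  The terms with \<open>Db\<close> cancel in pairs since
  \<open>b\<close> is closed and those with \<open>Dw\<close> in triples since \<open>w = dl\<close> is closed.\<close>

lemma divergence_identity:
  fixes e :: "nat \<Rightarrow> 'e::euclidean_space"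
  assumes closed_b: "\<And>u v. Db u v = Db v u"
    and dl: "\<And>u v. Dl u v - Dl v u = w u v"
    and closed_w: "\<And>u v z. Dw u v z + Dw v z u + Dw z u v = (0::real)"
  shows "(\<Sum>\<sigma> | \<sigma> permutes {..<2 * m + 3}. of_int (sign \<sigma>) *
      (Db (e (\<sigma> 0)) (e (\<sigma> 1)) * (l (e (\<sigma> 2)) * pairing_product w {..<m} 3 (\<lambda>i. e (\<sigma> i)))
       + b (e (\<sigma> 1)) * (Dl (e (\<sigma> 0)) (e (\<sigma> 2)) * pairing_product w {..<m} 3 (\<lambda>i. e (\<sigma> i)))
       + b (e (\<sigma> 1)) * (l (e (\<sigma> 2)) * (\<Sum>j<m. Dw (e (\<sigma> 0)) (e (\<sigma> (2 * j + 3))) (e (\<sigma> (2 * j + 3 + 1)))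
            * pairing_product w ({..<m} - {j}) 3 (\<lambda>i. e (\<sigma> i))))))
    = - contact_volume (Suc m) b w e / 2"
proof -
  let ?N = "2 * m + 3"
  let ?S = "{\<sigma>. \<sigma> permutes {..<?N}}"
  let ?Q = "\<lambda>J \<sigma>. pairing_product w J 3 (\<lambda>i. e (\<sigma> i))"
  define F1 where "F1 \<sigma> = Db (e (\<sigma> 0)) (e (\<sigma> 1)) * (l (e (\<sigma> 2)) * ?Q {..<m} \<sigma>)" for \<sigma> :: "nat \<Rightarrow> nat"
  define F2 where "F2 \<sigma> = b (e (\<sigma> 1)) * (Dl (e (\<sigma> 0)) (e (\<sigma> 2)) * ?Q {..<m} \<sigma>)" for \<sigma> :: "nat \<Rightarrow> nat"
  define F3 where "F3 j \<sigma> = b (e (\<sigma> 1)) * (l (e (\<sigma> 2)) * (Dw (e (\<sigma> 0)) (e (\<sigma> (2 * j + 3))) (e (\<sigma> (2 * j + 3 + 1)))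
            * ?Q ({..<m} - {j}) \<sigma>))" for j and \<sigma> :: "nat \<Rightarrow> nat"
  have Q_low: "?Q J (\<sigma> \<circ> \<tau>) = ?Q J \<sigma>" if "\<And>i. i \<ge> 3 \<Longrightarrow> \<tau> i = i" for J \<sigma> \<tau>
    by (rule pairing_product_cong) (simp add: that)
  have S1: "(\<Sum>\<sigma>\<in>?S. of_int (sign \<sigma>) * F1 \<sigma>) = 0"
  proof (rule sum_sign_swap_zero[of 0 ?N 1])
    fix \<sigma>
    show "F1 (\<sigma> \<circ> Transposition.transpose 0 1) = F1 \<sigma>"
      unfolding F1_def using closed_b by (subst Q_low) (auto simp: Transposition.transpose_def)
  qed auto
  have S2: "(\<Sum>\<sigma>\<in>?S. of_int (sign \<sigma>) * F2 \<sigma>) = - contact_volume (Suc m) b w e / 2"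
  proof -
    let ?t = "Transposition.transpose 0 (2::nat)" and ?s = "Transposition.transpose 0 (1::nat)"
    have t: "?t permutes {..<?N}" "?s permutes {..<?N}" by (auto intro!: permutes_swap_id)
    define G where "G \<sigma> = b (e (\<sigma> 1)) * (w (e (\<sigma> 0)) (e (\<sigma> 2)) * ?Q {..<m} \<sigma>)" for \<sigma> :: "nat \<Rightarrow> nat"
    have F2t: "F2 (\<sigma> \<circ> ?t) = b (e (\<sigma> 1)) * (Dl (e (\<sigma> 2)) (e (\<sigma> 0)) * ?Q {..<m} \<sigma>)" for \<sigma>
      unfolding F2_def by (subst Q_low) (auto simp: Transposition.transpose_def)
    have FG: "F2 \<sigma> - F2 (\<sigma> \<circ> ?t) = G \<sigma>" for \<sigma>
    proof -
      have "F2 \<sigma> - F2 (\<sigma> \<circ> ?t)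
        = b (e (\<sigma> 1)) * ((Dl (e (\<sigma> 0)) (e (\<sigma> 2)) - Dl (e (\<sigma> 2)) (e (\<sigma> 0))) * ?Q {..<m} \<sigma>)"
        unfolding F2t unfolding F2_def by (simp only: left_diff_distrib right_diff_distrib)
      then show ?thesis unfolding dl G_def .
    qed
    have "(\<Sum>\<sigma>\<in>?S. of_int (sign \<sigma>) * F2 \<sigma>) = - (\<Sum>\<sigma>\<in>?S. of_int (sign \<sigma>) * F2 (\<sigma> \<circ> ?t))"
      using sum_sign_reindex[OF t(1), of F2] by (simp add: sign_swap_id)
    \<comment> \<open>Antisymmetrising the slots 0 and 2 replaces \<open>Dl\<close> by
      \<open>w\<close>; the factor 1/2 of the conclusion arises here.\<close>
    then have E1: "2 * (\<Sum>\<sigma>\<in>?S. of_int (sign \<sigma>) * F2 \<sigma>) = (\<Sum>\<sigma>\<in>?S. of_int (sign \<sigma>) * G \<sigma>)"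
      by (simp add: FG[symmetric] right_diff_distrib sum_subtractf)
    \<comment> \<open>Exchanging the slots 0 and 1 puts \<open>b\<close> in front; the minus sign of
      the conclusion arises here.\<close>
    have E2: "(\<Sum>\<sigma>\<in>?S. of_int (sign \<sigma>) * G \<sigma>) = - (\<Sum>\<sigma>\<in>?S. of_int (sign \<sigma>) * G (\<sigma> \<circ> ?s))"
      using sum_sign_reindex[OF t(2), of G] by (simp add: sign_swap_id)
    have E3: "(\<Sum>\<sigma>\<in>?S. of_int (sign \<sigma>) * G (\<sigma> \<circ> ?s)) = contact_volume (Suc m) b w e"
    proof -
      have "G (\<sigma> \<circ> ?s) = b (e (\<sigma> 0)) * (w (e (\<sigma> 1)) (e (\<sigma> 2)) * ?Q {..<m} \<sigma>)" for \<sigma>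
        unfolding G_def by (subst Q_low) (auto simp: Transposition.transpose_def)
      moreover have "w (e (\<sigma> 1)) (e (\<sigma> 2)) * ?Q {..<m} \<sigma> = pairing_product w {..<Suc m} 1 (\<lambda>i. e (\<sigma> i))" for \<sigma>
        unfolding pairing_product_def prod.lessThan_Suc_shift by (simp add: numeral_eq_Suc)
      moreover have "2 * Suc m + 1 = ?N" by simp
      ultimately show ?thesis
        unfolding contact_volume_def alternate_def by (simp only:)
    qed
    show ?thesis using E1 unfolding E2 E3 by linarith
  qed
  have S3: "(\<Sum>\<sigma>\<in>?S. of_int (sign \<sigma>) * F3 j \<sigma>) = 0" if j: "j < m" for j
  proof -
    let ?p = "2 * j + 3" and ?q = "2 * j + 3 + 1"
    \<comment> \<open>The 3-cycle of the slots 0, \<open>?p\<close>, \<open>?q\<close>. It is even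
      and fixes the slots of \<open>b\<close>, \<open>l\<close> and the remaining pairings, so
      rotating the arguments of \<open>Dw\<close> does not change the signed sum; three equal sums
      then add up to zero.\<close>
    define \<tau> where "\<tau> = Transposition.transpose 0 ?p \<circ> Transposition.transpose ?p ?q"
    have \<tau>: "\<tau> permutes {..<?N}"
      unfolding \<tau>_def using j by (intro permutes_compose permutes_swap_id) auto
    have sgn: "sign \<tau> = 1"
      unfolding \<tau>_def by (simp add: sign_compose permutation_swap_id sign_swap_id)
    have \<tau>_vals: "\<tau> 0 = ?p" "\<tau> ?p = ?q" "\<tau> ?q = 0" "\<tau> 1 = 1" "\<tau> 2 = 2"
      by (auto simp: \<tau>_def Transposition.transpose_def)
    have \<tau>_other: "\<tau> (2 * i + 3) = 2 * i + 3" "\<tau> (2 * i + 3 + 1) = 2 * i + 3 + 1" if "i \<noteq> j" for i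
      using that by (auto simp: \<tau>_def Transposition.transpose_def)
    have Q: "?Q ({..<m} - {j}) (\<sigma> \<circ> \<tau>) = ?Q ({..<m} - {j}) \<sigma>" for \<sigma>
      unfolding pairing_product_def
    proof (rule prod.cong[OF refl])
      fix i assume "i \<in> {..<m} - {j}"
      then have "i \<noteq> j" by simp
      then show "w (e ((\<sigma> \<circ> \<tau>) (2 * i + 3))) (e ((\<sigma> \<circ> \<tau>) (2 * i + 3 + 1)))
          = w (e (\<sigma> (2 * i + 3))) (e (\<sigma> (2 * i + 3 + 1)))"
        by (simp only: comp_apply \<tau>_other[OF \<open>i \<noteq> j\<close>])
    qed
    define H where "H \<sigma> x y z = b (e (\<sigma> 1)) * (l (e (\<sigma> 2)) *
        (Dw (e (\<sigma> x)) (e (\<sigma> y)) (e (\<sigma> z)) * ?Q ({..<m} - {j}) \<sigma>))"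
      for \<sigma> :: "nat \<Rightarrow> nat" and x y z
    have F3H: "F3 j \<sigma> = H \<sigma> 0 ?p ?q" for \<sigma>
      unfolding F3_def H_def ..
    have H\<tau>: "H (\<sigma> \<circ> \<tau>) x y z = H \<sigma> (\<tau> x) (\<tau> y) (\<tau> z)" for \<sigma> x y z
      unfolding H_def Q by (simp only: comp_apply \<tau>_vals)
    have cyc: "H \<sigma> 0 ?p ?q + H \<sigma> ?p ?q 0 + H \<sigma> ?q 0 ?p = 0" for \<sigma>
    proof -
      have "H \<sigma> 0 ?p ?q + H \<sigma> ?p ?q 0 + H \<sigma> ?q 0 ?p = b (e (\<sigma> 1)) * (l (e (\<sigma> 2)) *
        ((Dw (e (\<sigma> 0)) (e (\<sigma> ?p)) (e (\<sigma> ?q)) + Dw (e (\<sigma> ?p)) (e (\<sigma> ?q)) (e (\<sigma> 0))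
          + Dw (e (\<sigma> ?q)) (e (\<sigma> 0)) (e (\<sigma> ?p))) * ?Q ({..<m} - {j}) \<sigma>))"
        unfolding H_def by (simp only: distrib_left distrib_right)
      then show ?thesis by (simp only: closed_w mult_zero_left mult_zero_right)
    qed
    define A where "A F = (\<Sum>\<sigma>\<in>?S. of_int (sign \<sigma>) * F \<sigma>)" for F :: "(nat \<Rightarrow> nat) \<Rightarrow> real"
    have A\<tau>: "A F = A (\<lambda>\<sigma>. F (\<sigma> \<circ> \<tau>))" for F
      using sum_sign_reindex[OF \<tau>, of F] unfolding sgn A_def by (simp only: of_int_1 mult_1_left)
    have 1: "A (\<lambda>\<sigma>. H \<sigma> 0 ?p ?q) = A (\<lambda>\<sigma>. H \<sigma> ?p ?q 0)"
      using A\<tau>[of "\<lambda>\<sigma>. H \<sigma> 0 ?p ?q"] by (simp only: H\<tau> \<tau>_vals)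
    have 2: "A (\<lambda>\<sigma>. H \<sigma> ?p ?q 0) = A (\<lambda>\<sigma>. H \<sigma> ?q 0 ?p)"
      using A\<tau>[of "\<lambda>\<sigma>. H \<sigma> ?p ?q 0"] by (simp only: H\<tau> \<tau>_vals)
    have "A (\<lambda>\<sigma>. H \<sigma> 0 ?p ?q) + A (\<lambda>\<sigma>. H \<sigma> ?p ?q 0) + A (\<lambda>\<sigma>. H \<sigma> ?q 0 ?p)
      = (\<Sum>\<sigma>\<in>?S. of_int (sign \<sigma>) * (H \<sigma> 0 ?p ?q + H \<sigma> ?p ?q 0 + H \<sigma> ?q 0 ?p))"
      unfolding A_def by (simp only: distrib_left sum.distrib)
    then have "A (\<lambda>\<sigma>. H \<sigma> 0 ?p ?q) + A (\<lambda>\<sigma>. H \<sigma> ?p ?q 0) + A (\<lambda>\<sigma>. H \<sigma> ?q 0 ?p) = 0"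
      by (simp only: cyc mult_zero_right sum.neutral_const)
    then have "A (\<lambda>\<sigma>. H \<sigma> 0 ?p ?q) = 0" using 1 2 by linarith
    then show ?thesis unfolding A_def F3H .
  qed
  have "(\<Sum>\<sigma>\<in>?S. of_int (sign \<sigma>) * (F1 \<sigma> + F2 \<sigma> + (\<Sum>j<m. F3 j \<sigma>)))
    = (\<Sum>\<sigma>\<in>?S. of_int (sign \<sigma>) * F1 \<sigma>) + (\<Sum>\<sigma>\<in>?S. of_int (sign \<sigma>) * F2 \<sigma>)
      + (\<Sum>\<sigma>\<in>?S. \<Sum>j<m. of_int (sign \<sigma>) * F3 j \<sigma>)"
    by (simp add: distrib_left sum.distrib sum_distrib_left)
  moreover have "(\<Sum>\<sigma>\<in>?S. \<Sum>j<m. of_int (sign \<sigma>) * F3 j \<sigma>) = (\<Sum>j<m. \<Sum>\<sigma>\<in>?S. of_int (sign \<sigma>) * F3 j \<sigma>)"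
    by (rule sum.swap)
  moreover have "(\<Sum>j<m. \<Sum>\<sigma>\<in>?S. of_int (sign \<sigma>) * F3 j \<sigma>) = 0" by (simp add: S3)
  ultimately have "(\<Sum>\<sigma>\<in>?S. of_int (sign \<sigma>) * (F1 \<sigma> + F2 \<sigma> + (\<Sum>j<m. F3 j \<sigma>)))
      = - contact_volume (Suc m) b w e / 2"
    unfolding S1 S2 by linarith
  then show ?thesis
    unfolding F1_def F2_def F3_def sum_distrib_left .
qed

section \<open>Differential calculus\<close>

abbreviation dir_deriv :: "('e::euclidean_space \<Rightarrow> 'f::real_normed_vector) \<Rightarrow> 'e \<Rightarrow> 'e \<Rightarrow> 'f" where
  "dir_deriv f x v \<equiv> frechet_derivative f (at x) v"

lemma dir_deriv_eq: "(f has_derivative f') (at x) \<Longrightarrow> dir_deriv f x = f'"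
  using frechet_derivative_at by metis

lemma linear_dir_deriv: "f differentiable (at x) \<Longrightarrow> linear (dir_deriv f x)"
  by (rule linear_frechet_derivative)

lemma dir_deriv_cong_open:
  assumes "open S" "x \<in> S" "\<And>y. y \<in> S \<Longrightarrow> f y = g y"
  shows "dir_deriv f x = dir_deriv g x"
proof -
  have "(f has_derivative f') (at x) \<longleftrightarrow> (g has_derivative f') (at x)" for f'
    using has_derivative_transform_within_open[of f f' x UNIV S g]
      has_derivative_transform_within_open[of g f' x UNIV S f] assms by auto
  then show ?thesis unfolding frechet_derivative_def by simp
qed

lemma differentiable_cong_open:
  assumes "open S" "x \<in> S" "\<And>y. y \<in> S \<Longrightarrow> f y = g y" "f differentiable (at x)"
  shows "g differentiable (at x)"
  using has_derivative_transform_within_open[of f _ x UNIV S g] assms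
  unfolding differentiable_def by blast

lemma Ck_on_cong:
  assumes "open S" "\<And>x. x \<in> S \<Longrightarrow> f x = g x" "Ck_on k S f"
  shows "Ck_on k S g"
  using assms(2,3)
proof (induction k arbitrary: f g)
  case 0
  then show ?case by (simp cong: continuous_on_cong)
next
  case (Suc k)
  show ?case
    unfolding Ck_on.simps
  proof (intro conjI ballI allI)
    show "g differentiable (at x)" if "x \<in> S" for x
      using differentiable_cong_open[OF \<open>open S\<close> that, of f g] Suc.prems that by simp
    show "Ck_on k S (\<lambda>x. dir_deriv g x v)" for v
      by (rule Suc.IH[of "\<lambda>x. dir_deriv f x v"])
        (use dir_deriv_cong_open[OF \<open>open S\<close>, of _ f g] Suc.prems in auto)
  qed
qed

lemma Ck_on_diff:
  assumes "open S" "Ck_on k S f" "Ck_on k S g"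
  shows "Ck_on k S (\<lambda>x. f x - g x)"
  using assms(2,3)
proof (induction k arbitrary: f g)
  case 0
  then show ?case by (auto intro: continuous_intros)
next
  case (Suc k)
  show ?case
    unfolding Ck_on.simps
  proof (intro conjI ballI allI)
    show "(\<lambda>x. f x - g x) differentiable (at x)" if "x \<in> S" for x
      using Suc.prems that by (intro differentiable_diff) auto
    show "Ck_on k S (\<lambda>x. dir_deriv (\<lambda>x. f x - g x) x v)" for v
    proof (rule Ck_on_cong[OF \<open>open S\<close> _ Suc.IH])
      show "dir_deriv f x v - dir_deriv g x v = dir_deriv (\<lambda>x. f x - g x) x v" if "x \<in> S" for x
        using Suc.prems that by (subst dir_deriv_eq[OF has_derivative_diff])
          (auto simp: frechet_derivative_works[symmetric])
    qed (use Suc.prems in auto)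
  qed
qed

lemma smooth_on_diff:
  "open S \<Longrightarrow> smooth_on S f \<Longrightarrow> smooth_on S g \<Longrightarrow> smooth_on S (\<lambda>x. f x - g x)"
  by (simp add: smooth_on_def Ck_on_diff)

lemma smooth_on_dir_deriv: "smooth_on S f \<Longrightarrow> smooth_on S (\<lambda>x. dir_deriv f x v)"
  unfolding smooth_on_def using Ck_on.simps(2) by blast

lemma smooth_on_differentiable: "smooth_on S f \<Longrightarrow> x \<in> S \<Longrightarrow> f differentiable (at x)"
  unfolding smooth_on_def using Ck_on.simps(2) by blast

lemma smooth_on_has_derivative:
  "smooth_on S f \<Longrightarrow> x \<in> S \<Longrightarrow> (f has_derivative dir_deriv f x) (at x)"
  using smooth_on_differentiable frechet_derivative_works by blast

lemma smooth_on_continuous: "smooth_on S f \<Longrightarrow> continuous_on S f"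
  unfolding smooth_on_def using Ck_on.simps(1) by blast

text \<open>The cut-off functions used below are squares of positive parts and in general no better
  than C1.\<close>

definition C1_on :: "'e::euclidean_space set \<Rightarrow> ('e \<Rightarrow> 'f::real_normed_vector) \<Rightarrow> bool" where
  "C1_on S f \<longleftrightarrow> (\<forall>x\<in>S. f differentiable (at x)) \<and> (\<forall>v. continuous_on S (\<lambda>x. dir_deriv f x v))"

lemma smooth_on_imp_C1_on: "smooth_on S f \<Longrightarrow> C1_on S f"
  unfolding C1_on_def using smooth_on_differentiable smooth_on_continuous[OF smooth_on_dir_deriv] by blast

lemma C1_onI:
  assumes "\<And>x. x \<in> S \<Longrightarrow> (f has_derivative f' x) (at x)" "\<And>v. continuous_on S (\<lambda>x. f' x v)"
  shows "C1_on S f"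
  unfolding C1_on_def
proof (intro conjI ballI allI)
  show "f differentiable (at x)" if "x \<in> S" for x
    using assms(1)[OF that] unfolding differentiable_def by blast
  show "continuous_on S (\<lambda>x. dir_deriv f x v)" for v
    using assms(2)[of v] dir_deriv_eq[OF assms(1)] by (simp cong: continuous_on_cong)
qed

lemma C1_on_has_derivative: "C1_on S f \<Longrightarrow> x \<in> S \<Longrightarrow> (f has_derivative dir_deriv f x) (at x)"
  unfolding C1_on_def using frechet_derivative_works by blast

lemma C1_on_continuous_deriv: "C1_on S f \<Longrightarrow> continuous_on S (\<lambda>x. dir_deriv f x v)"
  unfolding C1_on_def by blast

lemma C1_on_continuous: "C1_on S f \<Longrightarrow> continuous_on S f"
  unfolding C1_on_def by (meson continuous_at_imp_continuous_on differentiable_imp_continuous_within)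

lemma C1_on_cong:
  assumes "open S" "\<And>x. x \<in> S \<Longrightarrow> f x = g x" "C1_on S f"
  shows "C1_on S g"
  using Ck_on_cong[OF assms(1,2), where k = "Suc 0"] assms(3) by (simp add: C1_on_def)

lemma C1_on_Un: "C1_on S f \<Longrightarrow> C1_on U f \<Longrightarrow> open S \<Longrightarrow> open U \<Longrightarrow> C1_on (S \<union> U) f"
  unfolding C1_on_def using continuous_on_open_Un by blast

lemma C1_on_const: "C1_on S (\<lambda>x. c)"
  by (rule C1_onI[where f' = "\<lambda>_ _. 0"]) auto

lemma C1_on_add:
  assumes "C1_on S f" "C1_on S g"
  shows "C1_on S (\<lambda>x. f x + g x)"
  by (rule C1_onI[OF has_derivative_add])
    (use assms in \<open>auto intro!: continuous_intros C1_on_has_derivative C1_on_continuous_deriv\<close>)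

lemma C1_on_sum:
  assumes "\<And>i. i \<in> I \<Longrightarrow> C1_on S (f i)"
  shows "C1_on S (\<lambda>x. \<Sum>i\<in>I. f i x)"
  using assms by (induction I rule: infinite_finite_induct) (auto intro: C1_on_add C1_on_const)

lemma C1_on_mult:
  fixes f g :: "'e::euclidean_space \<Rightarrow> real"
  assumes "C1_on S f" "C1_on S g"
  shows "C1_on S (\<lambda>x. f x * g x)"
proof (rule C1_onI)
  show "((\<lambda>x. f x * g x) has_derivative (\<lambda>v. f x * dir_deriv g x v + dir_deriv f x v * g x)) (at x)"
    if "x \<in> S" for x
    by (rule has_derivative_mult[OF C1_on_has_derivative[OF assms(1) that] C1_on_has_derivative[OF assms(2) that]])
  show "continuous_on S (\<lambda>x. f x * dir_deriv g x v + dir_deriv f x v * g x)" for v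
    by (intro continuous_on_add continuous_on_mult C1_on_continuous_deriv[OF assms(1)]
        C1_on_continuous_deriv[OF assms(2)] C1_on_continuous[OF assms(1)] C1_on_continuous[OF assms(2)])
qed

lemma C1_on_prod:
  fixes f :: "'i \<Rightarrow> 'e::euclidean_space \<Rightarrow> real"
  assumes "\<And>i. i \<in> I \<Longrightarrow> C1_on S (f i)"
  shows "C1_on S (\<lambda>x. \<Prod>i\<in>I. f i x)"
  using assms by (induction I rule: infinite_finite_induct) (auto intro: C1_on_mult C1_on_const)

lemma C1_on_inverse:
  fixes f :: "'e::euclidean_space \<Rightarrow> real"
  assumes "C1_on S f" "\<And>x. x \<in> S \<Longrightarrow> f x \<noteq> 0"
  shows "C1_on S (\<lambda>x. inverse (f x))"
proof (rule C1_onI)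
  show "((\<lambda>x. inverse (f x)) has_derivative (\<lambda>v. - (inverse (f x) * dir_deriv f x v * inverse (f x)))) (at x)"
    if "x \<in> S" for x
    by (rule Deriv.has_derivative_inverse[OF assms(2)[OF that] C1_on_has_derivative[OF assms(1) that]])
  show "continuous_on S (\<lambda>x. - (inverse (f x) * dir_deriv f x v * inverse (f x)))" for v
    by (intro continuous_intros C1_on_continuous_deriv[OF assms(1)] C1_on_continuous[OF assms(1)])
      (use assms(2) in auto)
qed

lemma C1_on_compose:
  fixes f :: "'e::euclidean_space \<Rightarrow> real" and g :: "'d::euclidean_space \<Rightarrow> 'e"
  assumes f: "C1_on U f" and g: "C1_on S g" and sub: "g ` S \<subseteq> U"
  shows "C1_on S (\<lambda>x. f (g x))"
proof (rule C1_onI)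
  fix x assume x: "x \<in> S"
  show "((\<lambda>x. f (g x)) has_derivative (\<lambda>v. dir_deriv f (g x) (dir_deriv g x v))) (at x)"
    by (rule has_derivative_compose[OF C1_on_has_derivative[OF g x]], rule C1_on_has_derivative[OF f])
      (use sub x in auto)
next
  fix v
  \<comment> \<open>Continuity of the derivative of \<open>f\<close> is known for each fixed
    direction only, so the moving direction is expanded in the basis.\<close>
  have "dir_deriv f (g x) (dir_deriv g x v) = (\<Sum>b\<in>Basis. (dir_deriv g x v \<bullet> b) * dir_deriv f (g x) b)"
    if "x \<in> S" for x
  proof -
    have lin: "linear (dir_deriv f (g x))"
      using has_derivative_linear[OF C1_on_has_derivative[OF f]] that sub by blast
    have "dir_deriv f (g x) (dir_deriv g x v)
      = dir_deriv f (g x) (\<Sum>b\<in>Basis. (dir_deriv g x v \<bullet> b) *\<^sub>R b)"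
      by (simp add: euclidean_representation)
    then show ?thesis by (simp add: linear_sum[OF lin] linear_scale[OF lin])
  qed
  moreover have "continuous_on S (\<lambda>x. \<Sum>b\<in>Basis. (dir_deriv g x v \<bullet> b) * dir_deriv f (g x) b)"
    by (intro continuous_intros C1_on_continuous_deriv[OF g]
        continuous_on_compose2[OF C1_on_continuous_deriv[OF f] C1_on_continuous[OF g] sub])
  ultimately show "continuous_on S (\<lambda>x. dir_deriv f (g x) (dir_deriv g x v))"
    by (simp cong: continuous_on_cong)
qed

section \<open>Symmetry of second derivatives\<close>

lemma has_derivative_along_line:
  assumes "(f has_derivative f') (at (x + s *\<^sub>R u))"
  shows "((\<lambda>s. f (x + s *\<^sub>R u)) has_real_derivative f' u) (at s)"
proof -
  have "((\<lambda>s. x + s *\<^sub>R u) has_derivative (\<lambda>d. d *\<^sub>R u)) (at s)"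
    by (auto intro!: derivative_eq_intros)
  from has_derivative_compose[OF this assms]
  have "((\<lambda>s. f (x + s *\<^sub>R u)) has_derivative (\<lambda>d. f' (d *\<^sub>R u))) (at s)" .
  moreover have "(\<lambda>d. f' (d *\<^sub>R u)) = (*) (f' u)"
    using linear_scale[OF has_derivative_linear[OF assms]] by (auto simp: mult.commute)
  ultimately show ?thesis by (simp add: has_field_derivative_def)
qed

text \<open>The mean value theorem is applied along \<open>u\<close> to the increment of
  \<open>f\<close> in direction \<open>h *\<^sub>R v\<close>, then along \<open>v\<close> to the
  derivative of \<open>f\<close> in direction \<open>u\<close>.\<close>

lemma second_difference_MVT:
  fixes f :: "'e::euclidean_space \<Rightarrow> real"
  assumes h: "h > 0" and S: "\<And>s t. 0 \<le> s \<Longrightarrow> s \<le> h \<Longrightarrow> 0 \<le> t \<Longrightarrow> t \<le> h \<Longrightarrow> x + s *\<^sub>R u + t *\<^sub>R v \<in> S"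
    and f: "C1_on S f" and fu: "C1_on S (\<lambda>y. dir_deriv f y u)"
  shows "\<exists>s t. 0 \<le> s \<and> s \<le> h \<and> 0 \<le> t \<and> t \<le> h \<and>
    f (x + h *\<^sub>R u + h *\<^sub>R v) - f (x + h *\<^sub>R u) - f (x + h *\<^sub>R v) + f x
      = h\<^sup>2 * dir_deriv (\<lambda>y. dir_deriv f y u) (x + s *\<^sub>R u + t *\<^sub>R v) v"
proof -
  let ?\<phi> = "\<lambda>s. f (x + h *\<^sub>R v + s *\<^sub>R u) - f (x + s *\<^sub>R u)"
  have "\<exists>s>0. s < h \<and> ?\<phi> h - ?\<phi> 0
      = (h - 0) * (dir_deriv f (x + h *\<^sub>R v + s *\<^sub>R u) u - dir_deriv f (x + s *\<^sub>R u) u)"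
  proof (rule MVT2[OF h])
    fix s assume "0 \<le> s" "s \<le> h"
    then have "x + h *\<^sub>R v + s *\<^sub>R u \<in> S" "x + s *\<^sub>R u \<in> S"
      using S[of s h] S[of s 0] h by (auto simp: algebra_simps)
    then show "(?\<phi> has_real_derivative
        dir_deriv f (x + h *\<^sub>R v + s *\<^sub>R u) u - dir_deriv f (x + s *\<^sub>R u) u) (at s)"
      by (intro DERIV_diff has_derivative_along_line C1_on_has_derivative[OF f])
  qed
  then obtain s where s: "0 < s" "s < h" and 1: "?\<phi> h - ?\<phi> 0
      = h * (dir_deriv f (x + h *\<^sub>R v + s *\<^sub>R u) u - dir_deriv f (x + s *\<^sub>R u) u)" by auto
  let ?\<psi> = "\<lambda>t. dir_deriv f (x + s *\<^sub>R u + t *\<^sub>R v) u"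
  have "\<exists>t>0. t < h \<and> ?\<psi> h - ?\<psi> 0
      = (h - 0) * dir_deriv (\<lambda>y. dir_deriv f y u) (x + s *\<^sub>R u + t *\<^sub>R v) v"
  proof (rule MVT2[OF h])
    fix t assume "0 \<le> t" "t \<le> h"
    then have "x + s *\<^sub>R u + t *\<^sub>R v \<in> S" using S s by simp
    then show "(?\<psi> has_real_derivative dir_deriv (\<lambda>y. dir_deriv f y u) (x + s *\<^sub>R u + t *\<^sub>R v) v) (at t)"
      by (intro has_derivative_along_line[where f = "\<lambda>y. dir_deriv f y u"] C1_on_has_derivative[OF fu])
  qed
  then obtain t where t: "0 < t" "t < h" and 2: "?\<psi> h - ?\<psi> 0
      = h * dir_deriv (\<lambda>y. dir_deriv f y u) (x + s *\<^sub>R u + t *\<^sub>R v) v" by auto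
  have "?\<phi> h - ?\<phi> 0 = h\<^sup>2 * dir_deriv (\<lambda>y. dir_deriv f y u) (x + s *\<^sub>R u + t *\<^sub>R v) v"
    using 1 2 by (simp add: power2_eq_square add_ac)
  then show ?thesis
    using s t by (intro exI[of _ s] exI[of _ t]) (simp add: algebra_simps)
qed

text \<open>The second difference over a parallelogram is symmetric in \<open>u\<close> and
  \<open>v\<close>. Hence the two mixed derivatives take a common value at points arbitrarily close
  to \<open>x\<close>, and continuity gives equality at \<open>x\<close>.\<close>

lemma symmetric_second_derivative:
  fixes f :: "'e::euclidean_space \<Rightarrow> real"
  assumes S: "open S" "x \<in> S" and f: "C1_on S f" and f': "\<And>u. C1_on S (\<lambda>y. dir_deriv f y u)"
  shows "dir_deriv (\<lambda>y. dir_deriv f y u) x v = dir_deriv (\<lambda>y. dir_deriv f y v) x u"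
proof -
  let ?A = "\<lambda>y. dir_deriv (\<lambda>y. dir_deriv f y u) y v" and ?B = "\<lambda>y. dir_deriv (\<lambda>y. dir_deriv f y v) y u"
  have "\<bar>?A x - ?B x\<bar> \<le> \<epsilon>" if \<epsilon>: "\<epsilon> > 0" for \<epsilon>
  proof -
    have near_value: "\<forall>\<^sub>F y in nhds x. dist (h y) (h x) < \<epsilon> / 2"
      if "isCont h x" for h :: "'e \<Rightarrow> real"
      using tendstoD[OF that[unfolded isCont_def tendsto_at_iff_tendsto_nhds], of "\<epsilon> / 2"] \<epsilon> by simp
    have cont: "isCont ?A x" "isCont ?B x"
      using C1_on_continuous_deriv[OF f'] S by (auto simp: continuous_on_eq_continuous_at)
    have "\<forall>\<^sub>F y in nhds x. dist (?A y) (?A x) < \<epsilon> / 2" "\<forall>\<^sub>F y in nhds x. dist (?B y) (?B x) < \<epsilon> / 2"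
      using near_value[OF cont(1)] near_value[OF cont(2)] by simp_all
    moreover have "\<forall>\<^sub>F y in nhds x. y \<in> S" using S by (simp add: eventually_nhds_in_open)
    ultimately have "\<forall>\<^sub>F y in nhds x. dist (?A y) (?A x) < \<epsilon> / 2 \<and> dist (?B y) (?B x) < \<epsilon> / 2 \<and> y \<in> S"
      by (simp add: eventually_conj_iff)
    then obtain d where d: "d > 0"
      "\<And>y. dist y x < d \<Longrightarrow> dist (?A y) (?A x) < \<epsilon> / 2 \<and> dist (?B y) (?B x) < \<epsilon> / 2 \<and> y \<in> S"
      unfolding eventually_nhds_metric by blast
    \<comment> \<open>With \<open>h = d / 2 / D\<close> the parallelogram spanned by
      \<open>h *\<^sub>R u\<close> and \<open>h *\<^sub>R v\<close> stays within distance
      \<open>d / 2\<close> of \<open>x\<close>; the summand 1 keeps \<open>D\<close> positive when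
      both vectors are zero.\<close>
    define D where "D = 1 + norm u + norm v"
    define h where "h = d / 2 / D"
    have pos: "D > 0" unfolding D_def by (smt (verit) norm_ge_zero)
    then have h: "h > 0" using d by (simp add: h_def)
    have near: "dist (x + s *\<^sub>R u + t *\<^sub>R v) x < d" if "0 \<le> s" "s \<le> h" "0 \<le> t" "t \<le> h" for s t
    proof -
      have "dist (x + s *\<^sub>R u + t *\<^sub>R v) x = norm (s *\<^sub>R u + t *\<^sub>R v)"
        by (simp add: dist_norm)
      also have "\<dots> \<le> s * norm u + t * norm v"
        using norm_triangle_ineq[of "s *\<^sub>R u" "t *\<^sub>R v"] that by simp
      also have "\<dots> \<le> h * norm u + h * norm v"
        using that by (intro add_mono mult_right_mono) auto
      also have "\<dots> \<le> h * D"
        using h by (simp add: D_def algebra_simps)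
      also have "\<dots> = d / 2" using pos by (simp add: h_def)
      finally show ?thesis using d by simp
    qed
    have inS: "x + s *\<^sub>R u + t *\<^sub>R v \<in> S" "x + t *\<^sub>R v + s *\<^sub>R u \<in> S"
      if "0 \<le> s" "s \<le> h" "0 \<le> t" "t \<le> h" for s t
      using d(2)[OF near[OF that]] by (auto simp: add_ac)
    obtain s t where st: "0 \<le> s" "s \<le> h" "0 \<le> t" "t \<le> h"
      and 1: "f (x + h *\<^sub>R u + h *\<^sub>R v) - f (x + h *\<^sub>R u) - f (x + h *\<^sub>R v) + f x
      = h\<^sup>2 * ?A (x + s *\<^sub>R u + t *\<^sub>R v)"
      using second_difference_MVT[OF h inS(1) f f'] by blast
    obtain s' t' where st': "0 \<le> s'" "s' \<le> h" "0 \<le> t'" "t' \<le> h"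
      and 2: "f (x + h *\<^sub>R v + h *\<^sub>R u) - f (x + h *\<^sub>R v) - f (x + h *\<^sub>R u) + f x
      = h\<^sup>2 * ?B (x + t' *\<^sub>R v + s' *\<^sub>R u)"
      using second_difference_MVT[OF h inS(2)[rotated 2] f f'] by blast
    have "h\<^sup>2 * ?A (x + s *\<^sub>R u + t *\<^sub>R v) = h\<^sup>2 * ?B (x + s' *\<^sub>R u + t' *\<^sub>R v)"
      using 1 2 by (simp add: algebra_simps)
    then have "?A (x + s *\<^sub>R u + t *\<^sub>R v) = ?B (x + s' *\<^sub>R u + t' *\<^sub>R v)"
      using h by simp
    moreover have "dist (?A (x + s *\<^sub>R u + t *\<^sub>R v)) (?A x) < \<epsilon> / 2"
      "dist (?B (x + s' *\<^sub>R u + t' *\<^sub>R v)) (?B x) < \<epsilon> / 2"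
      using d(2)[OF near[OF st]] d(2)[OF near[OF st']] by auto
    ultimately show ?thesis unfolding dist_real_def by linarith
  qed
  then have "\<bar>?A x - ?B x\<bar> \<le> 0" by (rule field_le_epsilon[of _ 0, simplified])
  then show ?thesis by simp
qed

section \<open>Integrals of derivatives of compactly supported functions, and bump functions\<close>

lemma continuous_compact_support_integrable:
  fixes f :: "'e::euclidean_space \<Rightarrow> real"
  assumes "continuous_on UNIV f" "compact K" "\<And>x. x \<notin> K \<Longrightarrow> f x = 0"
  shows "integrable lborel f"
proof -
  have "integrable lborel (\<lambda>x. indicator K x *\<^sub>R f x)"
    by (rule borel_integrable_compact) (use assms(2) continuous_on_subset[OF assms(1)] in auto)
  moreover have "(\<lambda>x. indicator K x *\<^sub>R f x) = f"
    using assms(3) by (auto simp: fun_eq_iff indicator_def)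
  ultimately show ?thesis by simp
qed

text \<open>The difference quotients of \<open>g\<close> integrate to zero because Lebesgue measure is invariant under
  translations.\<close>

lemma integral_dir_deriv_eq_0:
  fixes g :: "'e::euclidean_space \<Rightarrow> real"
  assumes g: "C1_on UNIV g" and K: "compact K" "\<And>x. x \<notin> K \<Longrightarrow> g x = 0"
  shows "integrable lborel (\<lambda>x. dir_deriv g x v)" "integral\<^sup>L lborel (\<lambda>x. dir_deriv g x v) = 0"
proof -
  have cont: "continuous_on UNIV (\<lambda>x. dir_deriv g x v)" by (rule C1_on_continuous_deriv[OF g])
  have zero: "dir_deriv g x v = 0" if "x \<notin> K" for x
    using dir_deriv_cong_open[of "- K" x g "\<lambda>_. 0"] K that
    by (simp add: compact_imp_closed open_Compl)
  show int: "integrable lborel (\<lambda>x. dir_deriv g x v)"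
    by (rule continuous_compact_support_integrable[OF cont K(1) zero])
  have "bounded ((\<lambda>x. dir_deriv g x v) ` K)"
    by (intro compact_imp_bounded compact_continuous_image K continuous_on_subset[OF cont]) auto
  then obtain M where M: "M > 0" "\<And>x. x \<in> K \<Longrightarrow> \<bar>dir_deriv g x v\<bar> \<le> M"
    by (auto simp: bounded_pos)
  then have M': "\<bar>dir_deriv g x v\<bar> \<le> M" for x
    using zero[of x] by (cases "x \<in> K") auto
  obtain R where R: "\<And>x. x \<in> K \<Longrightarrow> norm x \<le> R"
    using compact_imp_bounded[OF K(1)] unfolding bounded_iff by blast
  define F where "F n x = real (Suc n) * (g (x + (1 / real (Suc n)) *\<^sub>R v) - g x)" for n x
  have gint: "integrable lborel g"
    by (rule continuous_compact_support_integrable[OF C1_on_continuous[OF g] K])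
  have [measurable]: "g \<in> borel_measurable borel" using gint by auto
  have trans: "integrable lborel (\<lambda>x. g (x + c)) \<and> integral\<^sup>L lborel (\<lambda>x. g (x + c)) = integral\<^sup>L lborel g" for c
  proof -
    have "distr lborel borel (\<lambda>x. x + c) = (lborel :: 'e measure)"
      using lborel_distr_plus[of c] by (simp only: add.commute[of _ c])
    then show ?thesis
      using integrable_distr_eq[of "\<lambda>x. x + c" lborel borel g] integral_distr[of "\<lambda>x. x + c" lborel borel g] gint
      by simp
  qed
  have F0: "integral\<^sup>L lborel (F n) = 0" for n
    unfolding F_def using trans gint by simp
  have Fm: "F n \<in> borel_measurable lborel" for n unfolding F_def by measurable
  have lim: "(\<lambda>n. F n x) \<longlonglongrightarrow> dir_deriv g x v" for x
  proof -
    have "((\<lambda>s. g (x + s *\<^sub>R v)) has_real_derivative dir_deriv g x v) (at 0)"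
      using has_derivative_along_line[of g "dir_deriv g x" x 0 v] C1_on_has_derivative[OF g, of x] by simp
    then have "((\<lambda>s. (g (x + s *\<^sub>R v) - g x) / s) \<longlongrightarrow> dir_deriv g x v) (at 0)"
      by (simp add: has_field_derivative_iff)
    moreover have "filterlim (\<lambda>n. 1 / real (Suc n)) (at 0) sequentially"
      unfolding filterlim_at using LIMSEQ_inverse_real_of_nat by (simp add: inverse_eq_divide)
    ultimately have "(\<lambda>n. (g (x + (1 / real (Suc n)) *\<^sub>R v) - g x) / (1 / real (Suc n))) \<longlonglongrightarrow> dir_deriv g x v"
      by (rule filterlim_compose)
    then show ?thesis by (simp add: F_def mult.commute)
  qed
  \<comment> \<open>The step is at most 1, so all difference quotients vanish outside the ball of
    radius \<open>R + norm v\<close>; inside it the mean value theorem bounds them by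
    \<open>M\<close>.\<close>
  have bound: "norm (F n x) \<le> M * indicator (cball 0 (R + norm v)) x" for n x
  proof (cases "norm x \<le> R + norm v")
    case True
    let ?t = "1 / real (Suc n)"
    have "\<exists>z>0. z < ?t \<and> g (x + ?t *\<^sub>R v) - g (x + 0 *\<^sub>R v) = (?t - 0) * dir_deriv g (x + z *\<^sub>R v) v"
      by (rule MVT2) (simp, rule has_derivative_along_line[OF C1_on_has_derivative[OF g UNIV_I]])
    then obtain z where "g (x + ?t *\<^sub>R v) - g x = ?t * dir_deriv g (x + z *\<^sub>R v) v" by auto
    then have "F n x = dir_deriv g (x + z *\<^sub>R v) v" by (simp add: F_def)
    then show ?thesis using M' True by simp
  next
    case False
    let ?t = "1 / real (Suc n)"
    have "norm (?t *\<^sub>R v) \<le> norm v" using mult_right_mono[of ?t 1 "norm v"] by simp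
    then have "norm (x + ?t *\<^sub>R v) > R"
      using False norm_diff_ineq[of x "?t *\<^sub>R v"] by linarith
    moreover have "norm x > R" using False norm_ge_zero[of v] by linarith
    ultimately have "g (x + ?t *\<^sub>R v) = 0" "g x = 0" using R K(2) by fastforce+
    then show ?thesis using M by (simp add: F_def)
  qed
  have "(\<lambda>n. integral\<^sup>L lborel (F n)) \<longlonglongrightarrow> integral\<^sup>L lborel (\<lambda>x. dir_deriv g x v)"
  proof (rule integral_dominated_convergence)
    show "integrable lborel (\<lambda>x. M * indicator (cball 0 (R + norm v)) x :: real)"
      by (rule integrable_mult_right, rule integrable_real_indicator)
        (simp, rule emeasure_bounded_finite[OF bounded_cball])
  qed (use Fm lim bound int in auto)
  then show "integral\<^sup>L lborel (\<lambda>x. dir_deriv g x v) = 0"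
    by (simp add: F0 LIMSEQ_const_iff)
qed

text \<open>Extension by zero reduces this to the whole space: \<open>U\<close> and the complement
  of \<open>K\<close> are open, cover everything, and the extension is C1 on both.\<close>

lemma set_integral_dir_deriv_eq_0:
  fixes g :: "'e::euclidean_space \<Rightarrow> real"
  assumes U: "open U" and g: "C1_on U g" and K: "compact K" "K \<subseteq> U" "\<And>x. x \<in> U - K \<Longrightarrow> g x = 0"
  shows "set_integrable lborel U (\<lambda>x. dir_deriv g x v)" "(LINT x:U|lborel. dir_deriv g x v) = 0"
proof -
  define G where "G x = (if x \<in> U then g x else 0)" for x
  have "C1_on U G" by (rule C1_on_cong[OF U _ g]) (simp add: G_def)
  moreover have "C1_on (- K) G"
    by (rule C1_on_cong[OF _ _ C1_on_const[of _ 0]]) (use K in \<open>auto simp: G_def compact_imp_closed open_Compl\<close>)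
  ultimately have "C1_on (U \<union> - K) G"
    by (rule C1_on_Un) (use U K in \<open>auto simp: compact_imp_closed open_Compl\<close>)
  moreover have "U \<union> - K = UNIV" using K by auto
  ultimately have G: "C1_on UNIV G" by simp
  have GK: "G x = 0" if "x \<notin> K" for x using K that by (auto simp: G_def)
  have eq: "indicator U x *\<^sub>R dir_deriv g x v = dir_deriv G x v" for x
  proof (cases "x \<in> U")
    case True
    then show ?thesis using dir_deriv_cong_open[OF U True, of G g] by (simp add: G_def)
  next
    case False
    then have "x \<in> - K" using K by auto
    then have "dir_deriv G x = dir_deriv (\<lambda>_. 0) x"
      by (intro dir_deriv_cong_open[of "- K"]) (use K GK in \<open>auto simp: compact_imp_closed open_Compl\<close>)
    then show ?thesis using False by simp
  qed
  show "set_integrable lborel U (\<lambda>x. dir_deriv g x v)" "(LINT x:U|lborel. dir_deriv g x v) = 0"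
    unfolding set_integrable_def set_lebesgue_integral_def eq
    using integral_dir_deriv_eq_0[OF G K(1) GK] by simp_all
qed

text \<open>The outer square makes the positive part differentiable across the sphere of radius
  \<open>r\<close>; the squared distance keeps the function differentiable at
  \<open>p\<close>.\<close>

definition bump :: "'e::euclidean_space \<Rightarrow> real \<Rightarrow> 'e \<Rightarrow> real" where
  "bump p r x = (max 0 (r\<^sup>2 - (x - p) \<bullet> (x - p)))\<^sup>2"

lemma bump_nonneg: "bump p r x \<ge> 0" by (simp add: bump_def)

lemma bump_pos: "dist p x < r \<Longrightarrow> bump p r x > 0"
  using power_strict_mono[of "norm (x - p)" r 2]
  by (simp add: bump_def dist_norm norm_minus_commute power2_norm_eq_inner[symmetric])

lemma bump_eq_0: "r > 0 \<Longrightarrow> x \<notin> cball p r \<Longrightarrow> bump p r x = 0"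
  using power_strict_mono[of r "norm (x - p)" 2]
  by (simp add: bump_def dist_norm norm_minus_commute power2_norm_eq_inner[symmetric])

lemma has_real_derivative_max_square:
  "((\<lambda>t::real. (max 0 t)\<^sup>2) has_real_derivative 2 * max 0 t) (at t)"
proof -
  consider "t > 0" | "t < 0" | "t = 0" by linarith
  then show ?thesis
  proof cases
    case 1
    have "((\<lambda>t::real. t\<^sup>2) has_real_derivative 2 * max 0 t) (at t)"
      using 1 by (auto intro!: derivative_eq_intros)
    then show ?thesis
      by (rule has_field_derivative_transform_within_open[of _ _ _ "{0<..}"]) (use 1 in auto)
  next
    case 2
    have "((\<lambda>t::real. 0) has_real_derivative 2 * max 0 t) (at t)"
      using 2 by (auto intro!: derivative_eq_intros)
    then show ?thesis
      by (rule has_field_derivative_transform_within_open[of _ _ _ "{..<0}"]) (use 2 in auto)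
  next
    case 3
    have "((\<lambda>h::real. (max 0 h)\<^sup>2 / h) \<longlongrightarrow> 0) (at 0)"
    proof (rule Lim_null_comparison)
      show "\<forall>\<^sub>F h in at 0. norm ((max 0 h)\<^sup>2 / h) \<le> \<bar>h\<bar>"
        by (auto simp: power2_eq_square max_def abs_mult intro!: always_eventually)
      show "((\<lambda>h::real. \<bar>h\<bar>) \<longlongrightarrow> 0) (at 0)"
        by (rule tendsto_eq_intros | simp)+
    qed
    then show ?thesis using 3 by (simp add: has_field_derivative_iff)
  qed
qed

lemma C1_on_bump: "C1_on S (bump p r)"
proof (rule C1_onI)
  fix x
  have "((\<lambda>x. r\<^sup>2 - (x - p) \<bullet> (x - p)) has_derivative (\<lambda>v. - (2 * ((x - p) \<bullet> v)))) (at x)"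
    by (auto intro!: derivative_eq_intros simp: inner_commute)
  from has_derivative_compose[OF this has_real_derivative_max_square[unfolded has_field_derivative_def]]
  show "(bump p r has_derivative (\<lambda>v. 2 * max 0 (r\<^sup>2 - (x - p) \<bullet> (x - p)) * - (2 * ((x - p) \<bullet> v)))) (at x)"
    by (simp add: bump_def[abs_def])
qed (intro continuous_intros)

section \<open>Integration on a closed manifold\<close>

definition in_chart :: "('a, 'e) chart \<Rightarrow> ('a \<Rightarrow> real) \<Rightarrow> 'e \<Rightarrow> real" where
  "in_chart c f x = f (inv_into (fst c) (snd c) x)"

definition C1_function :: "('a, 'e::euclidean_space) chart set \<Rightarrow> ('a \<Rightarrow> real) \<Rightarrow> bool" where
  "C1_function A f \<longleftrightarrow> (\<forall>c\<in>A. C1_on (coord_dom c) (in_chart c f))"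

definition overlap :: "('a, 'e) chart \<Rightarrow> ('a, 'e) chart \<Rightarrow> 'e set" where
  "overlap c c' = snd c ` (fst c \<inter> fst c')"

lemma overlap_subset: "overlap c c' \<subseteq> coord_dom c"
  by (auto simp: overlap_def coord_dom_def)

locale closed_atlas =
  fixes T :: "'a topology" and A :: "('a, 'e::euclidean_space) chart set"
  assumes closed: "closed_manifold T A"
begin

lemma atlas: "smooth_atlas T A" and Hausdorff: "Hausdorff_space T" and compact: "compact_space T"
  and nonempty: "topspace T \<noteq> {}"
  using closed by (auto simp: closed_manifold_def smooth_manifold_def)

lemma topspace_eq: "topspace T = (\<Union>c\<in>A. fst c)"
  using atlas by (simp add: smooth_atlas_def)

context
  fixes c assumes c: "c \<in> A"
begin

lemma open_fst: "openin T (fst c)"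
  and open_coord_dom: "open (coord_dom c)"
  and homeo: "homeomorphic_map (subtopology T (fst c)) (top_of_set (coord_dom c)) (snd c)"
  using atlas c by (auto simp: smooth_atlas_def)

lemma topspace_chart: "topspace (subtopology T (fst c)) = fst c"
  using openin_subset[OF open_fst] by auto

lemma inj_chart: "inj_on (snd c) (fst c)"
  using homeomorphic_imp_injective_map[OF homeo] by (simp only: topspace_chart)

lemma inv_chart [simp]: "m \<in> fst c \<Longrightarrow> inv_into (fst c) (snd c) (snd c m) = m"
  by (rule inv_into_f_f[OF inj_chart])

lemma in_chart_apply: "m \<in> fst c \<Longrightarrow> in_chart c f (snd c m) = f m"
  by (simp add: in_chart_def)

lemma transition_apply: "m \<in> fst c \<Longrightarrow> transition c c' (snd c m) = snd c' m"
  by (simp add: transition_def)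

lemma open_image:
  assumes "openin T V" "V \<subseteq> fst c"
  shows "open (snd c ` V)"
proof -
  have "openin (subtopology T (fst c)) V"
    using assms open_fst by (simp add: openin_open_subtopology)
  then have "openin (top_of_set (coord_dom c)) (snd c ` V)"
    using homeomorphic_imp_open_map[OF homeo] by (simp add: open_map_def)
  then show ?thesis
    using open_coord_dom openin_open_trans by blast
qed

lemma open_preimage:
  assumes "open W"
  shows "openin T {m \<in> fst c. snd c m \<in> W}"
proof -
  have "continuous_map (subtopology T (fst c)) euclidean (snd c)"
    using homeomorphic_imp_continuous_map[OF homeo] by (simp add: continuous_map_in_subtopology)
  from openin_continuous_map_preimage[OF this, of W] assms
  have "openin (subtopology T (fst c)) {m \<in> fst c. snd c m \<in> W}"
    by (simp only: topspace_chart open_openin[symmetric])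
  then show ?thesis by (rule openin_trans_full[OF _ open_fst])
qed

text \<open>A compact set in a chart is compact in \<open>T\<close>, and \<open>T\<close> is
  Hausdorff. Closedness in the whole manifold is what allows functions to be extended by zero beyond
  the chart.\<close>

lemma closed_preimage:
  assumes K: "compact K" "K \<subseteq> coord_dom c"
  shows "closedin T {m \<in> fst c. snd c m \<in> K}"
proof -
  obtain g where g: "homeomorphic_maps (subtopology T (fst c)) (top_of_set (coord_dom c)) (snd c) g"
    using homeo homeomorphic_map_maps by blast
  then have cont: "continuous_map (top_of_set (coord_dom c)) (subtopology T (fst c)) g"
    and gf: "\<And>m. m \<in> fst c \<Longrightarrow> g (snd c m) = m"
    unfolding homeomorphic_maps_def topspace_chart by auto
  have "compactin (top_of_set (coord_dom c)) K"
    using K by (simp add: compactin_subtopology)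
  then have "compactin (subtopology T (fst c)) (g ` K)"
    using image_compactin cont by blast
  then have "compactin T (g ` K)" by (simp add: compactin_subtopology)
  moreover have "g ` K = {m \<in> fst c. snd c m \<in> K}"
  proof
    show "g ` K \<subseteq> {m \<in> fst c. snd c m \<in> K}"
    proof
      fix y assume "y \<in> g ` K"
      then obtain x where x: "x \<in> K" "y = g x" by blast
      then obtain m where "m \<in> fst c" "x = snd c m" using K by (auto simp: coord_dom_def)
      then show "y \<in> {m \<in> fst c. snd c m \<in> K}" using x gf by simp
    qed
    show "{m \<in> fst c. snd c m \<in> K} \<subseteq> g ` K"
    proof
      fix m assume "m \<in> {m \<in> fst c. snd c m \<in> K}"
      then have "m = g (snd c m)" "snd c m \<in> K" using gf by auto
      then show "m \<in> g ` K" by blast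
    qed
  qed
  ultimately show ?thesis using compactin_imp_closedin[OF Hausdorff] by simp
qed

lemma open_overlap: "c' \<in> A \<Longrightarrow> open (overlap c c')"
  unfolding overlap_def using atlas c
  by (intro open_image openin_Int) (auto simp: smooth_atlas_def)

lemma smooth_transition: "c' \<in> A \<Longrightarrow> smooth_on (overlap c c') (transition c c')"
  unfolding overlap_def using atlas c by (auto simp: smooth_atlas_def)

lemma inj_transition:
  assumes "c' \<in> A"
  shows "inj_on (transition c c') (overlap c c')"
proof (rule inj_onI)
  fix x y assume "x \<in> overlap c c'" "y \<in> overlap c c'" and eq: "transition c c' x = transition c c' y"
  then obtain m m' where m: "m \<in> fst c" "m \<in> fst c'" "x = snd c m" "m' \<in> fst c" "m' \<in> fst c'" "y = snd c m'"
    by (auto simp: overlap_def)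
  then have "snd c' m = snd c' m'" using eq by (simp add: transition_apply)
  moreover have "inj_on (snd c') (fst c')"
    using assms atlas homeomorphic_imp_injective_map[of "subtopology T (fst c')" _ "snd c'"] openin_subset[of T "fst c'"]
    by (auto simp: smooth_atlas_def inf.absorb2)
  ultimately show "x = y" using m by (simp add: inj_on_eq_iff)
qed

end

lemma in_chart_transition:
  assumes "c \<in> A" "c' \<in> A" "x \<in> overlap c c'"
  shows "in_chart c f x = in_chart c' f (transition c c' x)"
  using assms by (auto simp: overlap_def in_chart_apply transition_apply)

lemma transition_in_coord_dom:
  assumes "c \<in> A" "x \<in> overlap c c'"
  shows "transition c c' x \<in> coord_dom c'"
  using assms by (auto simp: overlap_def coord_dom_def transition_apply)

text \<open>Each chart domain is covered by its overlap with \<open>c0\<close> and the open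
  complement of the preimage of the ball. The function is a bump composed with a transition map on
  the first part and zero on the second.\<close>

lemma C1_function_bump:
  assumes c0: "c0 \<in> A" and r: "r > 0" and K: "cball p r \<subseteq> coord_dom c0"
  shows "C1_function A (\<lambda>m. if m \<in> fst c0 then bump p r (snd c0 m) else 0)" (is "C1_function A ?f")
  unfolding C1_function_def
proof
  fix c assume c: "c \<in> A"
  let ?Z = "snd c ` (fst c - {m \<in> fst c0. snd c0 m \<in> cball p r})"
  have "C1_on (overlap c c0) (\<lambda>x. bump p r (transition c c0 x))"
    using C1_on_compose[OF C1_on_bump[of UNIV p r] smooth_on_imp_C1_on[OF smooth_transition[OF c c0]]] by simp
  then have 1: "C1_on (overlap c c0) (in_chart c ?f)"
    by (rule C1_on_cong[OF open_overlap[OF c c0], rotated])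
      (auto simp: overlap_def in_chart_apply[OF c] transition_apply[OF c])
  have oZ: "open ?Z"
    by (rule open_image[OF c]) (use openin_diff[OF open_fst[OF c] closed_preimage[OF c0 _ K]] in auto)
  have 2: "C1_on ?Z (in_chart c ?f)"
  proof (rule C1_on_cong[OF oZ _ C1_on_const[of _ 0]])
    fix x assume "x \<in> ?Z"
    then obtain m where "m \<in> fst c" "x = snd c m" and m: "\<not> (m \<in> fst c0 \<and> snd c0 m \<in> cball p r)" by blast
    then have "in_chart c ?f x = ?f m" using in_chart_apply[OF c, of m ?f] by simp
    also have "\<dots> = 0" using m bump_eq_0[OF r, of "snd c0 m" p] by (cases "m \<in> fst c0") simp_all
    finally show "0 = in_chart c ?f x" by simp
  qed
  have "overlap c c0 \<union> ?Z = coord_dom c"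
    by (auto simp: overlap_def coord_dom_def)
  then show "C1_on (coord_dom c) (in_chart c ?f)"
    using C1_on_Un[OF 1 2 open_overlap[OF c c0] oZ] by simp
qed

text \<open>By compactness finitely many bumps, each supported in a closed ball of one chart, have a
  positive sum; dividing by the sum normalises them.\<close>

lemma finite_partition_of_unity:
  obtains N :: nat and ch K \<rho> where
    "N > 0"
    "\<And>i. i < N \<Longrightarrow> ch i \<in> A" "\<And>i. i < N \<Longrightarrow> fst (ch i) \<noteq> {}"
    "(\<Union>i<N. fst (ch i)) = topspace T"
    "\<And>i. i < N \<Longrightarrow> compact (K i)" "\<And>i. i < N \<Longrightarrow> K i \<subseteq> coord_dom (ch i)"
    "\<And>i. i < N \<Longrightarrow> C1_function A (\<rho> i)"
    "\<And>i m. i < N \<Longrightarrow> \<not> (m \<in> fst (ch i) \<and> snd (ch i) m \<in> K i) \<Longrightarrow> \<rho> i m = 0"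
    "\<And>m. m \<in> topspace T \<Longrightarrow> (\<Sum>i<N. \<rho> i m) = 1"
proof -
  have "\<exists>c r. c \<in> A \<and> m \<in> fst c \<and> r > 0 \<and> cball (snd c m) r \<subseteq> coord_dom c" if m: "m \<in> topspace T" for m
  proof -
    obtain c where c: "c \<in> A" "m \<in> fst c" using m unfolding topspace_eq by blast
    then have "snd c m \<in> coord_dom c" by (auto simp: coord_dom_def)
    then obtain r where "r > 0" "cball (snd c m) r \<subseteq> coord_dom c"
      using open_coord_dom[OF c(1)] open_contains_cball by blast
    then show ?thesis using c by blast
  qed
  then obtain C R where CR: "\<And>m. m \<in> topspace T \<Longrightarrow> C m \<in> A \<and> m \<in> fst (C m) \<and> R m > (0::real)
      \<and> cball (snd (C m) m) (R m) \<subseteq> coord_dom (C m)"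
    by metis
  \<comment> \<open>The bump with this centre and radius, extended by zero outside the chart, is
    positive on \<open>V m\<close>.\<close>
  define V where "V m = {m' \<in> fst (C m). snd (C m) m' \<in> ball (snd (C m) m) (R m)}" for m
  have "openin T (V m)" if "m \<in> topspace T" for m
    unfolding V_def by (rule open_preimage) (use CR[OF that] in auto)
  then have "\<forall>U\<in>V ` topspace T. openin T U" by blast
  moreover have "m \<in> V m" if "m \<in> topspace T" for m
    using CR[OF that] by (simp add: V_def)
  then have "topspace T \<subseteq> \<Union>(V ` topspace T)" by blast
  ultimately obtain \<F> where "finite \<F>" "\<F> \<subseteq> V ` topspace T" "topspace T \<subseteq> \<Union>\<F>"
    using compact unfolding compact_space_alt by metis
  then obtain P where P: "finite P" "P \<subseteq> topspace T" "topspace T \<subseteq> \<Union>(V ` P)"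
    by (metis finite_subset_image)
  obtain h where h: "bij_betw h {..<card P} P"
    using ex_bij_betw_nat_finite[OF P(1)] by (auto simp: atLeast0LessThan)
  define N where "N = card P"
  have hP: "h i \<in> P" "h i \<in> topspace T" if "i < N" for i
    using h that P(2) by (auto simp: bij_betw_def N_def)
  define f where "f i m = (if m \<in> fst (C (h i)) then bump (snd (C (h i)) (h i)) (R (h i)) (snd (C (h i)) m) else 0)" for i m
  define F where "F m = (\<Sum>i<N. f i m)" for m
  have f_nonneg: "f i m \<ge> 0" for i m by (simp add: f_def bump_nonneg)
  have ex: "\<exists>i<N. m \<in> V (h i)" if m: "m \<in> topspace T" for m
  proof -
    obtain q where "q \<in> P" "m \<in> V q" using P(3) m by auto
    moreover from this obtain i where "i < N" "q = h i" using h by (auto simp: bij_betw_def N_def)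
    ultimately show ?thesis by blast
  qed
  have F_pos: "F m > 0" if m: "m \<in> topspace T" for m
  proof -
    obtain i where i: "i < N" "m \<in> V (h i)" using ex[OF m] by blast
    then have "f i m > 0" by (simp add: f_def V_def bump_pos)
    then show ?thesis unfolding F_def using i f_nonneg by (intro sum_pos2[of _ i]) auto
  qed
  have f_C1: "C1_function A (f i)" if "i < N" for i
    unfolding f_def using CR[OF hP(2)[OF that]] by (intro C1_function_bump) auto
  have quot_C1: "C1_function A (\<lambda>m. f i m * inverse (F m))" if i: "i < N" for i
    unfolding C1_function_def
  proof
    fix c assume c: "c \<in> A"
    have "C1_on (coord_dom c) (in_chart c (f j))" if "j < N" for j
      using f_C1[OF that] c by (simp add: C1_function_def)
    then have "C1_on (coord_dom c) (\<lambda>x. in_chart c (f i) x * inverse (\<Sum>j<N. in_chart c (f j) x))"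
    proof (intro C1_on_mult C1_on_inverse C1_on_sum)
      fix x assume "x \<in> coord_dom c"
      then obtain m where m: "m \<in> fst c" "x = snd c m" by (auto simp: coord_dom_def)
      then have "m \<in> topspace T" using c topspace_eq by auto
      then show "(\<Sum>j<N. in_chart c (f j) x) \<noteq> 0"
        using F_pos[of m] m by (simp add: in_chart_apply[OF c] F_def)
    qed (use i in auto)
    then show "C1_on (coord_dom c) (in_chart c (\<lambda>m. f i m * inverse (F m)))"
      by (simp add: in_chart_def[abs_def] F_def)
  qed
  \<comment> \<open>A point of the manifold guarantees that index 0 exists; the contradiction is
    eventually found in chart 0.\<close>
  obtain m0 where m0: "m0 \<in> topspace T" using nonempty by blast
  show thesis
  proof (rule that[of N "\<lambda>i. C (h i)" "\<lambda>i. cball (snd (C (h i)) (h i)) (R (h i))" "\<lambda>i m. f i m * inverse (F m)"])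
    show "N > 0" using ex[OF m0] by auto
    show "C (h i) \<in> A" "fst (C (h i)) \<noteq> {}" "cball (snd (C (h i)) (h i)) (R (h i)) \<subseteq> coord_dom (C (h i))" if "i < N" for i
      using CR[OF hP(2)[OF that]] by auto
    show "(\<Union>i<N. fst (C (h i))) = topspace T"
    proof
      show "(\<Union>i<N. fst (C (h i))) \<subseteq> topspace T"
        using CR hP(2) topspace_eq by blast
      show "topspace T \<subseteq> (\<Union>i<N. fst (C (h i)))"
        using ex by (fastforce simp: V_def)
    qed
    show "compact (cball (snd (C (h i)) (h i)) (R (h i)))" for i by simp
    show "C1_function A (\<lambda>m. f i m * inverse (F m))" if "i < N" for i using quot_C1[OF that] .
    show "f i m * inverse (F m) = 0"
      if "i < N" "\<not> (m \<in> fst (C (h i)) \<and> snd (C (h i)) m \<in> cball (snd (C (h i)) (h i)) (R (h i)))" for i m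
      using that(2) CR[OF hP(2)[OF that(1)]] by (auto simp: f_def bump_eq_0 simp del: mem_cball)
    show "(\<Sum>i<N. f i m * inverse (F m)) = 1" if "m \<in> topspace T" for m
      using F_pos[OF that] by (simp add: sum_distrib_right[symmetric] F_def[symmetric])
  qed
qed

text \<open>\<open>E c f\<close> stands for \<open>d(f \<eta>)\<close> in the chart \<open>c\<close>, where \<open>d\<eta>\<close> is \<open>\<kappa>\<close> times the volume form \<open>\<Omega>\<close>.
  Coordinate changes need not preserve orientation; multiplying by the sign of \<open>\<Omega>\<close> turns these forms
  into densities.\<close>

lemma no_exact_volume_form:
  fixes \<Omega> :: "('a, 'e) chart \<Rightarrow> 'e \<Rightarrow> real" and E :: "('a, 'e) chart \<Rightarrow> ('a \<Rightarrow> real) \<Rightarrow> 'e \<Rightarrow> real"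
  assumes \<Omega>_cont: "\<And>c. c \<in> A \<Longrightarrow> continuous_on (coord_dom c) (\<Omega> c)"
    and \<Omega>_nz: "\<And>c x. c \<in> A \<Longrightarrow> x \<in> coord_dom c \<Longrightarrow> \<Omega> c x \<noteq> 0"
    and \<Omega>_trans: "\<And>c c' x. c \<in> A \<Longrightarrow> c' \<in> A \<Longrightarrow> x \<in> overlap c c' \<Longrightarrow>
      \<Omega> c x = jacobian (dir_deriv (transition c c') x) * \<Omega> c' (transition c c' x)"
    and E_cont: "\<And>c f. c \<in> A \<Longrightarrow> C1_function A f \<Longrightarrow> continuous_on (coord_dom c) (E c f)"
    and E_trans: "\<And>c c' f x. c \<in> A \<Longrightarrow> c' \<in> A \<Longrightarrow> C1_function A f \<Longrightarrow> x \<in> overlap c c' \<Longrightarrow>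
      E c f x = jacobian (dir_deriv (transition c c') x) * E c' f (transition c c' x)"
    and E_local: "\<And>c f m V. c \<in> A \<Longrightarrow> openin T V \<Longrightarrow> m \<in> V \<Longrightarrow> m \<in> fst c \<Longrightarrow>
      (\<And>m'. m' \<in> V \<Longrightarrow> f m' = 0) \<Longrightarrow> E c f (snd c m) = 0"
    and E_integral: "\<And>c f K. c \<in> A \<Longrightarrow> C1_function A f \<Longrightarrow> compact K \<Longrightarrow> K \<subseteq> coord_dom c \<Longrightarrow>
      (\<And>x. x \<in> coord_dom c - K \<Longrightarrow> in_chart c f x = 0) \<Longrightarrow>
      set_integrable lborel (coord_dom c) (\<lambda>x. sgn (\<Omega> c x) * E c f x) \<and>
      (LINT x:coord_dom c|lborel. sgn (\<Omega> c x) * E c f x) = 0"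
    and E_sum: "\<And>c x (\<rho> :: nat \<Rightarrow> 'a \<Rightarrow> real) N. c \<in> A \<Longrightarrow> x \<in> coord_dom c \<Longrightarrow> (\<And>i. i < N \<Longrightarrow> C1_function A (\<rho> i)) \<Longrightarrow>
      (\<And>m. m \<in> topspace T \<Longrightarrow> (\<Sum>i<N. \<rho> i m) = 1) \<Longrightarrow> (\<Sum>i<N. E c (\<rho> i) x) = \<kappa> * \<Omega> c x"
    and \<kappa>: "\<kappa> \<noteq> 0"
  shows False
proof -
  obtain N :: nat and ch K \<rho> where N: "N > 0"
    and ch: "\<And>i. i < N \<Longrightarrow> ch i \<in> A" and ch_ne: "\<And>i. i < N \<Longrightarrow> fst (ch i) \<noteq> {}"
    and cover: "(\<Union>i<N. fst (ch i)) = topspace T"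
    and K: "\<And>i. i < N \<Longrightarrow> compact (K i)" "\<And>i. i < N \<Longrightarrow> K i \<subseteq> coord_dom (ch i)"
    and \<rho>: "\<And>i. i < N \<Longrightarrow> C1_function A (\<rho> i)"
    and \<rho>0: "\<And>i m. i < N \<Longrightarrow> \<not> (m \<in> fst (ch i) \<and> snd (ch i) m \<in> K i) \<Longrightarrow> \<rho> i m = 0"
    and \<rho>1: "\<And>m. m \<in> topspace T \<Longrightarrow> (\<Sum>i<N. \<rho> i m) = 1"
    by (rule finite_partition_of_unity) (rule that; assumption)
  \<comment> \<open>The points whose first chart in the list is number \<open>k\<close>. These sets
    partition the manifold, so no point is counted twice.\<close>
  define B where "B k = fst (ch k) - (\<Union>j<k. fst (ch j))" for k
  define G where "G k i x = sgn (\<Omega> (ch k) x) * E (ch k) (\<rho> i) x" for k i x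
  \<comment> \<open>The part of piece \<open>k\<close> inside chart \<open>i\<close>, seen in the
    coordinates of chart \<open>k\<close>; \<open>Q\<close> is the same set in the coordinates of
    chart \<open>i\<close>.\<close>
  define P where "P k i = snd (ch k) ` (B k \<inter> fst (ch i))" for k i
  define Q where "Q k i = snd (ch i) ` (B k \<inter> fst (ch i))" for k i
  have fst_sub: "fst (ch i) \<subseteq> topspace T" if "i < N" for i
    using cover that by blast
  have borel_image: "snd (ch l) ` (B k \<inter> fst (ch i)) \<in> sets borel"
    if "l < N" "k < N" "i < N" "B k \<inter> fst (ch i) \<subseteq> fst (ch l)" for l k i
  proof -
    have op: "openin T (fst (ch j))" if "j < N" for j using open_fst[OF ch[OF that]] .
    let ?X = "fst (ch l) \<inter> fst (ch k) \<inter> fst (ch i)"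
    \<comment> \<open>As a difference of two open sets, the image is Borel.\<close>
    have "B k \<inter> fst (ch i) = ?X - ?X \<inter> (\<Union>j<k. fst (ch j))"
      using that(4) by (auto simp: B_def)
    then have "snd (ch l) ` (B k \<inter> fst (ch i)) = snd (ch l) ` ?X - snd (ch l) ` (?X \<inter> (\<Union>j<k. fst (ch j)))"
      using inj_on_image_set_diff[OF inj_chart[OF ch[OF that(1)]], of ?X "?X \<inter> (\<Union>j<k. fst (ch j))"] by auto
    moreover have "open (snd (ch l) ` ?X)" "open (snd (ch l) ` (?X \<inter> (\<Union>j<k. fst (ch j))))"
    proof -
      have X: "openin T ?X" using that by (intro openin_Int op)
      have "openin T (\<Union>j<k. fst (ch j))"
        by (rule openin_Union) (use op that(2) in auto)
      then have XU: "openin T (?X \<inter> (\<Union>j<k. fst (ch j)))" by (rule openin_Int[OF X])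
      show "open (snd (ch l) ` ?X)" by (rule open_image[OF ch[OF that(1)] X]) blast
      show "open (snd (ch l) ` (?X \<inter> (\<Union>j<k. fst (ch j))))" by (rule open_image[OF ch[OF that(1)] XU]) blast
    qed
    ultimately show ?thesis by simp
  qed
  have P_borel: "P k i \<in> sets borel" and Q_borel: "Q k i \<in> sets borel" if "k < N" "i < N" for k i
  proof -
    have sub: "B k \<inter> fst (ch i) \<subseteq> fst (ch k)" "B k \<inter> fst (ch i) \<subseteq> fst (ch i)"
      by (auto simp: B_def)
    show "P k i \<in> sets borel" unfolding P_def by (rule borel_image[OF that(1) that sub(1)])
    show "Q k i \<in> sets borel" unfolding Q_def by (rule borel_image[OF that(2) that sub(2)])
  qed
  have G_cont: "continuous_on (coord_dom (ch k)) (G k i)" if "k < N" "i < N" for k i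
    unfolding G_def
  proof (rule continuous_on_mult)
    show "continuous_on (coord_dom (ch k)) (\<lambda>x. sgn (\<Omega> (ch k) x))"
      using \<Omega>_nz[OF ch[OF that(1)]] by (intro continuous_on_sgn \<Omega>_cont ch that(1)) blast
    show "continuous_on (coord_dom (ch k)) (E (ch k) (\<rho> i))"
      by (rule E_cont[OF ch[OF that(1)] \<rho>[OF that(2)]])
  qed
  have G_int: "set_integrable lborel (coord_dom (ch i)) (G i i)" "(LINT x:coord_dom (ch i)|lborel. G i i x) = 0" if i: "i < N" for i
  proof -
    have "in_chart (ch i) (\<rho> i) x = 0" if "x \<in> coord_dom (ch i) - K i" for x
      using that by (auto simp: coord_dom_def in_chart_apply[OF ch[OF i]] intro!: \<rho>0[OF i])
    from E_integral[OF ch[OF i] \<rho>[OF i] K(1)[OF i] K(2)[OF i] this]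
    show "set_integrable lborel (coord_dom (ch i)) (G i i)" "(LINT x:coord_dom (ch i)|lborel. G i i x) = 0"
      unfolding G_def by auto
  qed
  have Q_int: "set_integrable lborel (Q k i) (G i i)" if "k < N" "i < N" for k i
    by (rule set_integrable_subset[OF G_int(1)[OF that(2)]])
      (use Q_borel[OF that] in \<open>auto simp: Q_def coord_dom_def\<close>)
  have cov: "set_integrable lborel (P k i) (G k i) \<and> (LINT x:P k i|lborel. G k i x) = (LINT x:Q k i|lborel. G i i x)"
    if k: "k < N" and i: "i < N" for k i
  proof -
    let ?t = "transition (ch k) (ch i)"
    have B_sub: "B k \<inter> fst (ch i) \<subseteq> fst (ch k) \<inter> fst (ch i)" by (auto simp: B_def)
    then have P_overlap: "P k i \<subseteq> overlap (ch k) (ch i)" by (auto simp: P_def overlap_def)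
    have tP: "?t ` P k i = Q k i"
      unfolding P_def Q_def image_image
    proof (rule image_cong[OF refl])
      fix m assume "m \<in> B k \<inter> fst (ch i)"
      then have "m \<in> fst (ch k)" using B_sub by blast
      then show "?t (snd (ch k) m) = snd (ch i) m" by (rule transition_apply[OF ch[OF k]])
    qed
    have "set_integrable lborel (P k i) (G k i) \<and> (LINT x:P k i|lborel. G k i x) = (LINT x:?t ` P k i|lborel. G i i x)"
    proof (rule change_of_variables_lborel[where g' = "dir_deriv ?t" and g = ?t and S = "P k i" and h = "G k i" and f = "G i i"])
      show "P k i \<in> sets borel" "?t ` P k i \<in> sets borel"
        unfolding tP by (rule P_borel[OF k i], rule Q_borel[OF k i])
      show "(?t has_derivative dir_deriv ?t x) (at x)" if "x \<in> P k i" for x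
        using smooth_on_has_derivative[OF smooth_transition[OF ch[OF k] ch[OF i]]] P_overlap that by blast
      show "inj_on ?t (P k i)"
        by (rule inj_on_subset[OF inj_transition[OF ch[OF k] ch[OF i]] P_overlap])
      \<comment> \<open>With \<open>J\<close> the Jacobian,
        \<open>sgn (J * y) * J = \<bar>J\<bar> * sgn y\<close>, so the signed coefficients transform
        as the change of variables formula demands.\<close>
      show "G k i x = \<bar>jacobian (dir_deriv ?t x)\<bar> * G i i (?t x)" if "x \<in> P k i" for x
      proof -
        have x: "x \<in> overlap (ch k) (ch i)" using P_overlap that by blast
        show ?thesis
          unfolding G_def \<Omega>_trans[OF ch[OF k] ch[OF i] x] E_trans[OF ch[OF k] ch[OF i] \<rho>[OF i] x]
          by (simp add: sgn_mult abs_sgn mult_ac)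
      qed
      show "set_borel_measurable borel (P k i) (G k i)"
        unfolding set_borel_measurable_def
        by (rule borel_measurable_continuous_on_indicator[OF P_borel[OF k i]])
          (rule continuous_on_subset[OF G_cont[OF k i] subset_trans[OF P_overlap overlap_subset]])
      show "set_integrable lborel (?t ` P k i) (G i i)"
        unfolding tP by (rule Q_int[OF k i])
    qed
    then show ?thesis by (simp only: tP)
  qed
  have G_zero: "G k i (snd (ch k) m) = 0" if k: "k < N" and i: "i < N" and m: "m \<in> fst (ch k)" "m \<notin> fst (ch i)" for k i m
  proof -
    \<comment> \<open>\<open>\<rho> i\<close> vanishes on the complement of a closed subset of chart
      \<open>i\<close>. A point outside chart \<open>i\<close> has this open set as a neighbourhood,
      so locality of \<open>E\<close> applies.\<close>
    let ?V = "topspace T - {m \<in> fst (ch i). snd (ch i) m \<in> K i}"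
    have "E (ch k) (\<rho> i) (snd (ch k) m) = 0"
    proof (rule E_local[OF ch[OF k], of ?V])
      show "openin T ?V"
        using closed_preimage[OF ch[OF i] K(1)[OF i] K(2)[OF i]] by (simp add: openin_diff)
      show "m \<in> ?V" using m fst_sub[OF k] by auto
      show "\<rho> i m' = 0" if "m' \<in> ?V" for m' using that by (intro \<rho>0[OF i]) auto
    qed (use m in auto)
    then show ?thesis by (simp add: G_def)
  qed
  define D where "D k = snd (ch k) ` B k" for k
  \<comment> \<open>Outside chart \<open>i\<close> the function \<open>G k i\<close> is zero, so its
    integral over the whole piece is that over \<open>P k i\<close>, where coordinates can be
    changed.\<close>
  have D_eq: "indicator (D k) x *\<^sub>R G k i x = indicator (P k i) x *\<^sub>R G k i x" if "k < N" "i < N" for k i x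
  proof (cases "x \<in> D k - P k i")
    case True
    then obtain m where "m \<in> B k" "m \<notin> fst (ch i)" "x = snd (ch k) m" by (auto simp: D_def P_def)
    then show ?thesis using G_zero[OF that, of m] by (simp add: B_def)
  next
    case False
    moreover have "P k i \<subseteq> D k" by (auto simp: P_def D_def)
    ultimately show ?thesis by (auto simp: indicator_def)
  qed
  have sumG: "(\<Sum>i<N. G k i x) = \<kappa> * \<bar>\<Omega> (ch k) x\<bar>" if k: "k < N" and x: "x \<in> D k" for k x
  proof -
    have "x \<in> coord_dom (ch k)" using x by (auto simp: D_def B_def coord_dom_def)
    then have eq: "(\<Sum>i<N. E (ch k) (\<rho> i) x) = \<kappa> * \<Omega> (ch k) x" by (rule E_sum[OF ch[OF k] _ \<rho> \<rho>1])
    have "(\<Sum>i<N. G k i x) = sgn (\<Omega> (ch k) x) * (\<Sum>i<N. E (ch k) (\<rho> i) x)"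
      unfolding G_def by (rule sum_distrib_left[symmetric])
    then show ?thesis
      unfolding eq by (simp add: abs_sgn mult_ac)
  qed
  have D_int: "set_integrable lborel (D k) (\<lambda>x. \<kappa> * \<bar>\<Omega> (ch k) x\<bar>) \<and>
      (LINT x:D k|lborel. \<kappa> * \<bar>\<Omega> (ch k) x\<bar>) = (\<Sum>i<N. LINT x:Q k i|lborel. G i i x)" if k: "k < N" for k
  proof -
    have eq: "indicator (D k) x *\<^sub>R (\<kappa> * \<bar>\<Omega> (ch k) x\<bar>) = (\<Sum>i<N. indicator (P k i) x *\<^sub>R G k i x)" for x
    proof -
      have "(\<Sum>i<N. indicator (P k i) x *\<^sub>R G k i x) = (\<Sum>i<N. indicator (D k) x *\<^sub>R G k i x)"
        by (rule sum.cong[OF refl], rule D_eq[OF k, symmetric]) simp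
      also have "\<dots> = indicator (D k) x *\<^sub>R (\<Sum>i<N. G k i x)" by (rule scaleR_sum_right[symmetric])
      also have "\<dots> = indicator (D k) x *\<^sub>R (\<kappa> * \<bar>\<Omega> (ch k) x\<bar>)"
        by (cases "x \<in> D k") (simp_all add: sumG[OF k])
      finally show ?thesis by (rule sym)
    qed
    have int: "integrable lborel (\<lambda>x. indicator (P k i) x *\<^sub>R G k i x)" if "i < N" for i
      using cov[OF k that] by (simp add: set_integrable_def)
    have "(LINT x:D k|lborel. \<kappa> * \<bar>\<Omega> (ch k) x\<bar>) = (\<Sum>i<N. LINT x:P k i|lborel. G k i x)"
      unfolding set_lebesgue_integral_def eq by (rule Bochner_Integration.integral_sum) (rule int, simp)
    also have "\<dots> = (\<Sum>i<N. LINT x:Q k i|lborel. G i i x)"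
      by (rule sum.cong[OF refl]) (simp add: cov[OF k])
    finally have "(LINT x:D k|lborel. \<kappa> * \<bar>\<Omega> (ch k) x\<bar>) = (\<Sum>i<N. LINT x:Q k i|lborel. G i i x)" .
    moreover have "set_integrable lborel (D k) (\<lambda>x. \<kappa> * \<bar>\<Omega> (ch k) x\<bar>)"
      unfolding set_integrable_def eq by (rule Bochner_Integration.integrable_sum) (rule int, simp)
    ultimately show ?thesis by blast
  qed
  \<comment> \<open>For fixed \<open>i\<close> the sets \<open>Q k i\<close> partition the
    coordinate domain of chart \<open>i\<close>, so the sum is the integral over that domain, which
    is zero.\<close>
  have Q_sum: "(\<Sum>k<N. LINT x:Q k i|lborel. G i i x) = 0" if i: "i < N" for i
  proof -
    have uniq: "\<exists>!k. k < N \<and> x \<in> Q k i" if x: "x \<in> coord_dom (ch i)" for x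
    proof -
      obtain m where m: "m \<in> fst (ch i)" "x = snd (ch i) m" using x by (auto simp: coord_dom_def)
      have Q_iff: "x \<in> Q k i \<longleftrightarrow> m \<in> B k" for k
        unfolding Q_def m(2)
        using inj_on_image_mem_iff[OF inj_chart[OF ch[OF i]] m(1), of "B k \<inter> fst (ch i)"] m(1) by simp
      have ex: "\<exists>k. k < N \<and> m \<in> fst (ch k)" using m i by blast
      from ex obtain l where l: "l < N" "m \<in> fst (ch l)" and least: "\<forall>j<l. \<not> (j < N \<and> m \<in> fst (ch j))"
        using exists_least_iff[of "\<lambda>k. k < N \<and> m \<in> fst (ch k)"] by blast
      have min: "m \<notin> fst (ch j)" if "j < l" for j
        using least that less_trans[OF that l(1)] by blast
      show ?thesis
        unfolding Q_iff
      proof (rule ex1I[of _ l])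
        show "l < N \<and> m \<in> B l" using l min by (auto simp: B_def)
        fix k assume "k < N \<and> m \<in> B k"
        then have "m \<in> fst (ch k)" "\<And>j. j < k \<Longrightarrow> m \<notin> fst (ch j)" by (auto simp: B_def)
        then have "\<not> k < l" "\<not> l < k" using min l(2) by blast+
        then show "k = l" by simp
      qed
    qed
    have ind: "(\<Sum>k<N. indicator (Q k i) x) = (indicator (coord_dom (ch i)) x :: real)" for x
    proof (cases "x \<in> coord_dom (ch i)")
      case True
      obtain k where k: "k < N" "x \<in> Q k i" "\<And>k'. k' < N \<Longrightarrow> x \<in> Q k' i \<Longrightarrow> k' = k" using uniq[OF True] by blast
      have "(\<Sum>k'<N. indicator (Q k' i) x) = (\<Sum>k'<N. if k' = k then 1 else 0 :: real)"
      proof (rule sum.cong[OF refl])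
        fix k' assume "k' \<in> {..<N}"
        then have "x \<in> Q k' i \<longleftrightarrow> k' = k" using k by blast
        then show "indicator (Q k' i) x = (if k' = k then 1 else 0 :: real)"
          using k(2) by (cases "k' = k") simp_all
      qed
      then show ?thesis using k(1) True by simp
    next
      case False
      then have "x \<notin> Q k i" for k by (auto simp: Q_def coord_dom_def)
      then show ?thesis using False by simp
    qed
    have int: "integrable lborel (\<lambda>x. indicator (Q k i) x *\<^sub>R G i i x)" if "k < N" for k
      using Q_int[OF that i] by (simp only: set_integrable_def)
    have "(\<Sum>k<N. LINT x:Q k i|lborel. G i i x) = (LINT x|lborel. (\<Sum>k<N. indicator (Q k i) x *\<^sub>R G i i x))"
      unfolding set_lebesgue_integral_def
      by (rule Bochner_Integration.integral_sum[symmetric]) (rule int, simp)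
    also have "\<dots> = (LINT x:coord_dom (ch i)|lborel. G i i x)"
      unfolding set_lebesgue_integral_def ind[symmetric] scaleR_sum_left ..
    finally show ?thesis using G_int(2)[OF i] by simp
  qed
  have "(LINT x:D k|lborel. \<kappa> * \<bar>\<Omega> (ch k) x\<bar>) = \<kappa> * (LINT x:D k|lborel. \<bar>\<Omega> (ch k) x\<bar>)" for k
    unfolding set_lebesgue_integral_def by (simp add: mult.left_commute[of _ \<kappa>])
  \<comment> \<open>The double sum over pieces and cut-off functions is evaluated in two orders:
    summing over \<open>i\<close> first gives \<kappa> times the volume of each piece, summing over
    \<open>k\<close> first gives zero.\<close>
  then have "\<kappa> * (\<Sum>k<N. LINT x:D k|lborel. \<bar>\<Omega> (ch k) x\<bar>) = (\<Sum>k<N. LINT x:D k|lborel. \<kappa> * \<bar>\<Omega> (ch k) x\<bar>)"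
    by (simp only: sum_distrib_left)
  also have "\<dots> = (\<Sum>k<N. \<Sum>i<N. LINT x:Q k i|lborel. G i i x)"
    by (rule sum.cong[OF refl]) (simp only: D_int lessThan_iff)
  also have "\<dots> = (\<Sum>i<N. \<Sum>k<N. LINT x:Q k i|lborel. G i i x)" by (rule sum.swap)
  also have "\<dots> = 0" by (rule sum.neutral) (simp add: Q_sum)
  finally have total: "(\<Sum>k<N. LINT x:D k|lborel. \<bar>\<Omega> (ch k) x\<bar>) = 0"
    using \<kappa> by simp
  have nonneg: "(LINT x:D k|lborel. \<bar>\<Omega> (ch k) x\<bar>) \<ge> 0" for k
    unfolding set_lebesgue_integral_def by (intro integral_nonneg_AE) auto
  have zero: "(LINT x:D 0|lborel. \<bar>\<Omega> (ch 0) x\<bar>) = 0"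
    using sum_nonneg_0[OF finite_lessThan nonneg total, of 0] N by simp
  \<comment> \<open>No chart precedes number 0, so \<open>D 0\<close> is a full coordinate domain:
    open and non-empty, hence not a null set.\<close>
  have D0: "D 0 = coord_dom (ch 0)" by (simp add: D_def B_def coord_dom_def)
  have "set_integrable lborel (D 0) (\<lambda>x. (1 / \<kappa>) * (\<kappa> * \<bar>\<Omega> (ch 0) x\<bar>))"
    by (rule set_integrable_mult_right) (rule D_int[OF N, THEN conjunct1])
  then have int0: "integrable lborel (\<lambda>x. indicator (D 0) x *\<^sub>R \<bar>\<Omega> (ch 0) x\<bar>)"
    using \<kappa> unfolding set_integrable_def by simp
  have "AE x in lborel. 0 \<le> indicator (D 0) x *\<^sub>R \<bar>\<Omega> (ch 0) x\<bar>" by (rule AE_I2) simp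
  from integral_nonneg_eq_0_iff_AE[OF int0 this] zero
  have "AE x in lborel. indicator (D 0) x *\<^sub>R \<bar>\<Omega> (ch 0) x\<bar> = 0"
    unfolding set_lebesgue_integral_def by (rule iffD1)
  then have "AE x in lborel. x \<notin> D 0"
  proof (rule eventually_mono)
    fix x assume "indicator (D 0) x *\<^sub>R \<bar>\<Omega> (ch 0) x\<bar> = 0"
    then show "x \<notin> D 0" using \<Omega>_nz[OF ch[OF N], of x] D0 by auto
  qed
  moreover have D0_open: "open (D 0)"
    using open_coord_dom[OF ch[OF N]] D0 by simp
  ultimately have "D 0 \<in> null_sets lborel"
    using AE_iff_null_sets[of "D 0" lborel] by simp
  then have "negligible (D 0)"
    by (simp add: negligible_iff_null_sets null_sets_completionI)
  moreover have "D 0 \<noteq> {}" using ch_ne[OF N] D0 by (simp add: coord_dom_def)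
  ultimately show False using open_not_negligible D0_open by blast
qed

end

section \<open>Exterior derivatives of 1-forms\<close>

text \<open>The exterior derivative of the 1-form \<open>l\<close>, as a bilinear form in two
  vectors.\<close>

definition curl :: "('e::euclidean_space \<Rightarrow> 'e \<Rightarrow> real) \<Rightarrow> 'e \<Rightarrow> 'e \<Rightarrow> 'e \<Rightarrow> real" where
  "curl l x u v = dir_deriv (\<lambda>y. l y v) x u - dir_deriv (\<lambda>y. l y u) x v"

lemma curl_skew: "curl l x u v = - curl l x v u"
  by (simp add: curl_def)

lemma C1_on_inner: "C1_on S f \<Longrightarrow> C1_on S (\<lambda>x. f x \<bullet> b)"
  by (rule C1_onI[where f' = "\<lambda>x v. dir_deriv f x v \<bullet> b"])
    (auto intro: has_derivative_inner_left C1_on_has_derivative continuous_on_inner C1_on_continuous_deriv continuous_on_const)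

text \<open>Taken componentwise. The vector-valued case is used for transition maps in
  \<open>curl_pullback\<close>.\<close>

lemma symmetric_second_derivative_vector:
  fixes f :: "'e::euclidean_space \<Rightarrow> 'f::euclidean_space"
  assumes S: "open S" "x \<in> S" and f: "smooth_on S f"
  shows "dir_deriv (\<lambda>y. dir_deriv f y u) x v = dir_deriv (\<lambda>y. dir_deriv f y v) x u"
proof (rule euclidean_eqI)
  fix b :: 'f assume "b \<in> Basis"
  let ?g = "\<lambda>y. f y \<bullet> b"
  have f1: "C1_on S f" and f2: "C1_on S (\<lambda>y. dir_deriv f y w)" for w
    using f smooth_on_dir_deriv smooth_on_imp_C1_on by blast+
  have g: "dir_deriv ?g y w = dir_deriv f y w \<bullet> b" if "y \<in> S" for y w
    using dir_deriv_eq[OF has_derivative_inner_left[OF C1_on_has_derivative[OF f1 that]]] by simp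
  have g2: "C1_on S (\<lambda>y. dir_deriv ?g y w)" for w
    by (rule C1_on_cong[OF S(1) _ C1_on_inner[OF f2, of w b]]) (simp add: g)
  have gg: "dir_deriv (\<lambda>y. dir_deriv ?g y w) x z = dir_deriv (\<lambda>y. dir_deriv f y w) x z \<bullet> b" for w z
  proof -
    have "dir_deriv (\<lambda>y. dir_deriv ?g y w) x = dir_deriv (\<lambda>y. dir_deriv f y w \<bullet> b) x"
      by (rule dir_deriv_cong_open[OF S]) (rule g)
    also have "\<dots> = (\<lambda>z. dir_deriv (\<lambda>y. dir_deriv f y w) x z \<bullet> b)"
      by (rule dir_deriv_eq[OF has_derivative_inner_left[OF C1_on_has_derivative[OF f2 S(2)]]])
    finally show ?thesis by simp
  qed
  show "dir_deriv (\<lambda>y. dir_deriv f y u) x v \<bullet> b = dir_deriv (\<lambda>y. dir_deriv f y v) x u \<bullet> b"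
    using symmetric_second_derivative[OF S C1_on_inner[OF f1] g2, of v u] by (simp only: gg)
qed

lemma linear_expand_basis:
  fixes f :: "'e::euclidean_space \<Rightarrow> real"
  assumes "linear f"
  shows "f v = (\<Sum>b\<in>Basis. (v \<bullet> b) * f b)"
proof -
  have "f v = f (\<Sum>b\<in>Basis. (v \<bullet> b) *\<^sub>R b)" by (simp add: euclidean_representation)
  then show ?thesis by (simp add: linear_sum[OF assms] linear_scale[OF assms])
qed

locale one_form_on =
  fixes S :: "'e::euclidean_space set" and l :: "'e \<Rightarrow> 'e \<Rightarrow> real"
  assumes open_S: "open S"
    and linear_form: "\<And>x. x \<in> S \<Longrightarrow> linear (l x)"
    and smooth_form: "\<And>v. smooth_on S (\<lambda>x. l x v)"
begin

lemma linear_deriv_arg: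
  assumes "x \<in> S"
  shows "linear (\<lambda>v. dir_deriv (\<lambda>y. l y v) x u)"
proof (rule linearI)
  fix v w
  have "dir_deriv (\<lambda>y. l y (v + w)) x = dir_deriv (\<lambda>y. l y v + l y w) x"
    by (rule dir_deriv_cong_open[OF open_S assms]) (simp add: linear_add[OF linear_form])
  also have "\<dots> = (\<lambda>u. dir_deriv (\<lambda>y. l y v) x u + dir_deriv (\<lambda>y. l y w) x u)"
    by (rule dir_deriv_eq[OF has_derivative_add]) (rule smooth_on_has_derivative[OF smooth_form assms])+
  finally show "dir_deriv (\<lambda>y. l y (v + w)) x u = dir_deriv (\<lambda>y. l y v) x u + dir_deriv (\<lambda>y. l y w) x u"
    by simp
next
  fix r v
  have "dir_deriv (\<lambda>y. l y (r *\<^sub>R v)) x = dir_deriv (\<lambda>y. r * l y v) x"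
    by (rule dir_deriv_cong_open[OF open_S assms]) (simp add: linear_scale[OF linear_form])
  also have "\<dots> = (\<lambda>u. r * dir_deriv (\<lambda>y. l y v) x u)"
    by (rule dir_deriv_eq[OF has_derivative_mult_right]) (rule smooth_on_has_derivative[OF smooth_form assms])
  finally show "dir_deriv (\<lambda>y. l y (r *\<^sub>R v)) x u = r *\<^sub>R dir_deriv (\<lambda>y. l y v) x u"
    by simp
qed

lemma linear_deriv_dir: "x \<in> S \<Longrightarrow> linear (\<lambda>u. dir_deriv (\<lambda>y. l y v) x u)"
  using linear_dir_deriv[OF smooth_on_differentiable[OF smooth_form]] .

lemma linear_curl:
  assumes "x \<in> S"
  shows "linear (\<lambda>u. curl l x u v)" "linear (\<lambda>v. curl l x u v)"
  unfolding curl_def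
  by (intro linear_compose_sub linear_deriv_arg linear_deriv_dir assms)+

lemma smooth_on_curl: "smooth_on S (\<lambda>x. curl l x u v)"
  unfolding curl_def by (intro smooth_on_diff open_S smooth_on_dir_deriv smooth_form)

text \<open>The identity d d = 0: the six second derivatives cancel in pairs by symmetry.\<close>

lemma curl_closed:
  assumes "x \<in> S"
  shows "dir_deriv (\<lambda>y. curl l y v w) x u + dir_deriv (\<lambda>y. curl l y w u) x v + dir_deriv (\<lambda>y. curl l y u v) x w = 0"
proof -
  have sm: "smooth_on S (\<lambda>y. dir_deriv (\<lambda>y. l y v) y u)" for u v
    by (rule smooth_on_dir_deriv[OF smooth_form])
  have "dir_deriv (\<lambda>y. curl l y v w) x u
      = dir_deriv (\<lambda>y. dir_deriv (\<lambda>y. l y w) y v) x u - dir_deriv (\<lambda>y. dir_deriv (\<lambda>y. l y v) y w) x u" for u v w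
    unfolding curl_def
    using dir_deriv_eq[OF has_derivative_diff[OF smooth_on_has_derivative[OF sm assms] smooth_on_has_derivative[OF sm assms]], of w v v w]
    by simp
  moreover have "dir_deriv (\<lambda>y. dir_deriv (\<lambda>y. l y w) y v) x u = dir_deriv (\<lambda>y. dir_deriv (\<lambda>y. l y w) y u) x v" for u v w
    by (rule symmetric_second_derivative_vector[OF open_S assms smooth_form])
  ultimately show ?thesis by simp
qed

end

text \<open>The chain rule produces second derivatives of \<open>t\<close>, which are symmetric in
  \<open>u\<close> and \<open>v\<close> and cancel in the difference.\<close>

lemma curl_pullback:
  fixes t :: "'d::euclidean_space \<Rightarrow> 'e::euclidean_space"
  assumes "one_form_on S l" "one_form_on U l'" and t: "smooth_on O' t" and O: "open O'" "O' \<subseteq> S" "t ` O' \<subseteq> U"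
    and pull: "\<And>y v. y \<in> O' \<Longrightarrow> l y v = l' (t y) (dir_deriv t y v)" and x: "x \<in> O'"
  shows "curl l x u v = curl l' (t x) (dir_deriv t x u) (dir_deriv t x v)"
proof -
  interpret l: one_form_on S l by fact
  interpret l': one_form_on U l' by fact
  have tU: "t y \<in> U" if "y \<in> O'" for y using O that by blast
  have D: "dir_deriv (\<lambda>y. l y v) x u = dir_deriv (\<lambda>z. l' z (dir_deriv t x v)) (t x) (dir_deriv t x u)
      + l' (t x) (dir_deriv (\<lambda>y. dir_deriv t y v) x u)" for u v
  proof -
    \<comment> \<open>Both the point \<open>t y\<close> and the vector fed to \<open>l'\<close> move
      with \<open>y\<close>. Expanding the vector in the basis separates them for the product
      rule.\<close>
    have "dir_deriv (\<lambda>y. l y v) x = dir_deriv (\<lambda>y. \<Sum>b\<in>Basis. (dir_deriv t y v \<bullet> b) * l' (t y) b) x"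
      by (rule dir_deriv_cong_open[OF O(1) x])
        (simp add: pull linear_expand_basis[OF l'.linear_form[OF tU], symmetric])
    also have "\<dots> = (\<lambda>u. \<Sum>b\<in>Basis. (dir_deriv t x v \<bullet> b) * dir_deriv (\<lambda>z. l' z b) (t x) (dir_deriv t x u)
        + (dir_deriv (\<lambda>y. dir_deriv t y v) x u \<bullet> b) * l' (t x) b)"
    proof (rule dir_deriv_eq, rule has_derivative_sum, rule has_derivative_mult)
      fix b :: 'e
      show "((\<lambda>y. dir_deriv t y v \<bullet> b) has_derivative (\<lambda>u. dir_deriv (\<lambda>y. dir_deriv t y v) x u \<bullet> b)) (at x)"
        by (rule has_derivative_inner_left[OF smooth_on_has_derivative[OF smooth_on_dir_deriv[OF t] x]])
      show "((\<lambda>y. l' (t y) b) has_derivative (\<lambda>u. dir_deriv (\<lambda>z. l' z b) (t x) (dir_deriv t x u))) (at x)"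
        by (rule has_derivative_compose[OF smooth_on_has_derivative[OF t x]
              smooth_on_has_derivative[OF l'.smooth_form tU[OF x]]])
    qed
    finally have "dir_deriv (\<lambda>y. l y v) x u
        = (\<Sum>b\<in>Basis. (dir_deriv t x v \<bullet> b) * dir_deriv (\<lambda>z. l' z b) (t x) (dir_deriv t x u))
        + (\<Sum>b\<in>Basis. (dir_deriv (\<lambda>y. dir_deriv t y v) x u \<bullet> b) * l' (t x) b)"
      by (simp add: sum.distrib)
    then show ?thesis
      unfolding linear_expand_basis[OF l'.linear_deriv_arg[OF tU[OF x]], symmetric]
        linear_expand_basis[OF l'.linear_form[OF tU[OF x]], symmetric] .
  qed
  show ?thesis
    unfolding curl_def D symmetric_second_derivative_vector[OF O(1) x t, of u v] by simp
qed

text \<open>The sign is locally constant away from zeros. It can therefore be moved under a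
  derivative although a coordinate domain need not be connected.\<close>

lemma has_derivative_sgn:
  fixes f :: "'e::euclidean_space \<Rightarrow> real"
  assumes S: "open S" "x \<in> S" and f: "continuous_on S f" "f x \<noteq> 0"
  shows "((\<lambda>y. sgn (f y)) has_derivative (\<lambda>_. 0)) (at x)"
proof -
  let ?V = "S \<inter> f -` {z. sgn z = sgn (f x)}"
  have "{z. sgn z = sgn (f x)} = (if f x > 0 then {0<..} else {..<0})"
    using f(2) by (auto simp: sgn_if split: if_splits)
  then have "open {z. sgn z = sgn (f x)}" by simp
  then have V: "open ?V" by (rule continuous_open_preimage[OF f(1) S(1)])
  have xV: "x \<in> ?V" using S by simp
  show ?thesis
    by (rule has_derivative_transform_within_open[OF has_derivative_const[where c = "sgn (f x)"] V xV]) auto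
qed

text \<open>The form \<open>l\<close> is \<lambda> and \<open>b\<close> is the closed form \<beta> =
  \<lambda> - \<alpha>; the number \<open>m\<close> is \<open>n - 1\<close>, which makes the
  dimension \<open>2 * m + 3\<close>. The assumptions turn out to be contradictory.\<close>

locale closed_contact_pair = closed_atlas T A
  for T :: "'a topology" and A :: "('a, 'e::euclidean_space) chart set" +
  fixes m :: nat and l b :: "('a, 'e) chart \<Rightarrow> 'e \<Rightarrow> 'e \<Rightarrow> real"
  assumes dim: "DIM('e) = 2 * m + 3"
    and l_form: "\<And>c. c \<in> A \<Longrightarrow> one_form_on (coord_dom c) (l c)"
    and b_form: "\<And>c. c \<in> A \<Longrightarrow> one_form_on (coord_dom c) (b c)"
    and l_trans: "\<And>c c' x v. c \<in> A \<Longrightarrow> c' \<in> A \<Longrightarrow> x \<in> overlap c c' \<Longrightarrow>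
      l c x v = l c' (transition c c' x) (dir_deriv (transition c c') x v)"
    and b_trans: "\<And>c c' x v. c \<in> A \<Longrightarrow> c' \<in> A \<Longrightarrow> x \<in> overlap c c' \<Longrightarrow>
      b c x v = b c' (transition c c' x) (dir_deriv (transition c c') x v)"
    and b_closed: "\<And>c x u v. c \<in> A \<Longrightarrow> x \<in> coord_dom c \<Longrightarrow> curl (b c) x u v = 0"
    and volume_nz: "\<And>c x. c \<in> A \<Longrightarrow> x \<in> coord_dom c \<Longrightarrow>
      contact_volume (Suc m) (b c x) (curl (l c) x) basis_enum \<noteq> 0"
begin

definition volume :: "('a, 'e) chart \<Rightarrow> 'e \<Rightarrow> real" where
  "volume c x = contact_volume (Suc m) (b c x) (curl (l c) x) basis_enum"

text \<open>\<open>flux c f\<close> is \<open>d(f b \<and> l \<and> (dl)\<^sup>m)\<close> in the chart \<open>c\<close>; its second term comes from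
  \<open>divergence_identity\<close>.\<close>

definition flux :: "('a, 'e) chart \<Rightarrow> ('a \<Rightarrow> real) \<Rightarrow> 'e \<Rightarrow> real" where
  "flux c f x = flux_form m (dir_deriv (in_chart c f) x) (b c x) (l c x) (curl (l c) x) basis_enum
     - in_chart c f x * volume c x / 2"

section \<open>Transformation, continuity and integration of the volume and the flux\<close>

lemma curl_trans:
  assumes "c \<in> A" "c' \<in> A" "x \<in> overlap c c'"
  shows "curl (l c) x = (\<lambda>u v. curl (l c') (transition c c' x) (dir_deriv (transition c c') x u) (dir_deriv (transition c c') x v))"
  using curl_pullback[OF l_form[OF assms(1)] l_form[OF assms(2)] smooth_transition[OF assms(1,2)] open_overlap[OF assms(1,2)]
      overlap_subset _ l_trans[OF assms(1,2)] assms(3)] transition_in_coord_dom[OF assms(1)] by blast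

lemma linear_transition:
  assumes "c \<in> A" "c' \<in> A" "x \<in> overlap c c'"
  shows "linear (dir_deriv (transition c c') x)"
  by (rule linear_dir_deriv[OF smooth_on_differentiable[OF smooth_transition[OF assms(1,2)] assms(3)]])

lemma continuous_on_l: "c \<in> A \<Longrightarrow> continuous_on (coord_dom c) (\<lambda>x. l c x v)"
  and continuous_on_b: "c \<in> A \<Longrightarrow> continuous_on (coord_dom c) (\<lambda>x. b c x v)"
  and continuous_on_curl: "c \<in> A \<Longrightarrow> continuous_on (coord_dom c) (\<lambda>x. curl (l c) x u v)"
  using smooth_on_continuous one_form_on.smooth_form one_form_on.smooth_on_curl l_form b_form by blast+

lemma continuous_on_volume: "c \<in> A \<Longrightarrow> continuous_on (coord_dom c) (volume c)"
  unfolding volume_def[abs_def] contact_volume_def alternate_def pairing_product_def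
  by (intro continuous_on_sum continuous_on_mult continuous_on_prod continuous_on_const
      continuous_on_b continuous_on_curl)

lemma volume_trans:
  assumes "c \<in> A" "c' \<in> A" "x \<in> overlap c c'"
  shows "volume c x = jacobian (dir_deriv (transition c c') x) * volume c' (transition c c' x)"
proof -
  let ?L = "dir_deriv (transition c c') x" and ?y = "transition c c' x"
  have y: "?y \<in> coord_dom c'" by (rule transition_in_coord_dom[OF assms(1,3)])
  have "b c x = (\<lambda>v. b c' ?y (?L v))" using b_trans[OF assms] by blast
  then have "volume c x = contact_volume (Suc m) (b c' ?y) (curl (l c') ?y) (\<lambda>i. ?L (basis_enum i))"
    unfolding volume_def curl_trans[OF assms] by (simp only: contact_volume_pullback)
  also have "\<dots> = jacobian ?L * volume c' ?y"
    unfolding volume_def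
  proof (rule alternating_form_jacobian[OF _ linear_transition[OF assms]])
    have "alternating_form (2 * Suc m + 1) (contact_volume (Suc m) (b c' ?y) (curl (l c') ?y))"
      by (intro alternating_form_contact_volume one_form_on.linear_form[OF b_form[OF assms(2)] y]
          one_form_on.linear_curl[OF l_form[OF assms(2)] y])
    then show "alternating_form DIM('e) (contact_volume (Suc m) (b c' ?y) (curl (l c') ?y))"
      by (simp add: dim numeral_eq_Suc)
  qed
  finally show ?thesis .
qed

lemma in_chart_has_derivative:
  "C1_function A f \<Longrightarrow> c \<in> A \<Longrightarrow> x \<in> coord_dom c \<Longrightarrow>
    (in_chart c f has_derivative dir_deriv (in_chart c f) x) (at x)"
  unfolding C1_function_def using C1_on_has_derivative by blast

lemma in_chart_deriv_trans:
  assumes "c \<in> A" "c' \<in> A" "C1_function A f" "x \<in> overlap c c'"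
  shows "dir_deriv (in_chart c f) x = (\<lambda>v. dir_deriv (in_chart c' f) (transition c c' x) (dir_deriv (transition c c') x v))"
proof -
  have "dir_deriv (in_chart c f) x = dir_deriv (\<lambda>y. in_chart c' f (transition c c' y)) x"
    by (rule dir_deriv_cong_open[OF open_overlap[OF assms(1,2)] assms(4)])
      (rule in_chart_transition[OF assms(1,2)])
  also have "\<dots> = (\<lambda>v. dir_deriv (in_chart c' f) (transition c c' x) (dir_deriv (transition c c') x v))"
    by (rule dir_deriv_eq[OF has_derivative_compose[OF
          smooth_on_has_derivative[OF smooth_transition[OF assms(1,2)] assms(4)]
          in_chart_has_derivative[OF assms(3,2) transition_in_coord_dom[OF assms(1,4)]]]])
  finally show ?thesis .
qed

lemma flux_trans:
  assumes "c \<in> A" "c' \<in> A" "C1_function A f" "x \<in> overlap c c'"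
  shows "flux c f x = jacobian (dir_deriv (transition c c') x) * flux c' f (transition c c' x)"
proof -
  let ?L = "dir_deriv (transition c c') x" and ?y = "transition c c' x"
  have y: "?y \<in> coord_dom c'" by (rule transition_in_coord_dom[OF assms(1,4)])
  have b: "b c x = (\<lambda>v. b c' ?y (?L v))" and l: "l c x = (\<lambda>v. l c' ?y (?L v))"
    using b_trans[OF assms(1,2,4)] l_trans[OF assms(1,2,4)] by blast+
  let ?F = "flux_form m (dir_deriv (in_chart c' f) ?y) (b c' ?y) (l c' ?y) (curl (l c') ?y)"
  have "flux_form m (dir_deriv (in_chart c f) x) (b c x) (l c x) (curl (l c) x) basis_enum = ?F (\<lambda>i. ?L (basis_enum i))"
    unfolding b l curl_trans[OF assms(1,2,4)] in_chart_deriv_trans[OF assms] by (rule flux_form_pullback)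
  also have "\<dots> = jacobian ?L * ?F basis_enum"
  proof (rule alternating_form_jacobian[OF _ linear_transition[OF assms(1,2,4)]])
    show "alternating_form DIM('e) ?F"
      unfolding dim
      by (intro alternating_form_flux_form has_derivative_linear[OF in_chart_has_derivative[OF assms(3,2) y]]
          one_form_on.linear_form[OF b_form[OF assms(2)] y] one_form_on.linear_form[OF l_form[OF assms(2)] y]
          one_form_on.linear_curl[OF l_form[OF assms(2)] y])
  qed
  finally show ?thesis
    unfolding flux_def volume_trans[OF assms(1,2,4)] in_chart_transition[OF assms(1,2,4)]
    by (simp add: algebra_simps)
qed

lemma continuous_on_flux:
  assumes "c \<in> A" "C1_function A f"
  shows "continuous_on (coord_dom c) (flux c f)"
proof -
  have f: "C1_on (coord_dom c) (in_chart c f)" using assms by (simp add: C1_function_def)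
  show ?thesis
    unfolding flux_def[abs_def] flux_form_def alternate_def pairing_product_def
    by (intro continuous_on_diff continuous_on_divide continuous_on_sum continuous_on_mult continuous_on_prod
        continuous_on_const continuous_on_b continuous_on_l continuous_on_curl continuous_on_volume assms(1)
        C1_on_continuous_deriv[OF f] C1_on_continuous[OF f]) simp
qed

lemma flux_form_0: "flux_form m (\<lambda>_. 0) b' l' w v = 0"
  by (simp add: flux_form_def alternate_def)

lemma flux_local:
  assumes c: "c \<in> A" and V: "openin T V" "p \<in> V" "p \<in> fst c" "\<And>q. q \<in> V \<Longrightarrow> f q = 0"
  shows "flux c f (snd c p) = 0"
proof -
  have op: "open (snd c ` (V \<inter> fst c))"
    by (rule open_image[OF c]) (use V open_fst[OF c] in auto)
  have zero: "in_chart c f x = 0" if "x \<in> snd c ` (V \<inter> fst c)" for x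
    using that V by (auto simp: in_chart_apply[OF c])
  have p: "snd c p \<in> snd c ` (V \<inter> fst c)" using V by blast
  have "dir_deriv (in_chart c f) (snd c p) = dir_deriv (\<lambda>_. 0) (snd c p)"
    by (rule dir_deriv_cong_open[OF op p zero])
  moreover note zero[OF p]
  moreover have "dir_deriv (\<lambda>_::'e. 0::real) (snd c p) = (\<lambda>_. 0)" by (rule dir_deriv_eq) simp
  ultimately show ?thesis by (simp add: flux_def flux_form_0)
qed

lemma flux_form_sum:
  "flux_form m (\<lambda>v. \<Sum>i\<in>I. X i v) b' l' w e = (\<Sum>i\<in>I. flux_form m (X i) b' l' w e)"
  unfolding flux_form_def alternate_def sum_distrib_right sum_distrib_left by (rule sum.swap)

text \<open>The functions add up to 1, so their differentials cancel and only the second term of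
  \<open>flux\<close> survives, with its factor \<open>- 1 / 2\<close>.\<close>

lemma flux_sum:
  fixes \<rho> :: "nat \<Rightarrow> 'a \<Rightarrow> real"
  assumes c: "c \<in> A" and x: "x \<in> coord_dom c" and \<rho>: "\<And>i. i < N \<Longrightarrow> C1_function A (\<rho> i)"
    and one: "\<And>p. p \<in> topspace T \<Longrightarrow> (\<Sum>i<N. \<rho> i p) = 1"
  shows "(\<Sum>i<N. flux c (\<rho> i) x) = (- 1 / 2) * volume c x"
proof -
  have one': "(\<Sum>i<N. in_chart c (\<rho> i) y) = 1" if y: "y \<in> coord_dom c" for y
  proof -
    obtain p where "p \<in> fst c" "y = snd c p" using y by (auto simp: coord_dom_def)
    then show ?thesis using one[of p] openin_subset[OF open_fst[OF c]] by (auto simp: in_chart_apply[OF c])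
  qed
  have "(\<lambda>v. \<Sum>i<N. dir_deriv (in_chart c (\<rho> i)) x v) = dir_deriv (\<lambda>y. \<Sum>i<N. in_chart c (\<rho> i) y) x"
    by (rule dir_deriv_eq[symmetric], rule has_derivative_sum, rule in_chart_has_derivative[OF \<rho> c x]) simp
  also have "\<dots> = dir_deriv (\<lambda>_. 1) x"
    by (rule dir_deriv_cong_open[OF open_coord_dom[OF c] x one'])
  also have "\<dots> = (\<lambda>_. 0)" by (rule dir_deriv_eq) simp
  finally have "(\<Sum>i<N. flux_form m (dir_deriv (in_chart c (\<rho> i)) x) (b c x) (l c x) (curl (l c) x) basis_enum) = 0"
    unfolding flux_form_sum[symmetric] by (simp add: flux_form_0)
  moreover have "(\<Sum>i<N. in_chart c (\<rho> i) x * volume c x / 2) = (\<Sum>i<N. in_chart c (\<rho> i) x) * volume c x / 2"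
    by (simp add: sum_distrib_right sum_divide_distrib)
  ultimately show ?thesis
    unfolding flux_def sum_subtractf by (simp add: one'[OF x])
qed

text \<open>In coordinates the flux is a divergence: a signed sum of derivatives of compactly
  supported functions in basis directions, each of which integrates to zero.\<close>

lemma flux_integral:
  assumes c: "c \<in> A" and f: "C1_function A f" and K: "compact K" "K \<subseteq> coord_dom c"
    and supp: "\<And>x. x \<in> coord_dom c - K \<Longrightarrow> in_chart c f x = 0"
  shows "set_integrable lborel (coord_dom c) (\<lambda>x. sgn (volume c x) * flux c f x) \<and>
    (LINT x:coord_dom c|lborel. sgn (volume c x) * flux c f x) = 0"
proof -
  interpret l: one_form_on "coord_dom c" "l c" by (rule l_form[OF c])
  interpret b: one_form_on "coord_dom c" "b c" by (rule b_form[OF c])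
  let ?S = "coord_dom c" and ?P = "{\<sigma>. \<sigma> permutes {..<2 * m + 3}}"
  let ?s = "\<lambda>x. sgn (volume c x)" and ?r = "in_chart c f"
  let ?e = "\<lambda>\<sigma> i. basis_enum (\<sigma> i) :: 'e" and ?w = "curl (l c)"
  \<comment> \<open>Slot 0 is kept free for the direction of differentiation; \<open>b\<close> and
    \<open>l\<close> take the slots 1 and 2, and the pairings start at slot 3.\<close>
  define H where "H \<sigma> x = b c x (?e \<sigma> 1) * (l c x (?e \<sigma> 2) * pairing_product (?w x) {..<m} 3 (?e \<sigma>))" for \<sigma> x
  define H' where "H' \<sigma> x u =
      dir_deriv (\<lambda>y. b c y (?e \<sigma> 1)) x u * (l c x (?e \<sigma> 2) * pairing_product (?w x) {..<m} 3 (?e \<sigma>))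
      + b c x (?e \<sigma> 1) * (dir_deriv (\<lambda>y. l c y (?e \<sigma> 2)) x u * pairing_product (?w x) {..<m} 3 (?e \<sigma>))
      + b c x (?e \<sigma> 1) * (l c x (?e \<sigma> 2) * (\<Sum>j<m. dir_deriv (\<lambda>y. ?w y (?e \<sigma> (2 * j + 3)) (?e \<sigma> (2 * j + 3 + 1))) x u
            * pairing_product (?w x) ({..<m} - {j}) 3 (?e \<sigma>)))" for \<sigma> x u
  have H_C1: "C1_on ?S (H \<sigma>)" for \<sigma>
    unfolding H_def[abs_def] pairing_product_def
    by (intro C1_on_mult C1_on_prod smooth_on_imp_C1_on l.smooth_form b.smooth_form l.smooth_on_curl)
  have H_deriv: "(H \<sigma> has_derivative H' \<sigma> x) (at x)" if x: "x \<in> ?S" for \<sigma> x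
  proof -
    note db = smooth_on_has_derivative[OF b.smooth_form x]
    note dl = smooth_on_has_derivative[OF l.smooth_form x]
    note dw = smooth_on_has_derivative[OF l.smooth_on_curl x]
    have dp: "((\<lambda>y. pairing_product (?w y) {..<m} 3 (?e \<sigma>)) has_derivative
       (\<lambda>u. \<Sum>j<m. dir_deriv (\<lambda>y. ?w y (?e \<sigma> (2 * j + 3)) (?e \<sigma> (2 * j + 3 + 1))) x u
            * pairing_product (?w x) ({..<m} - {j}) 3 (?e \<sigma>))) (at x)"
      unfolding pairing_product_def by (rule has_derivative_prod) (rule dw)
    have eq: "H' \<sigma> x = (\<lambda>u. b c x (?e \<sigma> 1) * (l c x (?e \<sigma> 2) * (\<Sum>j<m. dir_deriv (\<lambda>y. ?w y (?e \<sigma> (2 * j + 3)) (?e \<sigma> (2 * j + 3 + 1))) x u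
            * pairing_product (?w x) ({..<m} - {j}) 3 (?e \<sigma>))
          + dir_deriv (\<lambda>y. l c y (?e \<sigma> 2)) x u * pairing_product (?w x) {..<m} 3 (?e \<sigma>))
        + dir_deriv (\<lambda>y. b c y (?e \<sigma> 1)) x u * (l c x (?e \<sigma> 2) * pairing_product (?w x) {..<m} 3 (?e \<sigma>)))"
      unfolding H'_def by (simp only: distrib_left add_ac)
    show ?thesis
      unfolding eq unfolding H_def[abs_def]
      by (rule has_derivative_mult[OF db has_derivative_mult[OF dl dp]])
  qed
  have s_deriv: "(?s has_derivative (\<lambda>_. 0)) (at x)" if "x \<in> ?S" for x
    using has_derivative_sgn[OF open_coord_dom[OF c] that continuous_on_volume[OF c]] volume_nz[OF c that]
    by (simp add: volume_def)
  \<comment> \<open>The locally constant sign may sit inside the differentiated function, and the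
    factor \<open>?r\<close> makes it vanish outside \<open>K\<close>.\<close>
  define G where "G \<sigma> x = ?s x * (?r x * H \<sigma> x)" for \<sigma> x
  have r_C1: "C1_on ?S ?r" using f c by (simp add: C1_function_def)
  have G_C1: "C1_on ?S (G \<sigma>)" for \<sigma>
    unfolding G_def[abs_def]
    by (intro C1_on_mult r_C1 H_C1) (rule C1_onI[OF s_deriv], auto)
  have G_deriv: "dir_deriv (G \<sigma>) x u = ?s x * (dir_deriv ?r x u * H \<sigma> x + ?r x * H' \<sigma> x u)" if x: "x \<in> ?S" for \<sigma> x u
  proof -
    have "(G \<sigma> has_derivative (\<lambda>u. ?s x * (?r x * H' \<sigma> x u + dir_deriv ?r x u * H \<sigma> x) + 0 * (?r x * H \<sigma> x))) (at x)"
      unfolding G_def[abs_def]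
      by (rule has_derivative_mult[OF s_deriv[OF x] has_derivative_mult[OF C1_on_has_derivative[OF r_C1 x] H_deriv[OF x]]])
    from dir_deriv_eq[OF this] show ?thesis by (simp add: add.commute)
  qed
  have G_int: "set_integrable lborel ?S (\<lambda>x. dir_deriv (G \<sigma>) x u)" "(LINT x:?S|lborel. dir_deriv (G \<sigma>) x u) = 0" for \<sigma> u
    using set_integral_dir_deriv_eq_0[OF open_coord_dom[OF c] G_C1 K] supp by (simp_all add: G_def)
  \<comment> \<open>Differentiating \<open>?r\<close> gives the \<open>flux_form\<close> term;
    differentiating \<open>H\<close> gives the volume term through
    \<open>divergence_identity\<close>.\<close>
  have pointwise: "(\<Sum>\<sigma>\<in>?P. of_int (sign \<sigma>) * dir_deriv (G \<sigma>) x (?e \<sigma> 0)) = ?s x * flux c f x" if x: "x \<in> ?S" for x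
  proof -
    have div: "(\<Sum>\<sigma>\<in>?P. of_int (sign \<sigma>) * H' \<sigma> x (?e \<sigma> 0)) = - volume c x / 2"
      unfolding H'_def volume_def
    proof (rule divergence_identity)
      show "dir_deriv (\<lambda>y. b c y v) x u = dir_deriv (\<lambda>y. b c y u) x v" for u v
        using b_closed[OF c x, of u v] by (simp add: curl_def)
      show "dir_deriv (\<lambda>y. l c y v) x u - dir_deriv (\<lambda>y. l c y u) x v = ?w x u v" for u v
        by (simp add: curl_def)
      show "dir_deriv (\<lambda>y. ?w y v z) x u + dir_deriv (\<lambda>y. ?w y z u) x v + dir_deriv (\<lambda>y. ?w y u v) x z = 0" for u v z
        by (rule l.curl_closed[OF x])
    qed
    have "(\<Sum>\<sigma>\<in>?P. of_int (sign \<sigma>) * dir_deriv (G \<sigma>) x (?e \<sigma> 0))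
      = ?s x * ((\<Sum>\<sigma>\<in>?P. of_int (sign \<sigma>) * (dir_deriv ?r x (?e \<sigma> 0) * H \<sigma> x))
          + ?r x * (\<Sum>\<sigma>\<in>?P. of_int (sign \<sigma>) * H' \<sigma> x (?e \<sigma> 0)))"
      by (simp add: G_deriv[OF x] sum_distrib_left sum.distrib[symmetric] algebra_simps)
    also have "(\<Sum>\<sigma>\<in>?P. of_int (sign \<sigma>) * (dir_deriv ?r x (?e \<sigma> 0) * H \<sigma> x))
      = flux_form m (dir_deriv ?r x) (b c x) (l c x) (?w x) basis_enum"
      unfolding flux_form_def alternate_def H_def ..
    finally show ?thesis unfolding div flux_def by simp
  qed
  have ind: "indicator ?S x *\<^sub>R (?s x * flux c f x)
      = (\<Sum>\<sigma>\<in>?P. of_int (sign \<sigma>) * (indicator ?S x *\<^sub>R dir_deriv (G \<sigma>) x (?e \<sigma> 0)))" for x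
    by (cases "x \<in> ?S") (simp_all add: pointwise[symmetric])
  have int: "integrable lborel (\<lambda>x. of_int (sign \<sigma>) * (indicator ?S x *\<^sub>R dir_deriv (G \<sigma>) x (?e \<sigma> 0)))" for \<sigma>
    using G_int(1)[of \<sigma> "?e \<sigma> 0"] unfolding set_integrable_def by (rule integrable_mult_right)
  have zero: "(LINT x|lborel. of_int (sign \<sigma>) * (indicator ?S x *\<^sub>R dir_deriv (G \<sigma>) x (?e \<sigma> 0))) = 0" for \<sigma>
    using G_int(2)[of \<sigma> "?e \<sigma> 0"] unfolding set_lebesgue_integral_def by simp
  have "(LINT x|lborel. (\<Sum>\<sigma>\<in>?P. of_int (sign \<sigma>) * (indicator ?S x *\<^sub>R dir_deriv (G \<sigma>) x (?e \<sigma> 0))))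
     = (\<Sum>\<sigma>\<in>?P. LINT x|lborel. of_int (sign \<sigma>) * (indicator ?S x *\<^sub>R dir_deriv (G \<sigma>) x (?e \<sigma> 0)))"
    by (rule Bochner_Integration.integral_sum) (rule int)
  then have "(LINT x|lborel. (\<Sum>\<sigma>\<in>?P. of_int (sign \<sigma>) * (indicator ?S x *\<^sub>R dir_deriv (G \<sigma>) x (?e \<sigma> 0)))) = 0"
    by (simp only: zero sum.neutral_const)
  moreover have "integrable lborel (\<lambda>x. \<Sum>\<sigma>\<in>?P. of_int (sign \<sigma>) * (indicator ?S x *\<^sub>R dir_deriv (G \<sigma>) x (?e \<sigma> 0)))"
    by (rule Bochner_Integration.integrable_sum) (rule int)
  ultimately show ?thesis
    unfolding set_integrable_def set_lebesgue_integral_def ind by blast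
qed

lemma no_closed_contact_pair: False
proof (rule no_exact_volume_form)
  show "continuous_on (coord_dom c) (volume c)" if "c \<in> A" for c
    by (rule continuous_on_volume[OF that])
  show "volume c x \<noteq> 0" if "c \<in> A" "x \<in> coord_dom c" for c x
    using volume_nz[OF that] by (simp add: volume_def)
  show "volume c x = jacobian (dir_deriv (transition c c') x) * volume c' (transition c c' x)"
    if "c \<in> A" "c' \<in> A" "x \<in> overlap c c'" for c c' x
    by (rule volume_trans[OF that])
  show "continuous_on (coord_dom c) (flux c f)" if "c \<in> A" "C1_function A f" for c f
    by (rule continuous_on_flux[OF that])
  show "flux c f x = jacobian (dir_deriv (transition c c') x) * flux c' f (transition c c' x)"
    if "c \<in> A" "c' \<in> A" "C1_function A f" "x \<in> overlap c c'" for c c' f x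
    by (rule flux_trans[OF that])
  show "flux c f (snd c p) = 0"
    if "c \<in> A" "openin T V" "p \<in> V" "p \<in> fst c" "\<And>q. q \<in> V \<Longrightarrow> f q = 0" for c f p V
    by (rule flux_local[OF that])
  show "set_integrable lborel (coord_dom c) (\<lambda>x. sgn (volume c x) * flux c f x) \<and>
      (LINT x:coord_dom c|lborel. sgn (volume c x) * flux c f x) = 0"
    if "c \<in> A" "C1_function A f" "compact K" "K \<subseteq> coord_dom c"
      "\<And>x. x \<in> coord_dom c - K \<Longrightarrow> in_chart c f x = 0" for c f K
    by (rule flux_integral[OF that])
  show "(\<Sum>i<N. flux c (\<rho> i) x) = (- 1 / 2) * volume c x"
    if "c \<in> A" "x \<in> coord_dom c" "\<And>i. i < N \<Longrightarrow> C1_function A (\<rho> i)"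
      "\<And>p. p \<in> topspace T \<Longrightarrow> (\<Sum>i<N. \<rho> i p) = 1" for c x N and \<rho> :: "nat \<Rightarrow> 'a \<Rightarrow> real"
    by (rule flux_sum[OF that])
  show "- 1 / 2 \<noteq> (0::real)" by simp
qed

end

text \<open>Any list of vectors is the image of the basis under a linear map, which multiplies the
  value of a top form by its determinant.\<close>

lemma alternating_form_top_eq_0:
  fixes a :: "'e::euclidean_space mform"
  assumes a: "alternating_form DIM('e) a" and zero: "a basis_enum = 0"
  shows "a v = 0"
proof -
  define L where "L x = (\<Sum>i<DIM('e). (x \<bullet> basis_enum i) *\<^sub>R v i)" for x :: 'e
  have lin: "linear L"
    by (rule linearI) (simp_all add: L_def inner_left_distrib scaleR_left_distrib sum.distrib scaleR_sum_right)
  have "L (basis_enum j) = v j" if j: "j < DIM('e)" for j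
  proof -
    have "(basis_enum j :: 'e) \<bullet> basis_enum i = (if i = j then 1 else 0)" if "i < DIM('e)" for i
      using basis_idx_eq_iff[OF j that] by (auto simp: basis_enum_def inner_basis_vec)
    then have "L (basis_enum j) = (\<Sum>i<DIM('e). if i = j then v i else 0)"
      unfolding L_def by (intro sum.cong) auto
    then show ?thesis using j by simp
  qed
  then have "a v = a (\<lambda>i. L (basis_enum i))"
    by (intro alternating_form_cong[OF a]) simp
  also have "\<dots> = 0" by (simp add: alternating_form_jacobian[OF a lin] zero)
  finally show ?thesis .
qed

section \<open>Basic cohomology of the Reeb foliation\<close>

text \<open>A 1-form reads entry 0 only, so constant sequences present it as a function of one
  vector.\<close>

abbreviation one_form :: "('a, 'e) dform \<Rightarrow> ('a, 'e) chart \<Rightarrow> 'e \<Rightarrow> 'e \<Rightarrow> real" where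
  "one_form \<omega> c x v \<equiv> \<omega> c x (\<lambda>_. v)"

context closed_atlas
begin

lemma forms_1_apply:
  assumes "\<omega> \<in> forms A 1"
  shows "\<omega> c x v = one_form \<omega> c x (v 0)"
proof (cases "c \<in> A \<and> x \<in> coord_dom c")
  case True
  then have "alternating_form 1 (\<omega> c x)" using assms by (simp add: forms_def)
  then show ?thesis by (rule alternating_form_cong) simp
next
  case False
  then have "\<omega> c x = 0" using assms unfolding forms_def by blast
  then show ?thesis by simp
qed

lemma one_form_on_forms:
  assumes \<omega>: "\<omega> \<in> forms A 1" and c: "c \<in> A"
  shows "one_form_on (coord_dom c) (one_form \<omega> c)"
proof (rule one_form_on.intro)
  show "open (coord_dom c)" by (rule open_coord_dom[OF c])
  show "linear (one_form \<omega> c x)" if "x \<in> coord_dom c" for x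
  proof -
    have "alternating_form 1 (\<omega> c x)" using \<omega> c that by (simp add: forms_def)
    from alternating_form_linear[OF this, of 0 "\<lambda>_. 0"]
    have "linear (\<lambda>v. \<omega> c x ((\<lambda>_. 0)(0 := v)))" by simp
    moreover have "\<omega> c x ((\<lambda>_. 0)(0 := v)) = one_form \<omega> c x v" for v
      using forms_1_apply[OF \<omega>, of c x "(\<lambda>_. 0)(0 := v)"] by simp
    ultimately show ?thesis by simp
  qed
  show "smooth_on (coord_dom c) (\<lambda>x. one_form \<omega> c x v)" for v
    using \<omega> c by (simp add: forms_def)
qed

lemma one_form_trans:
  assumes "\<omega> \<in> forms A 1" "c \<in> A" "c' \<in> A" "x \<in> overlap c c'"
  shows "one_form \<omega> c x v = one_form \<omega> c' (transition c c' x) (dir_deriv (transition c c') x v)"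
proof -
  have "\<omega> c x = pullback (transition c c') (\<omega> c') x"
    using assms unfolding forms_def overlap_def by blast
  then show ?thesis by (simp add: pullback_def)
qed

lemma ext_deriv_1_apply:
  fixes v :: "nat \<Rightarrow> 'e"
  assumes \<omega>: "\<omega> \<in> forms A 1" and "c \<in> A" "x \<in> coord_dom c"
  shows "ext_deriv A 1 \<omega> c x v = curl (one_form \<omega> c) x (v 0) (v 1)"
proof -
  have 0: "\<omega> c y (\<lambda>j. v (Suc j)) = one_form \<omega> c y (v 1)" for y
    using forms_1_apply[OF \<omega>, of c y "\<lambda>j. v (Suc j)"] by simp
  have 1: "\<omega> c y (\<lambda>j. if j = 0 then v j else v (Suc j)) = one_form \<omega> c y (v 0)" for y
    using forms_1_apply[OF \<omega>, of c y "\<lambda>j. if j = 0 then v j else v (Suc j)"] by simp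
  show ?thesis
    using assms(2,3) 0 1 by (simp add: ext_deriv_def ext_deriv_at_def curl_def atMost_Suc)
qed

lemma ext_deriv_forms:
  assumes \<omega>: "\<omega> \<in> forms A 1"
  shows "ext_deriv A 1 \<omega> \<in> forms A 2"
  unfolding forms_def mem_Collect_eq
proof (intro conjI allI ballI impI)
  fix c x assume "\<not> (c \<in> A \<and> x \<in> coord_dom c)"
  then show "ext_deriv A 1 \<omega> c x = 0" by (auto simp: ext_deriv_def)
next
  fix c x assume c: "c \<in> A" and x: "x \<in> coord_dom c"
  interpret one_form_on "coord_dom c" "one_form \<omega> c" by (rule one_form_on_forms[OF \<omega> c])
  have "multilinear 2 (\<lambda>v. curl (one_form \<omega> c) x (v 0) (v 1))"
    by (rule multilinear_2) (rule linear_curl[OF x])+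
  then have "multilinear 2 (ext_deriv A 1 \<omega> c x)"
    using ext_deriv_1_apply[OF \<omega> c x] by presburger
  moreover have "ext_deriv A 1 \<omega> c x v = 0" if "i < 2" "j < 2" "i \<noteq> j" "v i = v j" for v i j
  proof -
    have "v 0 = v 1" using that by (auto simp: less_2_cases_iff)
    then show ?thesis using ext_deriv_1_apply[OF \<omega> c x, of v] by (simp add: curl_def)
  qed
  ultimately show "alternating_form 2 (ext_deriv A 1 \<omega> c x)"
    unfolding alternating_form_def multilinear_def by blast
next
  fix c and v :: "nat \<Rightarrow> 'e" assume c: "c \<in> A"
  interpret one_form_on "coord_dom c" "one_form \<omega> c" by (rule one_form_on_forms[OF \<omega> c])
  have "smooth_on (coord_dom c) (\<lambda>x. curl (one_form \<omega> c) x (v 0) (v 1))" by (rule smooth_on_curl)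
  moreover have eq: "curl (one_form \<omega> c) x (v 0) (v 1) = ext_deriv A 1 \<omega> c x v" if "x \<in> coord_dom c" for x
    by (rule ext_deriv_1_apply[OF \<omega> c that, symmetric])
  ultimately show "smooth_on (coord_dom c) (\<lambda>x. ext_deriv A 1 \<omega> c x v)"
    unfolding smooth_on_def using Ck_on_cong[OF open_S eq] by simp
next
  fix c c' x assume c: "c \<in> A" "c' \<in> A" and "x \<in> snd c ` (fst c \<inter> fst c')"
  then have x: "x \<in> overlap c c'" by (simp add: overlap_def)
  have y: "transition c c' x \<in> coord_dom c'" by (rule transition_in_coord_dom[OF c(1) x])
  have x': "x \<in> coord_dom c" by (rule subsetD[OF overlap_subset x])
  have "curl (one_form \<omega> c) x u v = curl (one_form \<omega> c') (transition c c' x)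
      (dir_deriv (transition c c') x u) (dir_deriv (transition c c') x v)" for u v
    by (rule curl_pullback[OF one_form_on_forms[OF \<omega> c(1)] one_form_on_forms[OF \<omega> c(2)]
        smooth_transition[OF c] open_overlap[OF c] overlap_subset _ one_form_trans[OF \<omega> c] x])
      (use transition_in_coord_dom[OF c(1)] in blast)
  then show "ext_deriv A 1 \<omega> c x = pullback (transition c c') (ext_deriv A 1 \<omega> c') x"
    by (simp add: fun_eq_iff pullback_def ext_deriv_1_apply[OF \<omega> c(1) x'] ext_deriv_1_apply[OF \<omega> c(2) y] del: One_nat_def)
qed

lemma ext_deriv_ext_deriv:
  assumes \<omega>: "\<omega> \<in> forms A 1"
  shows "ext_deriv A 2 (ext_deriv A 1 \<omega>) = 0"
proof -
  have "ext_deriv_at 2 (ext_deriv A 1 \<omega> c) x v = 0" if c: "c \<in> A" and x: "x \<in> coord_dom c" for c x v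
  proof -
    interpret one_form_on "coord_dom c" "one_form \<omega> c" by (rule one_form_on_forms[OF \<omega> c])
    let ?w = "curl (one_form \<omega> c)"
    have D: "dir_deriv (\<lambda>y. ext_deriv A 1 \<omega> c y u) x = dir_deriv (\<lambda>y. ?w y (u 0) (u 1)) x" for u
      by (rule dir_deriv_cong_open[OF open_S x]) (rule ext_deriv_1_apply[OF \<omega> c])
    \<comment> \<open>The middle term of the exterior derivative is minus the derivative of
      \<open>?w\<close> at the pair 0, 2, while \<open>curl_closed\<close> has the cyclic order 2,
      0.\<close>
    have "dir_deriv (\<lambda>y. ?w y (v 2) (v 0)) x = dir_deriv (\<lambda>y. - ?w y (v 0) (v 2)) x"
      using curl_skew[of "one_form \<omega> c" _ "v 2" "v 0"] by simp
    also have "\<dots> = (\<lambda>u. - dir_deriv (\<lambda>y. ?w y (v 0) (v 2)) x u)"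
      by (rule dir_deriv_eq[OF has_derivative_minus[OF smooth_on_has_derivative[OF smooth_on_curl x]]])
    finally have skew: "dir_deriv (\<lambda>y. ?w y (v 2) (v 0)) x (v 1) = - dir_deriv (\<lambda>y. ?w y (v 0) (v 2)) x (v 1)"
      by simp
    have "ext_deriv_at 2 (ext_deriv A 1 \<omega> c) x v = dir_deriv (\<lambda>y. ?w y (v 1) (v 2)) x (v 0)
        - dir_deriv (\<lambda>y. ?w y (v 0) (v 2)) x (v 1) + dir_deriv (\<lambda>y. ?w y (v 0) (v 1)) x (v 2)"
      unfolding ext_deriv_at_def D by (simp add: numeral_2_eq_2)
    then show ?thesis using curl_closed[OF x, of "v 1" "v 2" "v 0"] skew by simp
  qed
  then show ?thesis
    by (auto simp: fun_eq_iff ext_deriv_def)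
qed

text \<open>The Reeb distribution is by definition the kernel of \<open>ext_deriv A 1 lam\<close>,
  which settles the first contraction; the second contracts d d\<lambda> = 0.\<close>

lemma ext_deriv_basic_cocycle:
  assumes "lam \<in> forms A 1"
  shows "ext_deriv A 1 lam \<in> carrier (basic_cocycles A (reeb A lam) 2)"
  using ext_deriv_forms[OF assms] ext_deriv_ext_deriv[OF assms]
  by (auto simp: basic_cocycles_def basic_forms_def reeb_def contraction_def fun_eq_iff)

lemma contact_form_not_basic_exact:
  assumes n: "n \<ge> 1" and contact: "contact_form A n lam"
    and \<alpha>: "\<alpha> \<in> basic_forms A (reeb A lam) 1" and exact: "ext_deriv A 1 \<alpha> = ext_deriv A 1 lam"
  shows False
proof -
  \<comment> \<open>Writing \<open>n\<close> as a successor makes room for \<lambda> beside \<beta>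
    in the primitive of the volume form.\<close>
  obtain m where m: "n = Suc m" using n by (cases n) auto
  have dim: "DIM('e) = 2 * n + 1" and lam: "lam \<in> forms A 1"
    and nondeg: "\<And>c x. c \<in> A \<Longrightarrow> x \<in> coord_dom c \<Longrightarrow>
      wedge 1 (2 * n) (lam c x) (wedge_power 2 (ext_deriv A 1 lam c x) n) \<noteq> 0"
    using contact by (auto simp: contact_form_def)
  have \<alpha>_form: "\<alpha> \<in> forms A 1" using \<alpha> by (simp add: basic_forms_def)
  let ?l = "one_form lam" and ?a = "one_form \<alpha>"
  let ?b = "\<lambda>c x v. ?l c x v - ?a c x v"
  have curl_eq: "curl (?a c) x u v = curl (?l c) x u v" if "c \<in> A" "x \<in> coord_dom c" for c x u v
  proof -
    have "curl (one_form \<omega> c) x u v = ext_deriv A 1 \<omega> c x (case_nat u (\<lambda>_. v))" if "\<omega> \<in> forms A 1" for \<omega>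
      unfolding ext_deriv_1_apply[OF that \<open>c \<in> A\<close> \<open>x \<in> coord_dom c\<close>] by simp
    from this[OF \<alpha>_form] this[OF lam] show ?thesis unfolding exact by (rule trans[OF _ sym])
  qed
  have "closed_contact_pair T A m ?l ?b"
  proof (rule closed_contact_pair.intro[OF closed_atlas_axioms], rule closed_contact_pair_axioms.intro)
    show "DIM('e) = 2 * m + 3" using dim m by simp
  next
    fix c assume c: "c \<in> A"
    interpret l: one_form_on "coord_dom c" "?l c" by (rule one_form_on_forms[OF lam c])
    interpret a: one_form_on "coord_dom c" "?a c" by (rule one_form_on_forms[OF \<alpha>_form c])
    show "one_form_on (coord_dom c) (?l c)" by (rule one_form_on_forms[OF lam c])
    show "one_form_on (coord_dom c) (?b c)"
    proof (rule one_form_on.intro)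
      show "open (coord_dom c)" by (rule l.open_S)
      show "linear (?b c x)" if "x \<in> coord_dom c" for x
        by (rule linear_compose_sub[OF l.linear_form[OF that] a.linear_form[OF that]])
      show "smooth_on (coord_dom c) (\<lambda>x. ?b c x v)" for v
        by (rule smooth_on_diff[OF l.open_S l.smooth_form a.smooth_form])
    qed
    fix x assume x: "x \<in> coord_dom c"
    have D: "dir_deriv (\<lambda>y. ?b c y v) x u = dir_deriv (\<lambda>y. ?l c y v) x u - dir_deriv (\<lambda>y. ?a c y v) x u" for u v
      using dir_deriv_eq[OF has_derivative_diff[OF smooth_on_has_derivative[OF l.smooth_form x]
            smooth_on_has_derivative[OF a.smooth_form x]]] by simp
    show "curl (?b c) x u v = 0" for u v
      using curl_eq[OF c x, of u v] by (simp add: curl_def D)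
    let ?w = "curl (?l c) x"
    have alt1: "alternating_form 1 (lam c x)" and alt2: "alternating_form 2 (ext_deriv A 1 lam c x)"
      using lam ext_deriv_forms[OF lam] c x by (simp_all add: forms_def)
    obtain v where "wedge 1 (2 * n) (lam c x) (wedge_power 2 (ext_deriv A 1 lam c x) n) v \<noteq> 0"
      using nondeg[OF c x] by (auto simp: fun_eq_iff)
    then have v: "contact_volume n (?l c x) ?w v \<noteq> 0"
      unfolding wedge_contact_volume[OF alt1 alt2] ext_deriv_1_apply[OF lam c x] by simp
    \<comment> \<open>Nondegeneracy provides some non-zero value; for a top form this forces a
      non-zero value on the numbered basis.\<close>
    have "alternating_form DIM('e) (contact_volume n (?l c x) ?w)"
      unfolding dim by (intro alternating_form_contact_volume l.linear_form l.linear_curl x)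
    then have l_volume: "contact_volume n (?l c x) ?w basis_enum \<noteq> 0"
      using alternating_form_top_eq_0 v by blast
    have odd: "odd DIM('e)" using dim by simp
    obtain X where X: "X \<noteq> 0" "\<And>u. ?w X u = 0" "\<And>u. ?w u X = 0"
      by (rule odd_dim_skew_kernel[OF l.linear_curl(2)[OF x] curl_skew[of "?l c" x] odd]) (rule that; assumption)
    \<comment> \<open>The kernel vector is tangent to the Reeb foliation, so basicness of \<alpha>
      makes \<alpha> vanish on it.\<close>
    have "X \<in> reeb A lam c x"
      unfolding reeb_def contraction_def by (simp add: fun_eq_iff ext_deriv_1_apply[OF lam c x] X del: One_nat_def)
    then have "contraction 1 X (\<alpha> c x) = 0"
      using \<alpha> c x by (simp add: basic_forms_def)
    then have "\<alpha> c x (case_nat X (\<lambda>_. X)) = 0"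
      by (simp add: contraction_def fun_eq_iff)
    then have aX: "?a c x X = 0"
      using forms_1_apply[OF \<alpha>_form, of c x "case_nat X (\<lambda>_. X)"] by simp
    have "contact_volume n (?a c x) ?w basis_enum = 0"
      by (rule contact_volume_kernel[OF a.linear_form[OF x] l.linear_curl[OF x] dim X(1) aX X(2,3)])
    then show "contact_volume (Suc m) (?b c x) ?w basis_enum \<noteq> 0"
      using l_volume by (simp add: contact_volume_diff m)
  next
    fix c c' x v assume "c \<in> A" "c' \<in> A" "x \<in> overlap c c'"
    note tr = one_form_trans[OF _ this]
    show "?l c x v = ?l c' (transition c c' x) (dir_deriv (transition c c') x v)" by (rule tr[OF lam])
    then show "?b c x v = ?b c' (transition c c' x) (dir_deriv (transition c c') x v)"
      using tr[OF \<alpha>_form] by simp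
  qed
  then show False by (rule closed_contact_pair.no_closed_contact_pair)
qed

text \<open>Since 0 is a coboundary, d\<lambda> belongs to its own coset; if that coset is the
  trivial one, d\<lambda> is the derivative of a basic 1-form.\<close>

lemma zero_in_basic_coboundaries: "0 \<in> basic_coboundaries A D 2"
proof -
  have alt: "alternating_form k (0 :: 'e mform)" for k
    by (simp add: alternating_form_def linear_zero)
  have const: "smooth_on S (\<lambda>_::'e. 0::real)" for S
  proof -
    have "Ck_on k S (\<lambda>_::'e. 0::real)" for k
    proof (induction k)
      case (Suc k)
      have "dir_deriv (\<lambda>_::'e. 0::real) x = (\<lambda>_. 0)" for x by (rule dir_deriv_eq) simp
      then show ?case using Suc by simp
    qed simp
    then show ?thesis by (simp add: smooth_on_def)
  qed
  have "dir_deriv (\<lambda>_::'e. 0::real) x = (\<lambda>_. 0)" for x by (rule dir_deriv_eq) simp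
  then have d0: "ext_deriv A 1 0 = (0 :: ('a, 'e) dform)"
    by (simp add: fun_eq_iff ext_deriv_def ext_deriv_at_def)
  have "(0 :: ('a, 'e) dform) \<in> forms A 1"
    by (simp add: forms_def alt const pullback_def fun_eq_iff)
  then have "(0 :: ('a, 'e) dform) \<in> basic_forms A D 1"
    by (simp add: basic_forms_def contraction_def fun_eq_iff d0 del: One_nat_def)
  then have "ext_deriv A 1 0 \<in> ext_deriv A 1 ` basic_forms A D 1" by (rule imageI)
  then show ?thesis
    unfolding d0 by (simp add: basic_coboundaries_def numeral_2_eq_2)
qed

end

theorem theorem5p1:
  fixes T :: "'a topology"
    and A :: "('a, 'e::euclidean_space) chart set"
    and lam :: "('a, 'e) dform"
    and n :: nat
  assumes "closed_manifold T A"
    and "n \<ge> 1"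
    and "contact_form A n lam"
  shows "basic_class A (reeb A lam) 2 (ext_deriv A 1 lam)
           \<in> carrier (basic_cohomology A (reeb A lam) 2)
       \<and> basic_class A (reeb A lam) 2 (ext_deriv A 1 lam)
           \<noteq> \<one>\<^bsub>basic_cohomology A (reeb A lam) 2\<^esub>"
proof
  interpret closed_atlas T A by standard fact
  let ?D = "reeb A lam" and ?w = "ext_deriv A 1 lam"
  have lam: "lam \<in> forms A 1" using assms(3) by (simp add: contact_form_def)
  show "basic_class A ?D 2 ?w \<in> carrier (basic_cohomology A ?D 2)"
    using ext_deriv_basic_cocycle[OF lam]
    by (auto simp: basic_class_def basic_cohomology_def carrier_FactGroup)
  show "basic_class A ?D 2 ?w \<noteq> \<one>\<^bsub>basic_cohomology A ?D 2\<^esub>"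
  proof
    assume "basic_class A ?D 2 ?w = \<one>\<^bsub>basic_cohomology A ?D 2\<^esub>"
    then have "basic_coboundaries A ?D 2 #>\<^bsub>basic_cocycles A ?D 2\<^esub> ?w = basic_coboundaries A ?D 2"
      by (simp add: basic_class_def basic_cohomology_def)
    moreover have "0 + ?w \<in> basic_coboundaries A ?D 2 #>\<^bsub>basic_cocycles A ?D 2\<^esub> ?w"
      using zero_in_basic_coboundaries by (force simp: r_coset_def basic_cocycles_def)
    ultimately have "?w \<in> basic_coboundaries A ?D 2" by simp
    then obtain \<alpha> where \<alpha>: "\<alpha> \<in> basic_forms A ?D 1" "?w = ext_deriv A 1 \<alpha>"
      by (auto simp: basic_coboundaries_def numeral_2_eq_2)
    then show False
      using contact_form_not_basic_exact[OF assms(2,3) \<alpha>(1) \<alpha>(2)[symmetric]] by blast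
  qed
qed

end
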